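(* Let $k\ge l\ge0$ be integers. For each $n\ge1$ define $f_i=f_i^{(n)}(w_1,w_2)$ by $$\Big(\Big(\sum_{m=0}^{l}S_m(x+y)z^{-l-1+m}\Big)w_1+\Big(\sum_{m=0}^{k}S_m(x+y)z^{-k-1+m}\Big)w_2\Big)^n=\sum_{i=0}^{n(l+k+1)}f_i^{(n)}(w_1,w_2)\,z^{-n(l+k+2)+i},$$ let $$p_n=\sum_{i=0}^{n(l+k+1)}f_i^{(n)}(w_1,w_2)\,(n(l+k+2)-i)\,x_{n(l+k+2)-i},$$ and let $f(w_1,w_2)=\exp\big(-\sum_{n\ge1}\frac{p_n}{n}\big)$. Put $A_{s,t}=\sum_{m=0}^{t}S_m(x+y)S_{s+t-m}(-x-y)$ for $s\geq 1$, $t\geq 0$. Then: (1) $$\exp\Big(\sum_{i\ge1}\frac{\partial x_i-\partial y_i}{i}z^{-i}\Big)f(w_1,w_2)=\Big(1-\Big(\sum_{m=0}^{l}S_m(x+y)z^{-l-1+m}\Big)w_1-\Big(\sum_{m=0}^{k}S_m(x+y)z^{-k-1+m}\Big)w_2\Big)f(w_1,w_2);$$ (2) $$\exp(b\varphi^*_{-k})\exp(a\varphi^*_{-l})\cdot1=f(-ap,-bp);$$ (3) for all integers $i,j\ge1$, with $D=1-cA_{i,l}-dA_{j,k}+cA_{i,l}\,dA_{j,k}-cA_{i,k}\,dA_{j,l}$, $$\exp(d\varphi_{-j}\varphi^*_{-k})\exp(c\varphi_{-i}\varphi^*_{-l})\cdot1=\frac1D\,f\Big(\frac{N_1}{D},\frac{N_2}{D}\Big),$$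 where $$N_1=-cS_{i-1}(-x-y)+cS_{i-1}(-x-y)\,dA_{j,k}-dS_{j-1}(-x-y)\,cA_{i,k},$$ $$N_2=-dS_{j-1}(-x-y)+dS_{j-1}(-x-y)\,cA_{i,l}-cS_{i-1}(-x-y)\,dA_{j,l}.$$ Here $a,b,c,d$ are arbitrary scalar parameters.
   Context: Let $x=(x_1,x_2,\dots)$, $y=(y_1,y_2,\dots)$ and $p$ be formal variables and let $\mathcal{B}=\mathbb{C}[[x,y;p,p^{-1}]]$ be the (completed) bosonic Fock space; $w_1,w_2,z$ are further formal variables. Write $\partial x_n=\partial/\partial x_n$, $\partial y_n=\partial/\partial y_n$, $\partial p=\partial/\partial p$. The operators $\varphi_i,\varphi^*_i$ ($i\in\mathbb{Z}$) on $\mathcal{B}$ are defined by the generating series $\varphi(z)=\sum_{i\in\mathbb{Z}}\varphi_iz^{-i-1}$ and $\varphi^*(z)=\sum_{i\in\mathbb{Z}}\varphi^*_iz^{-i}$, where $$\varphi^{*}(z)=p\exp\Big(\sum_{n>0}(x_n+y_n)z^n\Big)\Big(\sum_{k>0}kx_kz^{k-1}+\sum_{k>0}\partial x_k\,z^{-k-1}+p\,\partial p\,z^{-1}\Big)\exp\Big(-\sum_{n>0}(\partial x_n-\partial y_n)\tfrac{z^{-n}}{n}\Big),$$ $$\varphi(z)=p^{-1}\exp\Big(-\sum_{n>0}(x_n+y_n)z^n\Big)\exp\Big(\sum_{n>0}(\partial x_n-\partial y_n)\tfrac{z^{-n}}{n}\Big).$$ They satisfy $[\varphi_i,\varphi^*_j]=\delta_{i,-j}$,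 $[\varphi_i,\varphi_j]=[\varphi^*_i,\varphi^*_j]=0$, and $1\in\mathcal{B}$ is a vacuum vector: $\varphi_i\cdot1=\varphi^*_{i+1}\cdot1=0$ for $i\ge0$. For a sequence $t=(t_1,t_2,\dots)$ the elementary Schur polynomials $S_k(t)$ are defined by $\sum_{k\ge0}S_k(t)w^k=\exp(\sum_{n\ge1}t_nw^n)$ (and $S_k=0$ for $k<0$); $S_k(x+y)$ and $S_k(-x-y)$ are the values at $t_n=x_n+y_n$ and $t_n=-x_n-y_n$. Operator exponentials are the usual power series; all identities are identities of formal power series. *)

theory Defs
  imports Complex_Main "HOL-Library.Multiset" "HOL-Computational_Algebra.Formal_Power_Series"
begin

section \<open>Formal power series in arbitrarily many variables\<close>

text \<open>
  Monomials in the variables \<open>'v\<close> are finite multisets of variables, so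
  \<open>{#v, v, w#}\<close> is \<open>v^2 w\<close>. A series is an arbitrary family of coefficients;
  there may be infinitely many variables.
\<close>

typedef ('v, 'a) mps = "UNIV :: ('v multiset \<Rightarrow> 'a) set"
  morphisms mps_coeff Abs_mps ..

setup_lifting type_definition_mps

lemma mps_eqI: "(\<And>M. mps_coeff f M = mps_coeff g M) \<Longrightarrow> f = g"
  by (simp add: mps_coeff_inject[symmetric] fun_eq_iff)

lemma finite_multiset_splits: "finite {(A, B). A + B = (M :: 'v multiset)}"
proof -
  have "finite {A. A \<subseteq># M}"
  proof (induction M)
    case (add x M)
    have "{A. A \<subseteq># add_mset x M} \<subseteq> {A. A \<subseteq># M} \<union> add_mset x ` {A. A \<subseteq># M}"
    proof
      fix A assume "A \<in> {A. A \<subseteq># add_mset x M}"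
      then have A: "A \<subseteq># add_mset x M" by simp
      show "A \<in> {A. A \<subseteq># M} \<union> add_mset x ` {A. A \<subseteq># M}"
      proof (cases "x \<in># A")
        case True
        then obtain B where "A = add_mset x B" by (metis insert_DiffM)
        with A show ?thesis by simp
      next
        case False
        have "count A y \<le> count M y" for y
          using mset_subset_eq_count[OF A, of y] False by (cases "y = x") (auto simp: not_in_iff)
        then show ?thesis by (simp add: subseteq_mset_def)
      qed
    qed
    with add show ?case by (meson finite_UnI finite_imageI finite_subset)
  qed simp
  moreover have "{(A, B). A + B = M} \<subseteq> {A. A \<subseteq># M} \<times> {A. A \<subseteq># M}" by auto
  ultimately show ?thesis by (meson finite_SigmaI finite_subset)
qed

instantiation mps :: (type, comm_ring_1) comm_ring_1
begin

lift_definition zero_mps :: "('a, 'b) mps" is "\<lambda>_. 0" .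
lift_definition one_mps :: "('a, 'b) mps" is "\<lambda>M. if M = {#} then 1 else 0" .
lift_definition plus_mps :: "('a, 'b) mps \<Rightarrow> ('a, 'b) mps \<Rightarrow> ('a, 'b) mps"
  is "\<lambda>f g M. f M + g M" .
lift_definition uminus_mps :: "('a, 'b) mps \<Rightarrow> ('a, 'b) mps" is "\<lambda>f M. - f M" .
lift_definition minus_mps :: "('a, 'b) mps \<Rightarrow> ('a, 'b) mps \<Rightarrow> ('a, 'b) mps"
  is "\<lambda>f g M. f M - g M" .
lift_definition times_mps :: "('a, 'b) mps \<Rightarrow> ('a, 'b) mps \<Rightarrow> ('a, 'b) mps"
  is "\<lambda>f g M. \<Sum>(A, B) | A + B = M. f A * g B" .

instance
proof
  fix a b c :: "('a, 'b) mps"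
  show "a + b + c = a + (b + c)" by transfer (simp add: add.assoc)
  show "a + b = b + a" by transfer (simp add: add.commute)
  show "0 + a = a" by transfer simp
  show "- a + a = 0" by transfer simp
  show "a - b = a + - b" by transfer simp
  show "(0 :: ('a, 'b) mps) \<noteq> 1" by transfer (auto simp: fun_eq_iff)
  show "(a + b) * c = a * c + b * c"
    by transfer (simp add: distrib_right sum.distrib case_prod_unfold)
  show "a * b = b * a"
  proof transfer
    fix f g :: "'a multiset \<Rightarrow> 'b"
    have "(\<Sum>(A, B) | A + B = M. f A * g B) = (\<Sum>(A, B) | A + B = M. g A * f B)" for M
      by (rule sum.reindex_bij_witness[of _ prod.swap prod.swap]) (auto simp: ac_simps)
    then show "(\<lambda>M. \<Sum>(A, B) | A + B = M. f A * g B) = (\<lambda>M. \<Sum>(A, B) | A + B = M. g A * f B)"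
      by simp
  qed
  show "1 * a = a"
  proof transfer
    fix f :: "'a multiset \<Rightarrow> 'b"
    have "(\<Sum>(A, B) | A + B = M. (if A = {#} then 1 else 0) * f B) = f M" for M
    proof -
      have "(\<Sum>(A, B) | A + B = M. (if A = {#} then 1 else 0) * f B) =
            (\<Sum>(A, B) \<in> {({#} :: 'a multiset, M)}. (if A = {#} then 1 else 0) * f B)"
        by (rule sum.mono_neutral_right) (auto simp: finite_multiset_splits split: if_splits)
      then show ?thesis by simp
    qed
    then show "(\<lambda>M. \<Sum>(A, B) | A + B = M. (if A = {#} then 1 else 0) * f B) = f" by auto
  qed
  show "a * b * c = a * (b * c)"
  proof transfer
    fix f g h :: "'a multiset \<Rightarrow> 'b"
    have "(\<Sum>(A, B) | A + B = M. (\<Sum>(C, D) | C + D = A. f C * g D) * h B) =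
          (\<Sum>(A, B) | A + B = M. f A * (\<Sum>(C, D) | C + D = B. g C * h D))" for M
    proof -
      have "(\<Sum>(A, B) | A + B = M. (\<Sum>(C, D) | C + D = A. f C * g D) * h B) =
            (\<Sum>p \<in> {(A, B). A + B = M}. \<Sum>q \<in> {(C, D). C + D = fst p}. f (fst q) * g (snd q) * h (snd p))"
        by (simp add: case_prod_unfold sum_distrib_right)
      also have "\<dots> = (\<Sum>(p, q) \<in> (SIGMA p:{(A, B). A + B = M}. {(C, D). C + D = fst p}).
                         f (fst q) * g (snd q) * h (snd p))"
        by (rule sum.Sigma) (auto simp: finite_multiset_splits)
      also have "\<dots> = (\<Sum>(p, q) \<in> (SIGMA p:{(A, B). A + B = M}. {(C, D). C + D = snd p}).
                         f (fst p) * (g (fst q) * h (snd q)))"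
        by (rule sum.reindex_bij_witness[of _
              "\<lambda>(p, q). ((fst p + fst q, snd q), (fst p, fst q))"
              "\<lambda>(p, q). ((fst q, snd q + snd p), (snd q, snd p))"]) (auto simp: ac_simps)
      also have "\<dots> = (\<Sum>p \<in> {(A, B). A + B = M}. \<Sum>q \<in> {(C, D). C + D = snd p}. f (fst p) * (g (fst q) * h (snd q)))"
        by (rule sum.Sigma[symmetric]) (auto simp: finite_multiset_splits)
      finally show ?thesis by (simp add: case_prod_unfold sum_distrib_left)
    qed
    then show "(\<lambda>M. \<Sum>(A, B) | A + B = M. (\<Sum>(C, D) | C + D = A. f C * g D) * h B) =
               (\<lambda>M. \<Sum>(A, B) | A + B = M. f A * (\<Sum>(C, D) | C + D = B. g C * h D))" by simp
  qed
qed

end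

instantiation mps :: (type, "{real_algebra_1, comm_ring_1}") real_algebra_1
begin

lift_definition scaleR_mps :: "real \<Rightarrow> ('a, 'b) mps \<Rightarrow> ('a, 'b) mps" is "\<lambda>r f M. r *\<^sub>R f M" .

instance
  by standard
    (transfer; simp add: scaleR_add_right scaleR_add_left scaleR_sum_right case_prod_unfold)+

end

lift_definition mps_const :: "'a :: comm_ring_1 \<Rightarrow> ('v, 'a) mps"
  is "\<lambda>c M. if M = {#} then c else 0" .

lift_definition mps_var :: "'v \<Rightarrow> ('v, 'a :: comm_ring_1) mps"
  is "\<lambda>v M. if M = {#v#} then 1 else 0" .

lift_definition mps_pderiv :: "'v \<Rightarrow> ('v, 'a :: comm_ring_1) mps \<Rightarrow> ('v, 'a) mps"
  is "\<lambda>v f M. of_nat (count M v + 1) * f (add_mset v M)" .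

lift_definition mps_map :: "('a :: comm_ring_1 \<Rightarrow> 'b :: comm_ring_1) \<Rightarrow> ('v, 'a) mps \<Rightarrow> ('v, 'b) mps"
  is "\<lambda>h f M. h (f M)" .

text \<open>
  Infinite sums are formal: every coefficient of the sum receives only finitely many
  nonzero contributions. When that fails, the sum has no meaning.
\<close>

definition formally_summable :: "('i \<Rightarrow> ('v, 'a :: comm_ring_1) mps) \<Rightarrow> bool" where
  "formally_summable F \<longleftrightarrow> (\<forall>M. finite {i. mps_coeff (F i) M \<noteq> 0})"

definition formal_sum :: "('i \<Rightarrow> ('v, 'a :: comm_ring_1) mps) \<Rightarrow> ('v, 'a) mps" where
  "formal_sum F = Abs_mps (\<lambda>M. \<Sum>i | mps_coeff (F i) M \<noteq> 0. mps_coeff (F i) M)"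

definition mps_exp :: "('v, 'a :: {real_algebra_1, comm_ring_1}) mps \<Rightarrow> ('v, 'a) mps" where
  "mps_exp g = formal_sum (\<lambda>n. (1 / fact n) *\<^sub>R g ^ n)"

text \<open>
  Substituting for each variable \<open>v\<close> an element \<open>s v\<close> of the coefficient ring, which is
  itself a ring of power series.
\<close>

definition subst_term ::
  "('v \<Rightarrow> ('u, 'a :: comm_ring_1) mps) \<Rightarrow> ('v, ('u, 'a) mps) mps \<Rightarrow> 'v multiset \<Rightarrow> ('u, 'a) mps" where
  "subst_term s f M = mps_coeff f M * (\<Prod>v\<in>#M. s v)"

definition subst ::
  "('v \<Rightarrow> ('u, 'a :: comm_ring_1) mps) \<Rightarrow> ('v, ('u, 'a) mps) mps \<Rightarrow> ('u, 'a) mps" where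
  "subst s f = formal_sum (subst_term s f)"

text \<open>
  The coefficient of \<open>w^m\<close> in \<open>exp (\<Sum>n\<ge>1. t n w^n)\<close>; the \<open>n\<close>-th power of the
  exponent is divisible by \<open>w^n\<close>, so only \<open>n \<le> m\<close> contributes.
\<close>

definition schur :: "(nat \<Rightarrow> 'a :: {real_algebra_1, comm_ring_1}) \<Rightarrow> nat \<Rightarrow> 'a" where
  "schur t m = (\<Sum>n\<le>m. (1 / fact n) *\<^sub>R fps_nth (Abs_fps (\<lambda>j. if j = 0 then 0 else t j) ^ n) m)"


section \<open>The bosonic Fock space\<close>

text \<open>
  \<open>Vx n\<close>, \<open>Vy n\<close> with \<open>n \<ge> 1\<close> are the variables; \<open>Vx 0\<close> and \<open>Vy 0\<close> are never used.
  A \<open>fock\<close> vector \<open>v\<close> stands for the doubly infinite series with coefficient \<open>v q\<close> at \<open>p^q\<close>.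
\<close>

datatype xyvar = Vx nat | Vy nat

type_synonym xyser = "(xyvar, complex) mps"
type_synonym fock = "int \<Rightarrow> xyser"

abbreviation xx :: "nat \<Rightarrow> xyser" where "xx n \<equiv> mps_var (Vx n)"
abbreviation yy :: "nat \<Rightarrow> xyser" where "yy n \<equiv> mps_var (Vy n)"

definition vacuum :: fock where
  "vacuum = (\<lambda>q. if q = 0 then 1 else 0)"

abbreviation Splus :: "nat \<Rightarrow> xyser" where
  "Splus \<equiv> schur (\<lambda>n. xx n + yy n)"

abbreviation Sminus :: "nat \<Rightarrow> xyser" where
  "Sminus \<equiv> schur (\<lambda>n. - xx n - yy n)"

text \<open>
  Power series in \<open>z^(-1)\<close> are of type \<open>_ fps\<close>, with \<open>fps_X\<close> standing for \<open>z^(-1)\<close>.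
  \<open>deriv_z\<close> is the operator \<open>\<Sum>i\<ge>1. (\<partial>x_i - \<partial>y_i) z^(-i) / i\<close>. It raises the order
  in \<open>z^(-1)\<close>, so that its \<open>n\<close>-th iterate contributes to the coefficient of \<open>z^(-m)\<close>
  only for \<open>n \<le> m\<close>. \<open>exp_deriv_z \<sigma> g\<close> is \<open>exp (\<sigma> deriv_z) g\<close>.
\<close>

definition deriv_z :: "xyser fps \<Rightarrow> xyser fps" where
  "deriv_z G = Abs_fps (\<lambda>m. \<Sum>i = 1..m.
     (1 / of_nat i) *\<^sub>R (mps_pderiv (Vx i) (fps_nth G (m - i)) - mps_pderiv (Vy i) (fps_nth G (m - i))))"

definition exp_deriv_z :: "real \<Rightarrow> xyser \<Rightarrow> xyser fps" where
  "exp_deriv_z \<sigma> g =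
     Abs_fps (\<lambda>m. \<Sum>n\<le>m. (\<sigma> ^ n / fact n) *\<^sub>R fps_nth ((deriv_z ^^ n) (fps_const g)) m)"

text \<open>
  A two-sided series \<open>V\<close> in \<open>z\<close> over the Fock space is a function with \<open>V r q\<close> the coefficient
  of \<open>z^r p^q\<close>. Below: the operator \<open>exp (\<sigma> \<Sum>i\<ge>1. (\<partial>x_i - \<partial>y_i) z^(-i) / i)\<close>;
  multiplication by \<open>exp (\<Sum>n\<ge>1. t n z^n)\<close>; and the operator
  \<open>\<Sum>k>0. k x_k z^(k-1) + \<Sum>k>0. \<partial>x_k z^(-k-1) + p \<partial>p z^(-1)\<close>.
\<close>

definition shift_op :: "real \<Rightarrow> fock \<Rightarrow> (int \<Rightarrow> fock)" where
  "shift_op \<sigma> v = (\<lambda>r q. if r \<le> 0 then fps_nth (exp_deriv_z \<sigma> (v q)) (nat (- r)) else 0)"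

definition exp_mult_op :: "(nat \<Rightarrow> xyser) \<Rightarrow> (int \<Rightarrow> fock) \<Rightarrow> (int \<Rightarrow> fock)" where
  "exp_mult_op t V = (\<lambda>r q. formal_sum (\<lambda>m. schur t m * V (r - int m) q))"

definition current_op :: "(int \<Rightarrow> fock) \<Rightarrow> (int \<Rightarrow> fock)" where
  "current_op V = (\<lambda>r q.
     formal_sum (\<lambda>k. if k > 0 then of_nat k * xx k * V (r - (int k - 1)) q else 0)
     + formal_sum (\<lambda>k. if k > 0 then mps_pderiv (Vx k) (V (r + int k + 1) q) else 0)
     + of_int q * V (r + 1) q)"

definition phi_z :: "fock \<Rightarrow> (int \<Rightarrow> fock)" where
  "phi_z v = (\<lambda>r q. exp_mult_op (\<lambda>n. - xx n - yy n) (shift_op 1 v) r (q + 1))"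

definition phistar_z :: "fock \<Rightarrow> (int \<Rightarrow> fock)" where
  "phistar_z v =
     (\<lambda>r q. exp_mult_op (\<lambda>n. xx n + yy n) (current_op (shift_op (- 1) v)) r (q - 1))"

text \<open>
  The infinite sums inside \<open>phi_z\<close> and \<open>phistar_z\<close> always make sense, because \<open>schur t m\<close> is
  homogeneous of weight \<open>m\<close> when \<open>x_n\<close> and \<open>y_n\<close> have weight \<open>n\<close>.
\<close>

definition weight :: "xyvar multiset \<Rightarrow> nat" where
  "weight M = (\<Sum>v\<in>#M. case v of Vx n \<Rightarrow> n | Vy n \<Rightarrow> n)"

definition homogeneous :: "nat \<Rightarrow> xyser \<Rightarrow> bool" where
  "homogeneous d f \<longleftrightarrow> (\<forall>M. mps_coeff f M \<noteq> 0 \<longrightarrow> weight M = d)"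

lemma mps_coeff_times:
  "mps_coeff (f * g) M = (\<Sum>(A, B) | A + B = M. mps_coeff f A * mps_coeff g B)"
  by transfer simp

lemma mps_coeff_times_nonzeroE:
  fixes f g :: "('v, 'a :: comm_ring_1) mps"
  assumes "mps_coeff (f * g) M \<noteq> 0"
  obtains A B where "M = A + B" "mps_coeff f A \<noteq> 0" "mps_coeff g B \<noteq> 0"
proof -
  obtain p where "p \<in> {(A, B). A + B = M}"
    "(case p of (A, B) \<Rightarrow> mps_coeff f A * mps_coeff g B) \<noteq> 0"
    using sum.not_neutral_contains_not_neutral[OF assms[unfolded mps_coeff_times]] by blast
  then show thesis by (intro that[of "fst p" "snd p"]) (cases p; auto)+
qed

lemma homogeneous_0: "homogeneous d 0"
  by (simp add: homogeneous_def zero_mps.rep_eq)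

lemma homogeneous_1: "homogeneous 0 1"
  by (simp add: homogeneous_def one_mps.rep_eq weight_def)

lemma homogeneous_add: "homogeneous d f \<Longrightarrow> homogeneous d g \<Longrightarrow> homogeneous d (f + g)"
  by (force simp: homogeneous_def plus_mps.rep_eq)

lemma homogeneous_uminus: "homogeneous d f \<Longrightarrow> homogeneous d (- f)"
  by (simp add: homogeneous_def uminus_mps.rep_eq)

lemma homogeneous_scaleR: "homogeneous d f \<Longrightarrow> homogeneous d (r *\<^sub>R f)"
  by (simp add: homogeneous_def scaleR_mps.rep_eq)

lemma homogeneous_times: "homogeneous d f \<Longrightarrow> homogeneous e g \<Longrightarrow> homogeneous (d + e) (f * g)"
  unfolding homogeneous_def by (auto elim!: mps_coeff_times_nonzeroE simp: weight_def)

lemma homogeneous_sum: "(\<And>i. i \<in> I \<Longrightarrow> homogeneous d (f i)) \<Longrightarrow> homogeneous d (\<Sum>i\<in>I. f i)"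
  by (induction I rule: infinite_finite_induct) (auto intro: homogeneous_0 homogeneous_add)

lemma homogeneous_xx: "homogeneous n (xx n)" and homogeneous_yy: "homogeneous n (yy n)"
  by (auto simp: homogeneous_def mps_var.rep_eq weight_def)

lemma homogeneous_schur:
  assumes "\<And>n. homogeneous n (t n)"
  shows "homogeneous m (schur t m)"
proof -
  define T where "T = Abs_fps (\<lambda>j. if j = 0 then 0 else t j)"
  have "homogeneous j (fps_nth (T ^ n) j)" for n j
  proof (induction n arbitrary: j)
    case (Suc n)
    have "homogeneous (i + (j - i)) (fps_nth T i * fps_nth (T ^ n) (j - i))" if "i \<le> j" for i
      by (rule homogeneous_times[OF _ Suc]) (simp add: T_def assms homogeneous_0)
    then show ?case by (auto simp: fps_mult_nth intro!: homogeneous_sum)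
  qed (auto simp: homogeneous_0 homogeneous_1)
  then show ?thesis unfolding schur_def T_def by (intro homogeneous_sum homogeneous_scaleR)
qed

lemma formally_summable_exp_mult_op:
  assumes "\<And>n. homogeneous n (t n)"
  shows "formally_summable (\<lambda>m. schur t m * V (r - int m) q)"
  unfolding formally_summable_def
proof
  fix M
  have "m \<le> weight M" if "mps_coeff (schur t m * V (r - int m) q) M \<noteq> 0" for m
    using that homogeneous_schur[of t m] assms
    by (auto elim!: mps_coeff_times_nonzeroE simp: homogeneous_def weight_def)
  then have "{m. mps_coeff (schur t m * V (r - int m) q) M \<noteq> 0} \<subseteq> {..weight M}" by auto
  then show "finite {m. mps_coeff (schur t m * V (r - int m) q) M \<noteq> 0}"
    using finite_subset by blast
qed

lemma homogeneous_arguments: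
  "homogeneous n (xx n + yy n)" "homogeneous n (- xx n - yy n)"
proof -
  show "homogeneous n (xx n + yy n)"
    by (intro homogeneous_add homogeneous_xx homogeneous_yy)
  then have "homogeneous n (- (xx n + yy n))" by (rule homogeneous_uminus)
  then show "homogeneous n (- xx n - yy n)" by (simp add: algebra_simps)
qed

lemma formally_summable_current_op_x:
  fixes W :: "nat \<Rightarrow> xyser"
  shows "formally_summable (\<lambda>k. if k > 0 then of_nat k * xx k * W k else 0)"
  unfolding formally_summable_def
proof
  fix M
  have "{k. mps_coeff (if k > 0 then of_nat k * xx k * W k else 0) M \<noteq> 0} \<subseteq> {k. Vx k \<in># M}"
    by (auto simp: zero_mps.rep_eq mps_var.rep_eq mult.assoc mult.left_commute[of "of_nat _"]
        elim!: mps_coeff_times_nonzeroE split: if_splits)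
  moreover have "finite {k. Vx k \<in># M}"
    using finite_vimageI[of "set_mset M" Vx] by (simp add: vimage_def inj_def)
  ultimately show "finite {k. mps_coeff (if k > 0 then of_nat k * xx k * W k else 0) M \<noteq> 0}"
    using finite_subset by blast
qed

lemma formally_summable_current_op_pderiv:
  "formally_summable (\<lambda>k. if k > 0 then mps_pderiv (Vx k) (shift_op \<sigma> v (r + int k + 1) q) else 0)"
  unfolding formally_summable_def
proof
  fix M
  have "{k. mps_coeff (if k > 0 then mps_pderiv (Vx k) (shift_op \<sigma> v (r + int k + 1) q) else 0) M \<noteq> 0}
          \<subseteq> {..nat (- r)}"
    by (auto simp: shift_op_def zero_mps.rep_eq mps_pderiv.rep_eq split: if_splits)
  then show "finite {k. mps_coeff (if k > 0 then mps_pderiv (Vx k) (shift_op \<sigma> v (r + int k + 1) q) else 0) M \<noteq> 0}"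
    using finite_subset by blast
qed

definition phi :: "int \<Rightarrow> fock \<Rightarrow> fock" where
  "phi i v = phi_z v (- i - 1)"

definition phistar :: "int \<Rightarrow> fock \<Rightarrow> fock" where
  "phistar i v = phistar_z v (- i)"

definition scale_op :: "complex \<Rightarrow> (fock \<Rightarrow> fock) \<Rightarrow> (fock \<Rightarrow> fock)" where
  "scale_op c T v = (\<lambda>q. mps_const c * T v q)"

definition exp_op_term :: "(fock \<Rightarrow> fock) \<Rightarrow> fock \<Rightarrow> int \<Rightarrow> nat \<Rightarrow> xyser" where
  "exp_op_term T v q n = (1 / fact n) *\<^sub>R (T ^^ n) v q"

definition exp_op_defined :: "(fock \<Rightarrow> fock) \<Rightarrow> fock \<Rightarrow> bool" where
  "exp_op_defined T v \<longleftrightarrow> (\<forall>q. formally_summable (exp_op_term T v q))"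

definition exp_op :: "(fock \<Rightarrow> fock) \<Rightarrow> fock \<Rightarrow> fock" where
  "exp_op T v = (\<lambda>q. formal_sum (exp_op_term T v q))"


section \<open>The series f\<close>

datatype wvar = W1 | W2

type_synonym wser = "(wvar, xyser) mps"

abbreviation w1 :: wser where "w1 \<equiv> mps_var W1"
abbreviation w2 :: wser where "w2 \<equiv> mps_var W2"

text \<open>
  \<open>\<Sum>m=0..l. S_m(x+y) z^(-l-1+m)\<close>, again with \<open>fps_X\<close> for \<open>z^(-1)\<close>.
\<close>

definition schur_poly_z :: "nat \<Rightarrow> wser fps" where
  "schur_poly_z l = (\<Sum>m\<le>l. fps_const (mps_const (Splus m)) * fps_X ^ (l + 1 - m))"

definition f_coeff :: "nat \<Rightarrow> nat \<Rightarrow> nat \<Rightarrow> nat \<Rightarrow> wser" where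
  "f_coeff k l n i =
     fps_nth ((schur_poly_z l * fps_const w1 + schur_poly_z k * fps_const w2) ^ n)
       (n * (l + k + 2) - i)"

definition p_ser :: "nat \<Rightarrow> nat \<Rightarrow> nat \<Rightarrow> wser" where
  "p_ser k l n = (\<Sum>i\<le>n * (l + k + 1).
     f_coeff k l n i * of_nat (n * (l + k + 2) - i) * mps_const (xx (n * (l + k + 2) - i)))"

definition f_ser :: "nat \<Rightarrow> nat \<Rightarrow> wser" where
  "f_ser k l = mps_exp (- formal_sum (\<lambda>n. if n \<ge> 1 then (1 / of_nat n) *\<^sub>R p_ser k l n else 0))"

text \<open>
  Both infinite sums in \<open>f_ser\<close> make sense: \<open>p_ser k l n\<close> is homogeneous of degree \<open>n\<close> in
  \<open>w1\<close>, \<open>w2\<close>, and the exponent has no constant term.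
\<close>

lemma mps_coeff_power_eq_0:
  fixes g :: "('v, 'a :: comm_ring_1) mps"
  assumes "mps_coeff g {#} = 0" "mps_coeff (g ^ n) M \<noteq> 0"
  shows "n \<le> size M"
  using assms(2)
proof (induction n arbitrary: M)
  case (Suc n)
  from Suc.prems have "mps_coeff (g * g ^ n) M \<noteq> 0" by simp
  then obtain A B where AB: "M = A + B" "mps_coeff g A \<noteq> 0" "mps_coeff (g ^ n) B \<noteq> 0"
    by (rule mps_coeff_times_nonzeroE)
  with assms(1) have "A \<noteq> {#}" by auto
  then have "size A > 0" by (simp add: nonempty_has_size)
  with AB Suc.IH[of B] show ?case by simp
qed simp

lemma formally_summable_mps_exp:
  fixes g :: "('v, 'a :: {real_algebra_1, comm_ring_1}) mps"
  assumes "mps_coeff g {#} = 0"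
  shows "formally_summable (\<lambda>n. (1 / fact n) *\<^sub>R g ^ n)"
  unfolding formally_summable_def
proof
  fix M
  have "{n. mps_coeff ((1 / fact n) *\<^sub>R g ^ n) M \<noteq> 0} \<subseteq> {..size M}"
    using mps_coeff_power_eq_0[OF assms] by (auto simp: scaleR_mps.rep_eq)
  then show "finite {n. mps_coeff ((1 / fact n) *\<^sub>R g ^ n) M \<noteq> 0}"
    using finite_subset by blast
qed

definition w_homogeneous :: "nat \<Rightarrow> wser \<Rightarrow> bool" where
  "w_homogeneous d F \<longleftrightarrow> (\<forall>M. mps_coeff F M \<noteq> 0 \<longrightarrow> size M = d)"

lemma w_homogeneous_0: "w_homogeneous d 0"
  by (simp add: w_homogeneous_def zero_mps.rep_eq)

lemma w_homogeneous_add: "w_homogeneous d F \<Longrightarrow> w_homogeneous d G \<Longrightarrow> w_homogeneous d (F + G)"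
  by (force simp: w_homogeneous_def plus_mps.rep_eq)

lemma w_homogeneous_times:
  "w_homogeneous d F \<Longrightarrow> w_homogeneous e G \<Longrightarrow> w_homogeneous (d + e) (F * G)"
  unfolding w_homogeneous_def by (auto elim!: mps_coeff_times_nonzeroE)

lemma w_homogeneous_sum:
  "(\<And>i. i \<in> I \<Longrightarrow> w_homogeneous d (F i)) \<Longrightarrow> w_homogeneous d (\<Sum>i\<in>I. F i)"
  by (induction I rule: infinite_finite_induct) (auto intro: w_homogeneous_0 w_homogeneous_add)

lemma w_homogeneous_1: "w_homogeneous 0 1"
  by (simp add: w_homogeneous_def one_mps.rep_eq)

lemma w_homogeneous_of_nat: "w_homogeneous 0 (of_nat n)"
  by (induction n) (auto intro: w_homogeneous_0 w_homogeneous_add w_homogeneous_1)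

lemma w_homogeneous_const: "w_homogeneous 0 (mps_const c)"
  by (simp add: w_homogeneous_def mps_const.rep_eq)

lemma w_homogeneous_var: "w_homogeneous 1 (mps_var v)"
  by (simp add: w_homogeneous_def mps_var.rep_eq)

lemma w_homogeneous_p_ser: "w_homogeneous n (p_ser k l n)"
proof -
  have fps_times: "w_homogeneous (d + e) (fps_nth (F * G) m)"
    if "\<And>m. w_homogeneous d (fps_nth F m)" "\<And>m. w_homogeneous e (fps_nth G m)" for d e m F G
    using that by (auto simp: fps_mult_nth intro!: w_homogeneous_sum w_homogeneous_times)
  have S: "w_homogeneous 0 (fps_nth (schur_poly_z l) m)" for l m
    by (auto simp: schur_poly_z_def fps_sum_nth intro!: w_homogeneous_sum w_homogeneous_const w_homogeneous_0)
  have W: "w_homogeneous 1 (fps_nth (fps_const (mps_var v)) m)" for v m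
    using w_homogeneous_var by (simp add: w_homogeneous_0)
  define B where "B = schur_poly_z l * fps_const w1 + schur_poly_z k * fps_const w2"
  have B: "w_homogeneous 1 (fps_nth B m)" for m
    unfolding B_def fps_add_nth
    using fps_times[of 0 _ 1, OF S W] by (intro w_homogeneous_add) (simp_all del: fps_mult_right_const_nth)
  have pow: "w_homogeneous n (fps_nth (B ^ n) m)" for m
  proof (induction n arbitrary: m)
    case (Suc n)
    show ?case using fps_times[OF B Suc] by simp
  qed (simp add: w_homogeneous_0 w_homogeneous_1)
  have "w_homogeneous (n + 0 + 0)
          (f_coeff k l n i * of_nat (n * (l + k + 2) - i) * mps_const (xx (n * (l + k + 2) - i)))" for i
    using pow unfolding f_coeff_def B_def
    by (intro w_homogeneous_times w_homogeneous_of_nat w_homogeneous_const)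
  then show ?thesis unfolding p_ser_def by (intro w_homogeneous_sum) (simp only: add_0_right)
qed

lemma formally_summable_p_ser:
  "formally_summable (\<lambda>n. if n \<ge> 1 then (1 / of_nat n) *\<^sub>R p_ser k l n else 0)"
  unfolding formally_summable_def
proof
  fix M
  have "{n. mps_coeff (if n \<ge> 1 then (1 / of_nat n) *\<^sub>R p_ser k l n else 0) M \<noteq> 0} \<subseteq> {size M}"
    using w_homogeneous_p_ser[of _ k l]
    by (auto simp: w_homogeneous_def zero_mps.rep_eq scaleR_mps.rep_eq split: if_splits)
  then show "finite {n. mps_coeff (if n \<ge> 1 then (1 / of_nat n) *\<^sub>R p_ser k l n else 0) M \<noteq> 0}"
    using finite_subset by blast
qed

lemma f_ser_exponent_no_const:
  "mps_coeff (- formal_sum (\<lambda>n. if n \<ge> 1 then (1 / of_nat n) *\<^sub>R p_ser k l n else 0)) {#} = 0"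
proof -
  have "mps_coeff (if n \<ge> 1 then (1 / of_nat n) *\<^sub>R p_ser k l n else 0) {#} = 0" for n
    using w_homogeneous_p_ser[of n k l]
    by (auto simp: w_homogeneous_def zero_mps.rep_eq scaleR_mps.rep_eq)
  then show ?thesis by (simp add: formal_sum_def uminus_mps.rep_eq Abs_mps_inverse)
qed

text \<open>
  The variables \<open>w1\<close>, \<open>w2\<close> are constants for \<open>\<partial>x_i\<close>, \<open>\<partial>y_i\<close>, which therefore act
  on each coefficient.
\<close>

definition exp_deriv_z_w :: "wser \<Rightarrow> wser fps" where
  "exp_deriv_z_w F = Abs_fps (\<lambda>m. mps_map (\<lambda>g. fps_nth (exp_deriv_z 1 g) m) F)"

definition subst_w :: "xyser \<Rightarrow> xyser \<Rightarrow> wvar \<Rightarrow> xyser" where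
  "subst_w g h v = (case v of W1 \<Rightarrow> g | W2 \<Rightarrow> h)"

text \<open>
  \<open>F(\<alpha> p, \<beta> p)\<close>: the monomial \<open>w1^m w2^n\<close> becomes \<open>\<alpha>^m \<beta>^n p^(m+n)\<close>.
\<close>

definition subst_p :: "complex \<Rightarrow> complex \<Rightarrow> wser \<Rightarrow> fock" where
  "subst_p \<alpha> \<beta> F = (\<lambda>q. if q < 0 then 0 else
     \<Sum>(m, n) | m + n = nat q.
       mps_coeff F (replicate_mset m W1 + replicate_mset n W2) * mps_const (\<alpha> ^ m * \<beta> ^ n))"

text \<open>Elements of \<open>\<complex>[[x,y]]\<close> as Fock vectors of degree \<open>0\<close> in \<open>p\<close>.\<close>

definition fock_const :: "xyser \<Rightarrow> fock" where
  "fock_const g = (\<lambda>q. if q = 0 then g else 0)"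

definition A_ser :: "nat \<Rightarrow> nat \<Rightarrow> xyser" where
  "A_ser s t = (\<Sum>m\<le>t. Splus m * Sminus (s + t - m))"

definition D_ser :: "nat \<Rightarrow> nat \<Rightarrow> nat \<Rightarrow> nat \<Rightarrow> complex \<Rightarrow> complex \<Rightarrow> xyser" where
  "D_ser k l i j c d =
     1 - mps_const c * A_ser i l - mps_const d * A_ser j k
     + mps_const c * A_ser i l * (mps_const d * A_ser j k)
     - mps_const c * A_ser i k * (mps_const d * A_ser j l)"

definition N1_ser :: "nat \<Rightarrow> nat \<Rightarrow> nat \<Rightarrow> nat \<Rightarrow> complex \<Rightarrow> complex \<Rightarrow> xyser" where
  "N1_ser k l i j c d =
     - mps_const c * Sminus (i - 1)
     + mps_const c * Sminus (i - 1) * (mps_const d * A_ser j k)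
     - mps_const d * Sminus (j - 1) * (mps_const c * A_ser i k)"

definition N2_ser :: "nat \<Rightarrow> nat \<Rightarrow> nat \<Rightarrow> nat \<Rightarrow> complex \<Rightarrow> complex \<Rightarrow> xyser" where
  "N2_ser k l i j c d =
     - mps_const d * Sminus (j - 1)
     + mps_const d * Sminus (j - 1) * (mps_const c * A_ser i l)
     - mps_const c * Sminus (i - 1) * (mps_const d * A_ser j l)"

end

theory Submission
  imports Defs "HOL-Computational_Algebra.Formal_Laurent_Series" "HOL-Library.Groups_Big_Fun"
begin

text \<open>
  Put \<open>B = w1 P\<^sub>l(z) + w2 P\<^sub>k(z)\<close>, where \<open>P\<^sub>l(z)\<close> is the part of \<open>z\<^sup>-\<^sup>l\<^sup>-\<^sup>1 exp(\<Sum>(x\<^sub>n + y\<^sub>n) z\<^sup>n)\<close> with negative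
  powers of \<open>z\<close>. Then \<open>- log f\<close> is the constant term of \<open>- (\<Sum>j x\<^sub>j z\<^sup>j) log(1 - B)\<close>, and any
  derivation of it can be computed by applying the Euler operator in \<open>w\<close>, which turns the logarithm
  into a geometric series and is injective up to constants. In particular
  \<open>\<partial>x\<^sub>i - \<partial>y\<^sub>i\<close> annihilates \<open>B\<close>, so its exponential multiplies \<open>f\<close> by \<open>1 - B\<close>.

  The operator \<open>\<phi>\<^sup>*\<close> thus acts on \<open>f\<close> by a first order derivation with coefficients in
  \<open>U = z\<^sup>-\<^sup>l\<^sup>-\<^sup>1 exp(\<Sum>(x\<^sub>n + y\<^sub>n) z\<^sup>n) / (1 - B)\<close>, which maps \<open>B\<close> to the negative part of \<open>U\<^sub>+ B\<close>; since \<open>P\<^sub>l\<close> is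
  the negative part of \<open>U (1 - B)\<close>, the result is \<open>- \<partial>f/\<partial>w1\<close>. On the other hand \<open>\<phi>\<^sub>-\<^sub>i\<close> multiplies \<open>f\<close>
  by \<open>G\<^sub>i = S\<^sub>i\<^sub>-\<^sub>1(-x-y) - A\<^sub>i\<^sub>l w1 - A\<^sub>i\<^sub>k w2\<close>. This gives (2), and expresses the left-hand side of (3)
  as the sum over \<open>m\<close>, \<open>n\<close> of the coefficients of \<open>w1\<^sup>m w2\<^sup>n\<close> in \<open>(-c G\<^sub>i)\<^sup>m (-d G\<^sub>j)\<^sup>n f\<close>, which Lagrange
  inversion for two affine functions evaluates to \<open>f(N1/D, N2/D) / D\<close>.
\<close>

section \<open>Multivariate power series\<close>

text \<open>The obstacle is that \<open>phistar\<close> contains an infinite sum of derivations that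
  makes sense only coefficientwise. Its action is therefore computed for a cut-off
  \<open>theta v K\<close>, which is a genuine derivation, with explicit remainders that vanish in
  the limit \<open>mps_lim\<close>. In (3) the operators alternate, so \<open>phistar\<close> must
  act on p^-r times products of the G with f, not only on f: each factor G leaves the constant term
  of U in z behind, and this is exactly what p dp removes when it acts on p^-r. That is why
  \<open>adm\<close> records r. The variables w are mere labels: a Fock vector is attached to each
  monomial, \<open>phistar\<close> moves from one monomial to the next, and the factors picked up on
  the way are the factorials of the exponential. Convergence on the Fock space (exponentials, their
  exchange with operators, Lagrange inversion) is controlled by one filtration, the weight in x and
  y, which the exponentiated operators raise.\<close>

lemmas mps_coeff_simps =
  zero_mps.rep_eq one_mps.rep_eq plus_mps.rep_eq minus_mps.rep_eq uminus_mps.rep_eq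
  scaleR_mps.rep_eq mps_const.rep_eq mps_map.rep_eq mps_pderiv.rep_eq

lemma mps_coeff_sum: "mps_coeff (\<Sum>i\<in>I. F i) M = (\<Sum>i\<in>I. mps_coeff (F i) M)"
  by (induction I rule: infinite_finite_induct) (auto simp: mps_coeff_simps)

lemma mps_coeff_const_times:
  fixes f :: "('v, 'a :: comm_ring_1) mps"
  shows "mps_coeff (mps_const c * f) M = c * mps_coeff f M"
proof -
  have "mps_coeff (mps_const c * f) M =
    (\<Sum>(A, B) \<in> {({#} :: 'v multiset, M)}. mps_coeff (mps_const c) A * mps_coeff f B)"
    unfolding mps_coeff_times
    by (rule sum.mono_neutral_right)
       (auto simp: finite_multiset_splits mps_const.rep_eq split: if_splits)
  then show ?thesis by (simp add: mps_const.rep_eq)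
qed

lemma mps_const_simps [simp]:
  "mps_const 0 = 0" "mps_const 1 = 1"
  "mps_const a + mps_const b = mps_const (a + b)"
  "mps_const a - mps_const b = mps_const (a - b)"
  "- mps_const a = mps_const (- a)"
  by (auto intro!: mps_eqI simp: mps_coeff_simps)

lemma mps_const_times: "mps_const a * mps_const b = mps_const (a * b)"
  by (rule mps_eqI) (simp add: mps_coeff_const_times mps_const.rep_eq)

lemma mps_coeff_var_times:
  "mps_coeff (mps_var v * f) M = (if v \<in># M then mps_coeff f (M - {#v#}) else 0)"
proof -
  have "mps_coeff (mps_var v * f) M =
    (\<Sum>(A, B) \<in> (if v \<in># M then {({#v#}, M - {#v#})} else {}). mps_coeff (mps_var v) A * mps_coeff f B)"
    unfolding mps_coeff_times
    by (rule sum.mono_neutral_right)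
       (auto simp: finite_multiset_splits mps_var.rep_eq split: if_splits)
  then show ?thesis by (simp add: mps_var.rep_eq)
qed

lemma mps_coeff_times_empty: "mps_coeff (f * g) {#} = mps_coeff f {#} * mps_coeff g {#}"
proof -
  have "{(A, B). A + B = ({#} :: 'a multiset)} = {({#}, {#})}" by auto
  then show ?thesis by (simp add: mps_coeff_times)
qed

lemma finite_submultisets: "finite {A. A \<subseteq># (M :: 'v multiset)}"
  by (rule finite_subset[OF _ finite_imageI[OF finite_multiset_splits[of M], of fst]])
     (auto simp: image_iff subset_mset.le_iff_add)

lemma mps_coeff_times_cong:
  assumes "\<And>A. A \<subseteq># M \<Longrightarrow> mps_coeff f A = mps_coeff f' A"
    and "\<And>A. A \<subseteq># M \<Longrightarrow> mps_coeff g A = mps_coeff g' A"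
  shows "mps_coeff (f * g) M = mps_coeff (f' * g') M"
  unfolding mps_coeff_times by (rule sum.cong) (auto simp: assms)

lemma mps_coeff_pow_size:
  assumes "mps_coeff g {#} = 0" "size M < n"
  shows "mps_coeff (g ^ n) M = 0"
  using mps_coeff_power_eq_0[of g n M] assms by fastforce

lemma mps_coeff_formal_sum:
  "mps_coeff (formal_sum F) M = Sum_any (\<lambda>i. mps_coeff (F i) M)"
  by (simp add: formal_sum_def Abs_mps_inverse Sum_any.expand_set)

lemma formal_sum_finite:
  assumes "finite A" "\<And>i. i \<notin> A \<Longrightarrow> F i = 0"
  shows "formal_sum F = (\<Sum>i\<in>A. F i)"
  by (rule mps_eqI, unfold mps_coeff_formal_sum mps_coeff_sum, rule Sum_any.expand_superset)
     (use assms in \<open>force simp: mps_coeff_simps\<close>)+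

lemma formal_sum_zero: "formal_sum (\<lambda>i. 0) = 0"
  by (rule mps_eqI) (simp add: mps_coeff_formal_sum zero_mps.rep_eq)

text \<open>Geometric series in 1 - g: its n-th power has no monomial of size below n, so
  \<open>h\<close> may be given coefficientwise by partial sums cut at
  \<open>size M\<close>.\<close>

lemma mps_inverse_exists:
  fixes g :: "('v, 'a :: comm_ring_1) mps"
  assumes "mps_coeff g {#} = 1"
  shows "\<exists>h. g * h = 1"
proof -
  define u where "u = 1 - g"
  have u: "mps_coeff u {#} = 0" using assms by (simp add: u_def mps_coeff_simps)
  define h where "h = Abs_mps (\<lambda>M. mps_coeff (\<Sum>n\<le>size M. u ^ n) M)"
  have h: "mps_coeff h A = mps_coeff (\<Sum>n\<le>N. u ^ n) A" if "size A \<le> N" for A N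
  proof -
    have "(\<Sum>n\<le>size A. mps_coeff (u ^ n) A) = (\<Sum>n\<le>N. mps_coeff (u ^ n) A)"
      by (rule sum.mono_neutral_left) (use that mps_coeff_pow_size[OF u] in auto)
    then show ?thesis by (simp add: h_def Abs_mps_inverse mps_coeff_sum)
  qed
  have "mps_coeff ((1 - u) * h) M = mps_coeff 1 M" for M
  proof -
    have "mps_coeff ((1 - u) * h) M = mps_coeff ((1 - u) * (\<Sum>n<Suc (size M). u ^ n)) M"
      by (rule mps_coeff_times_cong) (auto simp: h lessThan_Suc_atMost size_mset_mono)
    also have "\<dots> = mps_coeff (1 - u ^ Suc (size M)) M"
      by (simp only: one_diff_power_eq)
    also have "\<dots> = mps_coeff 1 M"
      using mps_coeff_pow_size[OF u, of M "Suc (size M)"]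
      by (simp only: minus_mps.rep_eq) simp
    finally show ?thesis .
  qed
  then have "(1 - u) * h = 1" by (rule mps_eqI)
  then show ?thesis by (auto simp: u_def)
qed

lemma mps_map_times:
  fixes h :: "'a :: comm_ring_1 \<Rightarrow> 'b :: comm_ring_1"
  assumes "\<And>a b. h (a + b) = h a + h b" "h 0 = 0" "\<And>a b. h (a * b) = h a * h b"
  shows "mps_map h (f * g) = mps_map h f * mps_map h g"
proof (rule mps_eqI)
  have sum: "h (sum u I) = (\<Sum>i\<in>I. h (u i))" for u :: "'z \<Rightarrow> 'a" and I
    by (induction I rule: infinite_finite_induct) (auto simp: assms)
  show "mps_coeff (mps_map h (f * g)) M = mps_coeff (mps_map h f * mps_map h g) M" for M
    by (simp add: mps_coeff_times mps_map.rep_eq sum assms case_prod_unfold)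
qed

subsection \<open>Derivations\<close>

text \<open>No linearity over a base ring is asked for: compatibility with real scalars is a
  separate hypothesis wherever an exponential is differentiated.\<close>

definition derivation :: "('a :: comm_ring_1 \<Rightarrow> 'a) \<Rightarrow> bool" where
  "derivation d \<longleftrightarrow> (\<forall>a b. d (a + b) = d a + d b) \<and> (\<forall>a b. d (a * b) = a * d b + d a * b)"

lemma derivationI:
  "(\<And>a b. d (a + b) = d a + d b) \<Longrightarrow> (\<And>a b. d (a * b) = a * d b + d a * b) \<Longrightarrow> derivation d"
  by (simp add: derivation_def)

lemma derivation_add: "derivation d \<Longrightarrow> d (a + b) = d a + d b"
  and derivation_mult: "derivation d \<Longrightarrow> d (a * b) = a * d b + d a * b"
  by (simp_all add: derivation_def)

lemma derivation_0: "derivation d \<Longrightarrow> d 0 = 0"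
  using derivation_add[of d 0 0] by simp

lemma derivation_1: "derivation d \<Longrightarrow> d 1 = 0"
  using derivation_mult[of d 1 1] by simp

lemma derivation_uminus: "derivation d \<Longrightarrow> d (- a) = - d a"
  using derivation_add[of d a "- a"] by (simp add: derivation_0 eq_neg_iff_add_eq_0 add.commute)

lemma derivation_diff: "derivation d \<Longrightarrow> d (a - b) = d a - d b"
  using derivation_add[of d a "- b"] by (simp add: derivation_uminus)

lemma derivation_sum: "derivation d \<Longrightarrow> d (\<Sum>i\<in>I. f i) = (\<Sum>i\<in>I. d (f i))"
  by (induction I rule: infinite_finite_induct) (auto simp: derivation_0 derivation_add)

lemma derivation_power_Suc: "derivation d \<Longrightarrow> d (a ^ Suc n) = of_nat (Suc n) * a ^ n * d a"
proof (induction n)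
  case (Suc n)
  have "d (a ^ Suc (Suc n)) = a * d (a ^ Suc n) + d a * a ^ Suc n"
    using derivation_mult[OF Suc.prems, of a "a ^ Suc n"] by simp
  with Suc show ?case by (simp add: algebra_simps)
qed simp

lemma derivation_scale_sum:
  assumes "\<And>i. i \<in> I \<Longrightarrow> derivation (d i)"
  shows "derivation (\<lambda>a. \<Sum>i\<in>I. e i * d i a)"
  by (rule derivationI)
     (auto simp: sum.distrib[symmetric] sum_distrib_left sum_distrib_right algebra_simps
        derivation_add[OF assms] derivation_mult[OF assms] intro!: sum.cong)

lemma derivation_diff_fun:
  assumes "derivation d" "derivation e"
  shows "derivation (\<lambda>a. d a - e a)"
  using assms by (auto simp: derivation_def algebra_simps)

lemma derivation_inverse:
  assumes "derivation d" "(1 - b) * g = 1"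
  shows "d g = g * g * d b"
proof -
  have "0 = d ((1 - b) * g)" using assms by (simp add: derivation_1)
  also have "\<dots> = (1 - b) * d g - d b * g"
    using derivation_mult[OF assms(1), of "1 - b" g]
    by (simp add: derivation_diff[OF assms(1)] derivation_1[OF assms(1)])
  finally have "(1 - b) * d g = d b * g" by simp
  then have "g * ((1 - b) * d g) = g * (d b * g)" by simp
  moreover have "g * ((1 - b) * d g) = ((1 - b) * g) * d g" by (simp only: mult_ac)
  ultimately have "d g = g * (d b * g)" using assms(2) by simp
  then show ?thesis by (simp only: mult_ac)
qed

lemma mps_map_derivation:
  assumes "derivation d"
  shows "derivation (mps_map d)"
proof (rule derivationI; rule mps_eqI)
  fix f g :: "('b, 'a) mps" and M
  show "mps_coeff (mps_map d (f + g)) M = mps_coeff (mps_map d f + mps_map d g) M"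
    by (simp add: mps_coeff_simps derivation_add[OF assms])
  show "mps_coeff (mps_map d (f * g)) M = mps_coeff (f * mps_map d g + mps_map d f * g) M"
    by (simp add: mps_coeff_simps mps_coeff_times derivation_sum[OF assms] derivation_mult[OF assms]
        case_prod_unfold sum.distrib)
qed

text \<open>A grading turned into an operator: \<open>count\<close> gives a variable times its
  partial derivative, \<open>size\<close> the Euler operator.\<close>

lift_definition mps_grade :: "('v multiset \<Rightarrow> nat) \<Rightarrow> ('v, 'a :: comm_ring_1) mps \<Rightarrow> ('v, 'a) mps"
  is "\<lambda>c f M. of_nat (c M) * f M" .

lemma derivation_grade:
  assumes "\<And>A B. c (A + B) = c A + c B"
  shows "derivation (mps_grade c :: ('v, 'a :: comm_ring_1) mps \<Rightarrow> _)"
proof (rule derivationI; rule mps_eqI)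
  fix f g :: "('v, 'a) mps" and M
  show "mps_coeff (mps_grade c (f + g)) M = mps_coeff (mps_grade c f + mps_grade c g) M"
    by (simp add: mps_coeff_simps mps_grade.rep_eq algebra_simps)
  show "mps_coeff (mps_grade c (f * g)) M = mps_coeff (f * mps_grade c g + mps_grade c f * g) M"
    unfolding plus_mps.rep_eq mps_grade.rep_eq mps_coeff_times sum_distrib_left sum.distrib[symmetric]
    by (rule sum.cong) (auto simp: mps_grade.rep_eq assms algebra_simps)
qed

lemma var_times_pderiv: "mps_var v * mps_pderiv v f = mps_grade (\<lambda>M. count M v) f"
proof (rule mps_eqI)
  fix M
  show "mps_coeff (mps_var v * mps_pderiv v f) M = mps_coeff (mps_grade (\<lambda>M. count M v) f) M"
  proof (cases "v \<in># M")
    case True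
    then obtain N where "M = add_mset v N" by (metis insert_DiffM)
    then show ?thesis by (simp add: mps_coeff_var_times mps_pderiv.rep_eq mps_grade.rep_eq)
  qed (simp add: mps_coeff_var_times mps_grade.rep_eq not_in_iff[THEN iffD1])
qed

lemma mps_var_times_cancel:
  assumes "mps_var v * f = mps_var v * g"
  shows "f = g"
proof (rule mps_eqI)
  fix M
  have "mps_coeff (mps_var v * f) (add_mset v M) = mps_coeff (mps_var v * g) (add_mset v M)"
    by (simp add: assms)
  then show "mps_coeff f M = mps_coeff g M" by (simp add: mps_coeff_var_times)
qed

text \<open>A variable times its partial derivative is a grading, for which the Leibniz rule is
  plain; the variable is then cancelled.\<close>

lemma derivation_pderiv: "derivation (mps_pderiv v :: ('v, 'a :: comm_ring_1) mps \<Rightarrow> _)"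
proof (rule derivationI)
  fix f g :: "('v, 'a) mps"
  note D = derivation_grade[of "\<lambda>M. count M v", simplified]
  show "mps_pderiv v (f + g) = mps_pderiv v f + mps_pderiv v g"
    by (rule mps_eqI) (simp add: mps_coeff_simps algebra_simps)
  have "mps_var v * mps_pderiv v (f * g) = f * (mps_var v * mps_pderiv v g) + (mps_var v * mps_pderiv v f) * g"
    by (simp only: var_times_pderiv derivation_mult[OF D])
  also have "\<dots> = mps_var v * (f * mps_pderiv v g + mps_pderiv v f * g)"
    by (simp add: algebra_simps)
  finally show "mps_pderiv v (f * g) = f * mps_pderiv v g + mps_pderiv v f * g"
    by (rule mps_var_times_cancel)
qed

lemma pderiv_const [simp]: "mps_pderiv v (mps_const c) = 0"
  by (rule mps_eqI) (simp add: mps_coeff_simps)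

lemma pderiv_scaleR: "mps_pderiv v (r *\<^sub>R f) = r *\<^sub>R mps_pderiv v f"
  by (rule mps_eqI) (simp add: mps_coeff_simps)

lemma grade_scaleR: "mps_grade c (r *\<^sub>R f) = r *\<^sub>R mps_grade c f"
  by (rule mps_eqI) (simp add: mps_grade.rep_eq scaleR_mps.rep_eq)

lemma pderiv_var: "mps_pderiv v (mps_var u) = (if u = v then 1 else 0)"
  by (rule mps_eqI) (auto simp: mps_coeff_simps mps_var.rep_eq)

section \<open>The Euler operator and its injectivity\<close>

abbreviation euler :: "('v, 'a :: comm_ring_1) mps \<Rightarrow> ('v, 'a) mps" where
  "euler \<equiv> mps_grade size"

lemma derivation_euler: "derivation euler"
  by (rule derivation_grade) simp

lemma euler_const [simp]: "euler (mps_const c) = 0"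
  by (rule mps_eqI) (simp add: mps_coeff_simps mps_grade.rep_eq)

text \<open>The size of a nonempty monomial is invertible in a real algebra. This replaces
  integration: identities between logarithmic series are proved after applying
  \<open>euler\<close>.\<close>

lemma euler_inject:
  fixes f g :: "('v, 'a :: {real_algebra_1, comm_ring_1}) mps"
  assumes "euler f = euler g" "mps_coeff f {#} = mps_coeff g {#}"
  shows "f = g"
proof (rule mps_eqI)
  fix M
  have "mps_coeff (euler f) M = mps_coeff (euler g) M" by (simp add: assms)
  then have "real (size M) *\<^sub>R mps_coeff f M = real (size M) *\<^sub>R mps_coeff g M"
    by (simp add: mps_grade.rep_eq scaleR_conv_of_real)
  then show "mps_coeff f M = mps_coeff g M" using assms(2) by (cases "M = {#}") auto
qed

lemma euler_pderiv: "euler (mps_pderiv v f) + mps_pderiv v f = mps_pderiv v (euler f)"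
  by (rule mps_eqI) (simp add: mps_coeff_simps mps_grade.rep_eq algebra_simps)

text \<open>The version for partial derivatives, which lower the degree by one: the factor is size +
  1, invertible at the constant coefficient too.\<close>

lemma euler_plus_inject:
  fixes f g :: "('v, 'a :: {real_algebra_1, comm_ring_1}) mps"
  assumes "euler f + f = euler g + g"
  shows "f = g"
proof (rule mps_eqI)
  fix M
  have "mps_coeff (euler f + f) M = mps_coeff (euler g + g) M" by (simp add: assms)
  then have "real (Suc (size M)) *\<^sub>R mps_coeff f M = real (Suc (size M)) *\<^sub>R mps_coeff g M"
    by (simp add: mps_grade.rep_eq plus_mps.rep_eq scaleR_conv_of_real algebra_simps)
  then show "mps_coeff f M = mps_coeff g M" by (simp del: of_nat_Suc)
qed

lemma euler_map: 
  assumes "\<And>a b. h (a + b) = h a + h b" 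
  shows "euler (mps_map h f) = mps_map h (euler f)"
proof -
  have 0: "h 0 = 0" using assms[of 0 0] by simp
  have "h (of_nat n * a) = of_nat n * h a" for n a
    by (induction n) (auto simp: assms 0 algebra_simps)
  then show ?thesis by (intro mps_eqI) (simp add: mps_coeff_simps mps_grade.rep_eq)
qed

lemma pderiv_map: 
  assumes "\<And>a b. h (a + b) = h a + h b" 
  shows "mps_pderiv v (mps_map h f) = mps_map h (mps_pderiv v f)"
proof -
  have 0: "h 0 = 0" using assms[of 0 0] by simp
  have "h (of_nat n * a) = of_nat n * h a" for n a
    by (induction n) (auto simp: assms 0 algebra_simps)
  from this[of "Suc _"] show ?thesis by (intro mps_eqI) (simp add: mps_coeff_simps)
qed

text \<open>\<open>loc\<close> says that \<open>d\<close> looks at most one degree ahead. This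
  covers \<open>euler\<close> and coefficientwise derivations, which keep the degree, and partial
  derivatives, which lower it; it permits replacing the exponential by a partial sum.\<close>

lemma derivation_mps_exp:
  fixes g :: "('v, 'a :: {real_algebra_1, comm_ring_1}) mps"
  assumes d: "derivation d"
    and scaleR: "\<And>r a. d (r *\<^sub>R a) = r *\<^sub>R d a"
    and loc: "\<And>M f f'. (\<forall>A. size A \<le> Suc (size M) \<longrightarrow> mps_coeff f A = mps_coeff f' A)
                  \<Longrightarrow> mps_coeff (d f) M = mps_coeff (d f') M"
    and g: "mps_coeff g {#} = 0"
  shows "d (mps_exp g) = mps_exp g * d g"
proof (rule mps_eqI)
  fix M :: "'v multiset"
  define S where "S N = (\<Sum>n\<le>N. (1 / fact n) *\<^sub>R g ^ n)" for N
  have S: "mps_coeff (mps_exp g) A = mps_coeff (S N) A" if "size A \<le> N" for A N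
    unfolding mps_exp_def mps_coeff_formal_sum S_def mps_coeff_sum
    by (rule Sum_any.expand_superset)
       (use mps_coeff_pow_size[OF g, of A] that in \<open>force simp: scaleR_mps.rep_eq not_le[symmetric]\<close>)+
  define N where "N = size M"
  \<comment> \<open>The partial sum goes one degree beyond \<open>M\<close> because \<open>d\<close>
    may shift the degree; differentiating it lowers the last index again.\<close>
  have "mps_coeff (d (mps_exp g)) M = mps_coeff (d (S (Suc N))) M"
    by (rule loc) (simp add: S[of _ "Suc N"] N_def)
  also have "d (S (Suc N)) = S N * d g"
  proof -
    have "d (S (Suc N)) = (\<Sum>n\<le>Suc N. (1 / fact n) *\<^sub>R d (g ^ n))"
      by (simp only: S_def derivation_sum[OF d] scaleR)
    also have "\<dots> = (\<Sum>n\<le>N. (1 / fact (Suc n)) *\<^sub>R d (g ^ Suc n))"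
      by (subst sum.atMost_Suc_shift) (simp add: derivation_1[OF d])
    also have "\<dots> = (\<Sum>n\<le>N. (1 / fact n) *\<^sub>R g ^ n * d g)"
    proof (rule sum.cong)
      fix n
      have "(1 / fact (Suc n)) *\<^sub>R d (g ^ Suc n) = (1 / fact (Suc n) * real (Suc n)) *\<^sub>R (g ^ n * d g)"
        unfolding derivation_power_Suc[OF d]
        by (simp only: scaleR_scaleR[symmetric] scaleR_conv_of_real[of "real (Suc n)"] of_real_of_nat_eq
            mult.assoc)
      also have "1 / fact (Suc n) * real (Suc n) = 1 / (fact n :: real)"
        by (simp add: field_simps add_eq_0_iff_both_eq_0 fact_Suc del: of_nat_Suc)
      finally show "(1 / fact (Suc n)) *\<^sub>R d (g ^ Suc n) = (1 / fact n) *\<^sub>R g ^ n * d g" by simp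
    qed simp
    finally show ?thesis by (simp add: S_def sum_distrib_right)
  qed
  also have "mps_coeff (S N * d g) M = mps_coeff (mps_exp g * d g) M"
    by (rule mps_coeff_times_cong) (use S[of _ N] in \<open>auto simp: N_def dest: size_mset_mono\<close>)
  finally show "mps_coeff (d (mps_exp g)) M = mps_coeff (mps_exp g * d g) M" .
qed

lemma mps_exp_empty:
  assumes "mps_coeff g {#} = 0"
  shows "mps_coeff (mps_exp g) {#} = 1"
proof -
  have "mps_coeff (g ^ n) {#} = 0" if "n \<noteq> 0" for n
    using mps_coeff_pow_size[OF assms, of "{#}" n] that by simp
  then have "mps_coeff (mps_exp g) {#} = (\<Sum>n\<in>{0}. mps_coeff ((1 / fact n) *\<^sub>R g ^ n) {#})"
    unfolding mps_exp_def mps_coeff_formal_sum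
    by (intro Sum_any.expand_superset) (auto simp: scaleR_mps.rep_eq)
  then show ?thesis by (simp add: one_mps.rep_eq scaleR_mps.rep_eq)
qed

subsection \<open>Coefficientwise limits\<close>

text \<open>Convergence for the product of discrete topologies: every coefficient becomes
  stationary, at a stage that may depend on \<open>M\<close>.\<close>

definition mps_lim :: "(nat \<Rightarrow> ('v, 'a :: comm_ring_1) mps) \<Rightarrow> ('v, 'a) mps \<Rightarrow> bool" where
  "mps_lim F f \<longleftrightarrow> (\<forall>M. eventually (\<lambda>K. mps_coeff (F K) M = mps_coeff f M) sequentially)"

lemma mps_lim_const: "mps_lim (\<lambda>K. f) f"
  by (simp add: mps_lim_def)

lemma mps_lim_add:
  assumes "mps_lim F f" "mps_lim G g"
  shows "mps_lim (\<lambda>K. F K + G K) (f + g)"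
  unfolding mps_lim_def
proof
  fix M
  have "eventually (\<lambda>K. mps_coeff (F K) M = mps_coeff f M \<and> mps_coeff (G K) M = mps_coeff g M) sequentially"
    using assms by (simp add: mps_lim_def eventually_conj_iff)
  then show "eventually (\<lambda>K. mps_coeff (F K + G K) M = mps_coeff (f + g) M) sequentially"
    by eventually_elim (simp add: plus_mps.rep_eq)
qed

lemma mps_lim_times:
  assumes "mps_lim F f" "mps_lim G g"
  shows "mps_lim (\<lambda>K. F K * G K) (f * g)"
  unfolding mps_lim_def
proof
  fix M
  have "eventually (\<lambda>K. \<forall>A\<in>{A. A \<subseteq># M}. mps_coeff (F K) A = mps_coeff f A \<and> mps_coeff (G K) A = mps_coeff g A) sequentially"
    using assms by (intro eventually_ball_finite) (auto simp: finite_submultisets mps_lim_def eventually_conj_iff)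
  then show "eventually (\<lambda>K. mps_coeff (F K * G K) M = mps_coeff (f * g) M) sequentially"
    by eventually_elim (rule mps_coeff_times_cong; simp)
qed

lemma mps_lim_uminus: "mps_lim F f \<Longrightarrow> mps_lim (\<lambda>K. - F K) (- f)"
  unfolding mps_lim_def uminus_mps.rep_eq by simp

lemma mps_lim_diff: "mps_lim F f \<Longrightarrow> mps_lim G g \<Longrightarrow> mps_lim (\<lambda>K. F K - G K) (f - g)"
  using mps_lim_add[of F f "\<lambda>K. - G K" "- g"] mps_lim_uminus[of G g] by simp

lemma mps_lim_map:
  assumes "mps_lim F f"
  shows "mps_lim (\<lambda>K. mps_map h (F K)) (mps_map h f)"
  unfolding mps_lim_def
proof
  fix M
  have "eventually (\<lambda>K. mps_coeff (F K) M = mps_coeff f M) sequentially"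
    using assms by (simp add: mps_lim_def)
  then show "eventually (\<lambda>K. mps_coeff (mps_map h (F K)) M = mps_coeff (mps_map h f) M) sequentially"
    by eventually_elim (simp add: mps_map.rep_eq)
qed

section \<open>Exponentials in one variable\<close>

definition fps_map :: "('a :: zero \<Rightarrow> 'b :: zero) \<Rightarrow> 'a fps \<Rightarrow> 'b fps" where
  "fps_map d F = Abs_fps (\<lambda>n. d (fps_nth F n))"

lemma fps_map_nth [simp]: "fps_nth (fps_map d F) n = d (fps_nth F n)"
  by (simp add: fps_map_def)

lemma derivation_fps_map:
  assumes "derivation d"
  shows "derivation (fps_map d)"
  by (rule derivationI; rule fps_ext)
     (simp_all add: derivation_add[OF assms] fps_mult_nth derivation_sum[OF assms]
        derivation_mult[OF assms] sum.distrib)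

lemma fps_power_nth_eq_0:
  fixes G :: "'a :: comm_ring_1 fps"
  assumes "fps_nth G 0 = 0" "m < n"
  shows "fps_nth (G ^ n) m = 0"
  using assms(2)
proof (induction n arbitrary: m)
  case (Suc n)
  have "fps_nth G i * fps_nth (G ^ n) (m - i) = 0" if "i \<le> m" for i
    using Suc that assms(1) by (cases "i = 0") auto
  then show ?case by (simp add: fps_mult_nth)
qed simp

definition fexp :: "'a :: {real_algebra_1, comm_ring_1} fps \<Rightarrow> 'a fps" where
  "fexp G = Abs_fps (\<lambda>m. \<Sum>n\<le>m. (1 / fact n) *\<^sub>R fps_nth (G ^ n) m)"

lemma fexp_nth_le:
  assumes "fps_nth G 0 = 0" "m \<le> N"
  shows "fps_nth (fexp G) m = (\<Sum>n\<le>N. (1 / fact n) *\<^sub>R fps_nth (G ^ n) m)"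
  unfolding fexp_def fps_nth_Abs_fps
  by (rule sum.mono_neutral_left) (use assms fps_power_nth_eq_0[OF assms(1)] in auto)

text \<open>Finiteness comes from the order in \<open>fps_X\<close>, which \<open>fps_map\<close>
  preserves; this takes the place of the locality hypothesis used for
  \<open>mps_exp\<close>.\<close>

lemma derivation_fexp:
  assumes d: "derivation d" and scaleR: "\<And>r a. d (r *\<^sub>R a) = r *\<^sub>R d a"
    and G: "fps_nth G 0 = 0"
  shows "fps_map d (fexp G) = fexp G * fps_map d G"
proof (rule fps_ext)
  fix m
  note D = derivation_fps_map[OF d]
  have *: "(1 / fact (Suc n)) *\<^sub>R d (fps_nth (G ^ Suc n) m) = (1 / fact n) *\<^sub>R fps_nth (G ^ n * fps_map d G) m" for n
  proof -
    have "d (fps_nth (G ^ Suc n) m) = fps_nth (of_nat (Suc n) * (G ^ n * fps_map d G)) m"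
      using derivation_power_Suc[OF D, of G n] by (metis fps_map_nth mult.assoc)
    also have "\<dots> = real (Suc n) *\<^sub>R fps_nth (G ^ n * fps_map d G) m"
      by (simp only: fps_of_nat[symmetric] fps_mult_left_const_nth scaleR_conv_of_real of_real_of_nat_eq)
    finally have "(1 / fact (Suc n)) *\<^sub>R d (fps_nth (G ^ Suc n) m)
       = (1 / fact (Suc n) * real (Suc n)) *\<^sub>R fps_nth (G ^ n * fps_map d G) m" by simp
    also have "1 / fact (Suc n) * real (Suc n) = (1 / fact n :: real)"
      by (simp add: field_simps fact_Suc del: of_nat_Suc)
    finally show ?thesis .
  qed
  \<comment> \<open>The term n = m + 1 is zero because \<open>G\<close> starts in degree one; it is
    included so that the shifted index ends at m.\<close>
  have "fps_nth (fps_map d (fexp G)) m = (\<Sum>n\<le>Suc m. (1 / fact n) *\<^sub>R d (fps_nth (G ^ n) m))"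
    by (simp only: fps_map_nth fexp_nth_le[OF G, of m "Suc m"] le_SucI order.refl derivation_sum[OF d] scaleR)
  also have "\<dots> = (1 / fact 0) *\<^sub>R d (fps_nth (G ^ 0) m) +
     (\<Sum>n\<le>m. (1 / fact (Suc n)) *\<^sub>R d (fps_nth (G ^ Suc n) m))"
    by (rule sum.atMost_Suc_shift)
  also have "(1 / fact 0) *\<^sub>R d (fps_nth (G ^ 0) m) = 0"
    by (simp add: derivation_0[OF d] derivation_1[OF d])
  also have "(\<Sum>n\<le>m. (1 / fact (Suc n)) *\<^sub>R d (fps_nth (G ^ Suc n) m))
     = (\<Sum>n\<le>m. (1 / fact n) *\<^sub>R fps_nth (G ^ n * fps_map d G) m)"
    by (simp only: *)
  also have "\<dots> = (\<Sum>i\<le>m. (\<Sum>n\<le>m. (1 / fact n) *\<^sub>R fps_nth (G ^ n) i) * fps_nth (fps_map d G) (m - i))"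
    unfolding fps_mult_nth atLeast0AtMost scaleR_sum_right sum_distrib_right
    by (subst sum.swap) simp
  also have "\<dots> = fps_nth (fexp G * fps_map d G) m"
    unfolding fps_mult_nth atLeast0AtMost by (rule sum.cong) (auto simp: fexp_nth_le[OF G, of _ m])
  finally show "fps_nth (fps_map d (fexp G)) m = fps_nth (fexp G * fps_map d G) m" by simp
qed

lemma schur_fexp: "schur t m = fps_nth (fexp (Abs_fps (\<lambda>j. if j = 0 then 0 else t j))) m"
  by (simp add: schur_def fexp_def)

section \<open>Laurent series with power series coefficients\<close>

lemma fls_lower_bound:
  fixes f :: "'a :: zero fls"
  shows "\<exists>N. \<forall>n<N. fls_nth f n = 0"
  by (metis fls_nth_vanishes_belowE)

lemma nth_Abs_fls_zero:
  assumes "\<And>n. fls_nth f n = 0 \<Longrightarrow> g n = 0"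
  shows "fls_nth (Abs_fls g) n = g n"
  using fls_lower_bound[of f] assms by (intro nth_Abs_fls_ex_lower_bound) auto

text \<open>A coefficientwise map can kill leading terms and so change the subdegree; arbitrary
  lower bounds give one range of summation for a product and its images.\<close>

lemma fls_times_nth_bounds:
  fixes f g :: "'a :: comm_ring_1 fls"
  assumes "\<forall>n<a. fls_nth f n = 0" "\<forall>n<b. fls_nth g n = 0"
  shows "fls_nth (f * g) n = (\<Sum>i=a..n-b. fls_nth f i * fls_nth g (n - i))"
  unfolding fls_times_nth(2)[of f g n]
proof (rule sum.mono_neutral_cong)
  fix i
  show "i \<in> {a..n - b} - {fls_subdegree f..n - fls_subdegree g} \<Longrightarrow> fls_nth f i * fls_nth g (n - i) = 0"
    by (cases "i < fls_subdegree f") auto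
  show "i \<in> {fls_subdegree f..n - fls_subdegree g} - {a..n - b} \<Longrightarrow> fls_nth f i * fls_nth g (n - i) = 0"
    using assms by (cases "i < a") auto
qed auto

definition fls_map :: "('a :: zero \<Rightarrow> 'b :: zero) \<Rightarrow> 'a fls \<Rightarrow> 'b fls" where
  "fls_map d F = Abs_fls (\<lambda>n. d (fls_nth F n))"

text \<open>The operator z d/dz.\<close>

definition fls_zder :: "'a :: comm_ring_1 fls \<Rightarrow> 'a fls" where
  "fls_zder F = Abs_fls (\<lambda>n. of_int n * fls_nth F n)"

definition fls_neg :: "'a :: zero fls \<Rightarrow> 'a fls" where
  "fls_neg F = Abs_fls (\<lambda>n. if n < 0 then fls_nth F n else 0)"

lemma fls_map_nth: "d 0 = 0 \<Longrightarrow> fls_nth (fls_map d F) n = d (fls_nth F n)"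
  unfolding fls_map_def by (rule nth_Abs_fls_zero[of F]) auto

lemma fls_zder_nth [simp]: "fls_nth (fls_zder F) n = of_int n * fls_nth F n"
  unfolding fls_zder_def by (rule nth_Abs_fls_zero[of F]) auto

lemma fls_neg_nth [simp]: "fls_nth (fls_neg F) n = (if n < 0 then fls_nth F n else 0)"
  unfolding fls_neg_def by (rule nth_Abs_fls_zero[of F]) auto

lemma derivation_fls_map:
  fixes d :: "'a :: comm_ring_1 \<Rightarrow> 'a"
  assumes d: "derivation d"
  shows "derivation (fls_map d)"
proof (rule derivationI; rule fls_eqI)
  note nth = fls_map_nth[of d, OF derivation_0[OF d]]
  fix f g :: "'a fls" and n
  show "fls_nth (fls_map d (f + g)) n = fls_nth (fls_map d f + fls_map d g) n"
    by (simp add: nth derivation_add[OF d])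
  obtain a b where a: "\<forall>n<a. fls_nth f n = 0" and b: "\<forall>n<b. fls_nth g n = 0"
    using fls_lower_bound by metis
  have a': "\<forall>n<a. fls_nth (fls_map d f) n = 0" and b': "\<forall>n<b. fls_nth (fls_map d g) n = 0"
    by (auto simp: nth a b derivation_0[OF d])
  have "fls_nth (fls_map d (f * g)) n = d (fls_nth (f * g) n)" by (rule nth)
  also have "\<dots> = fls_nth (f * fls_map d g) n + fls_nth (fls_map d f * g) n"
    unfolding fls_times_nth_bounds[of a f b g, OF a b] fls_times_nth_bounds[of a f b "fls_map d g", OF a b']
      fls_times_nth_bounds[of a "fls_map d f" b g, OF a' b]
    by (simp add: derivation_sum[OF d] derivation_mult[OF d] sum.distrib nth)
  finally show "fls_nth (fls_map d (f * g)) n = fls_nth (f * fls_map d g + fls_map d f * g) n" by simp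
qed

lemma derivation_fls_zder: "derivation (fls_zder :: 'a :: comm_ring_1 fls \<Rightarrow> _)"
proof (rule derivationI; rule fls_eqI)
  fix f g :: "'a fls" and n
  show "fls_nth (fls_zder (f + g)) n = fls_nth (fls_zder f + fls_zder g) n"
    by (simp add: algebra_simps)
  obtain a b where a: "\<forall>n<a. fls_nth f n = 0" and b: "\<forall>n<b. fls_nth g n = 0"
    using fls_lower_bound by metis
  have a': "\<forall>n<a. fls_nth (fls_zder f) n = 0" and b': "\<forall>n<b. fls_nth (fls_zder g) n = 0"
    by (auto simp: a b)
  show "fls_nth (fls_zder (f * g)) n = fls_nth (f * fls_zder g + fls_zder f * g) n"
    unfolding fls_zder_nth fls_plus_nth fls_times_nth_bounds[of a f b g, OF a b]
      fls_times_nth_bounds[of a f b "fls_zder g", OF a b']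
      fls_times_nth_bounds[of a "fls_zder f" b g, OF a' b] sum_distrib_left sum.distrib[symmetric]
    by (rule sum.cong) (auto simp: algebra_simps)
qed

text \<open>
  Laurent series in \<open>z\<close> are the coefficients of power series in \<open>w\<close>, not conversely: the powers
  of \<open>z\<close> in the inverse of \<open>1 - B\<close> are bounded below for each monomial in \<open>w\<close>, but not uniformly.
\<close>

definition nthz :: "int \<Rightarrow> ('w, 'a :: comm_ring_1 fls) mps \<Rightarrow> ('w, 'a) mps" where
  "nthz n = mps_map (\<lambda>F. fls_nth F n)"

definition emb :: "('w, 'a :: comm_ring_1) mps \<Rightarrow> ('w, 'a fls) mps" where
  "emb = mps_map fls_const"

definition zpow :: "int \<Rightarrow> ('w, 'a :: comm_ring_1 fls) mps" where
  "zpow k = mps_const (fls_X_intpow k)"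

definition negz :: "('w, 'a :: comm_ring_1 fls) mps \<Rightarrow> ('w, 'a fls) mps" where
  "negz = mps_map fls_neg"

definition zder :: "('w, 'a :: comm_ring_1 fls) mps \<Rightarrow> ('w, 'a fls) mps" where
  "zder = mps_map fls_zder"

lemma mps_coeff_nthz: "mps_coeff (nthz n A) M = fls_nth (mps_coeff A M) n"
  by (simp add: nthz_def mps_map.rep_eq)

lemma nthz_eqI: "(\<And>n. nthz n A = nthz n B) \<Longrightarrow> A = B"
  by (intro mps_eqI fls_eqI) (metis mps_coeff_nthz)

lemma nthz_simps [simp]:
  "nthz n 0 = 0" "nthz n (A + B) = nthz n A + nthz n B" "nthz n (A - B) = nthz n A - nthz n B"
  "nthz n (- A) = - nthz n A" "nthz n (mps_const c) = mps_const (fls_nth c n)"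
  by (auto intro!: mps_eqI simp: mps_coeff_nthz mps_coeff_simps)

lemma nthz_sum: "nthz n (\<Sum>i\<in>I. A i) = (\<Sum>i\<in>I. nthz n (A i))"
  by (induction I rule: infinite_finite_induct) auto

lemma nthz_negz [simp]: "nthz n (negz A) = (if n < 0 then nthz n A else 0)"
  by (rule mps_eqI) (simp add: negz_def mps_coeff_nthz mps_coeff_simps)

lemma nthz_zder [simp]:
  fixes A :: "('w, 'a :: comm_ring_1 fls) mps"
  shows "nthz n (zder A) = of_int n * nthz n A"
proof -
  have *: "(of_int n :: ('w, 'a) mps) = mps_const (of_int n)" for n
    by (induction n rule: int_induct[of _ 0]) (auto simp: simp flip: mps_const_simps(3,4) mps_const_simps(2))
  show ?thesis
    by (rule mps_eqI) (simp add: zder_def mps_coeff_nthz mps_coeff_simps * mps_coeff_const_times)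
qed

lemma nthz_zpow_times [simp]: "nthz n (zpow k * A) = nthz (n - k) A"
  by (rule mps_eqI)
     (simp add: zpow_def mps_coeff_nthz mps_coeff_const_times fls_X_intpow_times_conv_shift)

lemma zpow_0 [simp]: "zpow 0 = 1"
  by (simp add: zpow_def)

lemma emb_simps [simp]:
  "emb 0 = 0" "emb 1 = 1" "emb (a + b) = emb a + emb b" "emb (a - b) = emb a - emb b"
  "emb (- a) = - emb a"
  by (auto intro!: mps_eqI simp: emb_def mps_coeff_simps fls_plus_const fls_minus_const)

lemma emb_times: "emb (a * b) = emb a * emb b"
  unfolding emb_def by (rule mps_map_times) (auto simp: fls_plus_const)

lemma nthz_emb [simp]: "nthz n (emb a) = (if n = 0 then a else 0)"
  by (rule mps_eqI) (simp add: emb_def mps_coeff_nthz mps_coeff_simps)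

lemma nthz_emb_times [simp]: "nthz n (emb a * A) = a * nthz n A"
  by (rule mps_eqI)
     (simp add: mps_coeff_nthz mps_coeff_times fls_nth_sum case_prod_unfold emb_def mps_map.rep_eq)

lemma nthz_times_emb [simp]: "nthz n (A * emb a) = nthz n A * a"
  by (metis mult.commute nthz_emb_times)

lemma nthz_pderiv: "mps_pderiv v (nthz n A) = nthz n (mps_pderiv v A)"
  unfolding nthz_def by (rule pderiv_map) simp

lemma nthz_euler: "euler (nthz n A) = nthz n (euler A)"
  unfolding nthz_def by (rule euler_map) simp

lemma emb_euler: "euler (emb a) = emb (euler a)"
  unfolding emb_def by (rule euler_map) (simp add: fls_plus_const)

lemma derivation_zder: "derivation zder"
  unfolding zder_def by (rule mps_map_derivation[OF derivation_fls_zder])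

lemma euler_zder: "euler (zder A) = zder (euler A)"
  unfolding zder_def by (rule euler_map) (simp add: derivation_add[OF derivation_fls_zder])

text \<open>Both bounds are uniform in the monomials of w. The series \<open>GamL\<close> below has
  such an upper bound but no lower one.\<close>

definition zge :: "int \<Rightarrow> ('w, 'a :: comm_ring_1 fls) mps \<Rightarrow> bool" where
  "zge N A \<longleftrightarrow> (\<forall>n<N. nthz n A = 0)"

definition zle :: "int \<Rightarrow> ('w, 'a :: comm_ring_1 fls) mps \<Rightarrow> bool" where
  "zle N A \<longleftrightarrow> (\<forall>n>N. nthz n A = 0)"

lemma zge_alt: "zge N A \<longleftrightarrow> (\<forall>M. \<forall>n<N. fls_nth (mps_coeff A M) n = 0)"
  unfolding zge_def by (metis mps_coeff_nthz mps_eqI zero_mps.rep_eq)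

lemma zle_alt: "zle N A \<longleftrightarrow> (\<forall>M. \<forall>n>N. fls_nth (mps_coeff A M) n = 0)"
  unfolding zle_def by (metis mps_coeff_nthz mps_eqI zero_mps.rep_eq)

lemma zge_times:
  assumes "zge a A" "zge b B"
  shows "zge (a + b) (A * B)"
  unfolding zge_alt
proof (intro allI impI)
  fix M n assume n: "n < a + b"
  have "fls_nth (mps_coeff A C * mps_coeff B D) n = 0" for C D
    using assms n fls_times_nth_bounds[of a "mps_coeff A C" b "mps_coeff B D" n] by (auto simp: zge_alt)
  then show "fls_nth (mps_coeff (A * B) M) n = 0"
    by (simp add: mps_coeff_times fls_nth_sum case_prod_unfold)
qed

lemma zle_times:
  assumes "zle a A" "zle b B"
  shows "zle (a + b) (A * B)"
  unfolding zle_alt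
proof (intro allI impI)
  fix M n assume n: "n > a + b"
  have "fls_nth (mps_coeff A C * mps_coeff B D) n = 0" for C D
    unfolding fls_times_nth(2)
  proof (rule sum.neutral, rule ballI)
    fix i
    show "fls_nth (mps_coeff A C) i * fls_nth (mps_coeff B D) (n - i) = 0"
      using assms n unfolding zle_alt by (cases "i > a") auto
  qed
  then show "fls_nth (mps_coeff (A * B) M) n = 0"
    by (simp add: mps_coeff_times fls_nth_sum case_prod_unfold)
qed

lemma zge_mono: "zge a A \<Longrightarrow> b \<le> a \<Longrightarrow> zge b A"
  and zle_mono: "zle a A \<Longrightarrow> a \<le> b \<Longrightarrow> zle b A"
  by (auto simp: zge_def zle_def)

lemma zle_diff: "zle a A \<Longrightarrow> zle a B \<Longrightarrow> zle a (A - B)"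
  by (auto simp: zle_def)

lemma zge_0_1: "zge 0 1" and zle_0_1: "zle 0 1"
  by (auto simp: zge_alt zle_alt one_mps.rep_eq)

lemma zle_power: "zle 0 A \<Longrightarrow> zle 0 (A ^ n)"
  by (induction n) (auto simp: zle_0_1 dest: zle_times)

lemma zle_negz: "zle (- 1) (negz A)"
  by (auto simp: zle_def)

lemma negz_zge: "zge 0 A \<Longrightarrow> negz A = 0"
  by (rule nthz_eqI) (auto simp: zge_def)

lemma negz_zle: "zle (- 1) A \<Longrightarrow> negz A = A"
  by (rule nthz_eqI) (auto simp: zle_def)

lemma negz_simps: "negz (A + B) = negz A + negz B" "negz (A - B) = negz A - negz B"
  by (rule nthz_eqI; simp)+

lemma nthz_one: "nthz n 1 = (if n = 0 then 1 else 0)"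
  using nthz_emb[of n 1] by simp

lemma nthz_zpow: "nthz n (zpow k) = (if n = k then 1 else 0)"
  using nthz_zpow_times[of n k 1] by (simp add: nthz_one)

lemma zge_zpow: "zge k (zpow k)"
  by (simp add: zge_def nthz_zpow)

lemma zle_emb: "zle 0 (emb a)"
  by (auto simp: zle_def)

text \<open>Only the finitely many divisors of \<open>M\<close> matter, and their coefficients in
  \<open>A\<close> have a common lower bound in z; for large \<open>K\<close> the factor
  \<open>R K\<close> pushes everything above z^n. This is how the remainders of the cut-offs
  vanish.\<close>

lemma mps_lim_nthz_zge:
  assumes "\<And>K. zge (int K) (R K)"
  shows "mps_lim (\<lambda>K. nthz n (R K * A)) 0"
  unfolding mps_lim_def
proof
  fix M
  have "\<exists>N. \<forall>C\<in>{C. C \<subseteq># M}. \<forall>n<N. fls_nth (mps_coeff A C) n = 0"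
    using finite_submultisets[of M]
  proof induction
    case (insert C S)
    then obtain N where N: "\<forall>C\<in>S. \<forall>n<N. fls_nth (mps_coeff A C) n = 0" by blast
    obtain N' where "\<forall>n<N'. fls_nth (mps_coeff A C) n = 0" using fls_lower_bound by blast
    with N show ?case by (intro exI[of _ "min N N'"]) auto
  qed auto
  then obtain N where N: "\<And>C n. C \<subseteq># M \<Longrightarrow> n < N \<Longrightarrow> fls_nth (mps_coeff A C) n = 0" by blast
  have "mps_coeff (nthz n (R K * A)) M = 0" if K: "K > nat (n - N)" for K
  proof -
    have "fls_nth (mps_coeff (R K) C * mps_coeff A D) n = 0" if "C + D = M" for C D
    proof -
      have "D \<subseteq># M" using that by auto
      then show ?thesis
        using assms[of K] K fls_times_nth_bounds[of "int K" "mps_coeff (R K) C" N "mps_coeff A D" n] N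
        by (auto simp: zge_alt)
    qed
    then show ?thesis
      by (simp add: mps_coeff_nthz mps_coeff_times fls_nth_sum case_prod_unfold)
  qed
  then show "eventually (\<lambda>K. mps_coeff (nthz n (R K * A)) M = mps_coeff 0 M) sequentially"
    by (auto simp: eventually_at_top_dense zero_mps.rep_eq)
qed

text \<open>Here \<open>fps_X\<close> stands for \<open>z\<^sup>-\<^sup>1\<close>; positive powers of \<open>z\<close> are dropped.\<close>

definition zinv_fps :: "('w, 'a :: comm_ring_1 fls) mps \<Rightarrow> ('w, 'a) mps fps" where
  "zinv_fps A = Abs_fps (\<lambda>n. nthz (- int n) A)"

lemma zinv_fps_nth [simp]: "fps_nth (zinv_fps A) n = nthz (- int n) A"
  by (simp add: zinv_fps_def)

text \<open>Without positive powers of z in the factors, dropping them loses nothing. This carries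
  identities between Laurent series over to power series in 1/z.\<close>

lemma zinv_fps_times:
  assumes "zle 0 A" "zle 0 B"
  shows "zinv_fps (A * B) = zinv_fps A * zinv_fps B"
proof (rule fps_ext, rule mps_eqI)
  fix n M
  have *: "fls_nth (mps_coeff A C * mps_coeff B D) (- int n)
    = (\<Sum>i\<le>n. fls_nth (mps_coeff A C) (- int i) * fls_nth (mps_coeff B D) (- int (n - i)))" (is "_ = ?S") for C D
  proof -
    obtain a b where a: "\<forall>n<a. fls_nth (mps_coeff A C) n = 0"
      and b: "\<forall>n<b. fls_nth (mps_coeff B D) n = 0"
      using fls_lower_bound by metis
    have "fls_nth (mps_coeff A C * mps_coeff B D) (- int n) =
      (\<Sum>i=a..- int n - b. fls_nth (mps_coeff A C) i * fls_nth (mps_coeff B D) (- int n - i))"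
      by (rule fls_times_nth_bounds[OF a b])
    also have "\<dots> = (\<Sum>i=- int n..0. fls_nth (mps_coeff A C) i * fls_nth (mps_coeff B D) (- int n - i))"
    proof (rule sum.mono_neutral_cong)
      fix i
      show "i \<in> {- int n..0} - {a..- int n - b} \<Longrightarrow> fls_nth (mps_coeff A C) i * fls_nth (mps_coeff B D) (- int n - i) = 0"
        using a b by (cases "i < a") auto
      show "i \<in> {a..- int n - b} - {- int n..0} \<Longrightarrow> fls_nth (mps_coeff A C) i * fls_nth (mps_coeff B D) (- int n - i) = 0"
        using assms by (cases "i > 0") (auto simp: zle_alt)
    qed auto
    also have "\<dots> = ?S"
      by (rule sum.reindex_bij_witness[of _ "\<lambda>i. - int i" "\<lambda>i. nat (- i)"]) (auto simp: of_nat_diff)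
    finally show ?thesis .
  qed
  show "mps_coeff (fps_nth (zinv_fps (A * B)) n) M = mps_coeff (fps_nth (zinv_fps A * zinv_fps B) n) M"
    by (simp add: fps_mult_nth mps_coeff_nthz mps_coeff_sum mps_coeff_times fls_nth_sum case_prod_unfold *
        atLeast0AtMost sum.swap[of _ "{..n}"])
qed

lemma zinv_fps_1: "zinv_fps 1 = 1"
  by (rule fps_ext) (auto simp: nthz_one)

lemma zinv_fps_power: "zle 0 A \<Longrightarrow> zinv_fps (A ^ n) = zinv_fps A ^ n"
  by (induction n) (auto simp: zinv_fps_1 zinv_fps_times zle_power)

section \<open>Derivations of the innermost coefficient ring\<close>

definition lder :: "('a :: comm_ring_1 \<Rightarrow> 'a) \<Rightarrow> ('w, 'a fls) mps \<Rightarrow> ('w, 'a fls) mps" where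
  "lder d = mps_map (fls_map d)"

lemma derivation_lder: "derivation d \<Longrightarrow> derivation (lder d)"
  unfolding lder_def by (intro mps_map_derivation derivation_fls_map)

lemma nthz_lder: "derivation d \<Longrightarrow> nthz n (lder d A) = mps_map d (nthz n A)"
  by (rule mps_eqI) (simp add: lder_def nthz_def mps_map.rep_eq fls_map_nth derivation_0)

lemma lder_emb: "derivation d \<Longrightarrow> lder d (emb a) = emb (mps_map d a)"
  by (rule mps_eqI) (auto simp: lder_def emb_def mps_map.rep_eq fls_map_nth derivation_0 intro!: fls_eqI)

lemma euler_lder: "derivation d \<Longrightarrow> euler (lder d A) = lder d (euler A)"
  unfolding lder_def by (rule euler_map) (simp add: derivation_add derivation_fls_map)

lemma derivation_of_nat_times: "derivation d \<Longrightarrow> d (of_nat n * a) = of_nat n * d a"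
  by (induction n) (auto simp: derivation_0 derivation_add algebra_simps)

lemma of_nat_times_scaleR: "of_nat n * (r *\<^sub>R a) = (real n * r) *\<^sub>R (a :: 'a :: real_algebra_1)"
  by (simp add: scaleR_conv_of_real mult.assoc)

section \<open>Schur polynomials\<close>

abbreviation dX :: "nat \<Rightarrow> xyser \<Rightarrow> xyser" where "dX k \<equiv> mps_pderiv (Vx k)"
abbreviation dY :: "nat \<Rightarrow> xyser \<Rightarrow> xyser" where "dY k \<equiv> mps_pderiv (Vy k)"

definition dXY :: "nat \<Rightarrow> xyser \<Rightarrow> xyser" where
  "dXY k a = dX k a - dY k a"

lemma derivation_dXY: "derivation (dXY k)"
  unfolding dXY_def[abs_def] by (intro derivation_diff_fun derivation_pderiv)

lemma dXY_scaleR: "dXY k (r *\<^sub>R a) = r *\<^sub>R dXY k a"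
  by (simp add: dXY_def pderiv_scaleR scaleR_diff_right)

lemma derivation_schur:
  assumes "derivation d" "\<And>r a. d (r *\<^sub>R a) = r *\<^sub>R d a"
  shows "fps_map d (Abs_fps (schur t)) = Abs_fps (schur t) * Abs_fps (\<lambda>j. if j = 0 then 0 else d (t j))"
proof -
  define T where "T = Abs_fps (\<lambda>j. if j = 0 then 0 else t j)"
  have T: "fps_nth T 0 = 0" by (simp add: T_def)
  have "Abs_fps (schur t) = fexp T"
    by (rule fps_ext) (simp add: schur_fexp T_def)
  moreover have "fps_map d T = Abs_fps (\<lambda>j. if j = 0 then 0 else d (t j))"
    by (rule fps_ext) (simp add: T_def derivation_0[OF assms(1)])
  ultimately show ?thesis using derivation_fexp[OF assms T] by simp
qed

text \<open>If \<open>d\<close> moves only t_k, it multiplies the generating series by c w^k, which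
  shifts the coefficients by k. With c = 0 it says that \<open>dXY\<close> annihilates functions of
  x + y.\<close>

lemma derivation_schur_nth:
  assumes "derivation d" "\<And>r a. d (r *\<^sub>R a) = r *\<^sub>R d a"
    and k: "k \<ge> 1" and t: "\<And>j. j \<ge> 1 \<Longrightarrow> d (t j) = (if j = k then c else 0)"
  shows "d (schur t m) = (if k \<le> m then c * schur t (m - k) else 0)"
proof -
  have *: "Abs_fps (\<lambda>j. if j = 0 then 0 else d (t j)) = fps_const c * fps_X ^ k"
    using k by (intro fps_ext) (auto simp: t fps_X_power_nth)
  have "d (schur t m) = fps_nth (fps_map d (Abs_fps (schur t))) m" by simp
  also have "\<dots> = fps_nth (fps_const c * Abs_fps (schur t) * fps_X ^ k) m"
    by (simp only: derivation_schur[OF assms(1,2)] * mult_ac)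
  also have "\<dots> = (if k \<le> m then c * schur t (m - k) else 0)"
    by (subst fps_X_power_mult_right_nth) auto
  finally show ?thesis .
qed

lemma dX_Splus: "k \<ge> 1 \<Longrightarrow> dX k (Splus m) = (if k \<le> m then Splus (m - k) else 0)"
  using derivation_schur_nth[of "dX k" k "\<lambda>n. xx n + yy n" 1 m]
  by (auto simp: derivation_pderiv pderiv_scaleR derivation_add[OF derivation_pderiv] pderiv_var)

lemma dX_Sminus: "k \<ge> 1 \<Longrightarrow> dX k (Sminus m) = (if k \<le> m then - Sminus (m - k) else 0)"
  using derivation_schur_nth[of "dX k" k "\<lambda>n. - xx n - yy n" "- 1" m]
  by (auto simp: derivation_pderiv pderiv_scaleR derivation_diff[OF derivation_pderiv]
      derivation_uminus[OF derivation_pderiv] pderiv_var)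

lemma dXY_Splus: "k \<ge> 1 \<Longrightarrow> dXY k (Splus m) = 0"
  using derivation_schur_nth[OF derivation_dXY dXY_scaleR, where k = k and t = "\<lambda>n. xx n + yy n" and c = 0 and m = m]
  by (auto simp: dXY_def derivation_add[OF derivation_pderiv] pderiv_var)

lemma dXY_Sminus: "k \<ge> 1 \<Longrightarrow> dXY k (Sminus m) = 0"
  using derivation_schur_nth[OF derivation_dXY dXY_scaleR, where k = k and t = "\<lambda>n. - xx n - yy n" and c = 0 and m = m]
  by (auto simp: dXY_def derivation_diff[OF derivation_pderiv]
      derivation_uminus[OF derivation_pderiv] pderiv_var)

text \<open>Stands in for the addition theorem of the exponential: a product is 1 when the
  logarithmic derivatives of its factors cancel and its value at the origin is right.\<close>

lemma fps_eq_1_if_euler_0: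
  fixes F :: "('v, 'a :: {real_algebra_1, comm_ring_1}) mps fps"
  assumes "fps_map euler F = 0" "\<And>n. mps_coeff (fps_nth F n) {#} = (if n = 0 then 1 else 0)"
  shows "F = 1"
proof (rule fps_ext)
  fix n
  have "euler (fps_nth F n) = fps_nth (fps_map euler F) n" by simp
  then have "euler (fps_nth F n) = euler (fps_nth 1 n)"
    using assms(1) by (auto simp: derivation_0[OF derivation_euler] derivation_1[OF derivation_euler])
  then show "fps_nth F n = fps_nth 1 n"
    by (rule euler_inject) (auto simp: assms(2) mps_coeff_simps)
qed

lemma mps_coeff_empty_fps_times:
  fixes F G :: "('v, 'a :: comm_ring_1) mps fps"
  assumes "\<And>n. mps_coeff (fps_nth F n) {#} = (if n = 0 then 1 else 0)"
  shows "mps_coeff (fps_nth (F * G) n) {#} = mps_coeff (fps_nth G n) {#}"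
proof -
  have "mps_coeff (fps_nth (F * G) n) {#} = (\<Sum>i\<le>n. if i = 0 then mps_coeff (fps_nth G n) {#} else 0)"
    unfolding fps_mult_nth mps_coeff_sum atLeast0AtMost
    by (rule sum.cong) (auto simp: mps_coeff_times_empty assms)
  then show ?thesis by simp
qed

lemma fexp_empty:
  fixes G :: "('v, 'a :: {real_algebra_1, comm_ring_1}) mps fps"
  assumes "\<And>n. mps_coeff (fps_nth G n) {#} = 0" "fps_nth G 0 = 0"
  shows "mps_coeff (fps_nth (fexp G) n) {#} = (if n = 0 then 1 else 0)"
proof -
  have "mps_coeff (fps_nth (G ^ j) m) {#} = 0" if "j \<noteq> 0" for j m
    using that by (cases j) (auto simp: fps_mult_nth mps_coeff_sum mps_coeff_times_empty assms)
  then have "(\<Sum>j\<le>n. (1 / fact j) *\<^sub>R mps_coeff (fps_nth (G ^ j) n) {#})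
      = (\<Sum>j\<le>n. if j = 0 then mps_coeff (fps_nth (G ^ 0) n) {#} else 0)"
    by (intro sum.cong) auto
  then show ?thesis
    by (simp add: fexp_def mps_coeff_sum mps_coeff_simps)
qed

lemma schur_inverse: "Abs_fps Splus * Abs_fps Sminus = 1"
proof (rule fps_eq_1_if_euler_0)
  define T where "T = (Abs_fps (\<lambda>j. if j = 0 then 0 else xx j + yy j))"
  note D = derivation_fps_map[OF derivation_euler]
  have E: "Abs_fps Splus = fexp T" "Abs_fps Sminus = fexp (- T)"
    by (auto intro!: fps_ext simp: schur_fexp T_def fps_eq_iff
       intro!: arg_cong[where f = "\<lambda>u. fps_nth (fexp u) _"])
  have "fps_map euler (fexp T) = fexp T * fps_map euler T"
    "fps_map euler (fexp (- T)) = fexp (- T) * fps_map euler (- T)"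
    by (rule derivation_fexp[OF derivation_euler grade_scaleR]; simp add: T_def)+
  then show "fps_map euler (Abs_fps Splus * Abs_fps Sminus) = 0"
    by (simp add: E derivation_mult[OF D] derivation_uminus[OF D] mult_ac)
  have T0: "fps_nth T 0 = 0" by (simp add: T_def)
  have "mps_coeff (fps_nth T n) {#} = 0" for n
    by (simp add: T_def mps_coeff_simps mps_var.rep_eq)
  then have "mps_coeff (fps_nth (fexp T) n) {#} = (if n = 0 then 1 else 0)"
    "mps_coeff (fps_nth (fexp (- T)) n) {#} = (if n = 0 then 1 else 0)" for n
    using fexp_empty[of T n] fexp_empty[of "- T" n] T0 by (simp_all add: uminus_mps.rep_eq)
  then show "mps_coeff (fps_nth (Abs_fps Splus * Abs_fps Sminus) n) {#} = (if n = 0 then 1 else 0)" for n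
    by (simp add: E mps_coeff_empty_fps_times)
qed

section \<open>The logarithm of the tau function\<close>

type_synonym wlser = "(wvar, xyser fls) mps"

abbreviation "Eplus \<equiv> fps_to_fls (Abs_fps Splus)"
abbreviation "Eminus \<equiv> fps_to_fls (Abs_fps Sminus)"

definition EplusL :: wlser where "EplusL = mps_const Eplus"
definition EminusL :: wlser where "EminusL = mps_const Eminus"
text \<open>z times the part of the current that multiplies by the variables x.\<close>

definition YL :: wlser where
  "YL = mps_const (fps_to_fls (Abs_fps (\<lambda>k. of_nat k * xx k)))"

lemma EplusL_EminusL: "EplusL * EminusL = 1"
  by (simp add: EplusL_def EminusL_def mps_const_times schur_inverse flip: fls_times_fps_to_fls)

lemma lder_const: "derivation d \<Longrightarrow> lder d (mps_const c) = mps_const (fls_map d c)"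
  by (rule mps_eqI) (auto simp: lder_def mps_coeff_simps intro!: fls_eqI simp: fls_map_nth derivation_0)

lemma zge_1_YL: "zge 1 YL"
  by (auto simp: zge_def YL_def)

lemma euler_YL: "euler YL = 0" and pderiv_YL: "mps_pderiv v YL = 0"
  by (simp_all add: YL_def)

text \<open>The hypothesis on \<open>d\<close> is what \<open>dX k\<close> and \<open>dXY k\<close>
  have in common.\<close>

lemma lder_YL:
  assumes "derivation d" "\<And>j. j \<ge> 1 \<Longrightarrow> d (xx j) = (if j = k then 1 else 0)" "k \<ge> 1"
  shows "lder d YL = of_nat k * zpow (int k)"
proof (rule nthz_eqI)
  fix n
  have d: "d (of_nat m * xx m) = (if m = k then of_nat k else 0)" for m
    using assms(2)[of m] assms(3) by (cases "m = 0") (auto simp: derivation_of_nat_times[OF assms(1)] derivation_0[OF assms(1)])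
  have "of_nat k = emb (of_nat k :: wser)"
    by (induction k) auto
  then have "nthz n (of_nat k * zpow (int k) :: wlser) = of_nat k * (if n = int k then 1 else 0)"
    by (simp add: nthz_zpow)
  moreover have "mps_const (of_nat m :: xyser) = (of_nat m :: wser)" for m
    by (induction m) (auto simp flip: mps_const_simps(3))
  ultimately show "nthz n (lder d YL) = nthz n (of_nat k * zpow (int k))"
    by (cases n) (auto simp: YL_def lder_const[OF assms(1)] fls_map_nth derivation_0[OF assms(1)] d)
qed

lemma lder_dX_EminusL:
  assumes "k \<ge> 1"
  shows "lder (dX k) EminusL = - zpow (int k) * EminusL"
proof (rule nthz_eqI)
  fix n
  show "nthz n (lder (dX k) EminusL) = nthz n (- zpow (int k) * EminusL)"
    by (auto simp: nthz_lder derivation_pderiv EminusL_def mps_map.rep_eq dX_Sminus[OF assms] nat_diff_distrib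
        derivation_0 lder_const fls_map_nth)
qed

lemma lder_dXY_EminusL: "k \<ge> 1 \<Longrightarrow> lder (dXY k) EminusL = 0"
  by (rule nthz_eqI)
     (auto simp: lder_const EminusL_def derivation_dXY fls_map_nth derivation_0 dXY_Sminus)

section \<open>The kernel B, its geometric series and the logarithm\<close>

context
  fixes \<iota> :: "wvar \<Rightarrow> nat"
begin

text \<open>The parameter \<open>\<iota>\<close> carries the indices of the two operators, l at
  \<open>W1\<close> and k at \<open>W2\<close>, so that both variables are treated alike.\<close>

definition WL :: "wvar \<Rightarrow> wlser" where "WL v = zpow (- int (\<iota> v) - 1) * EplusL"

definition Pfls :: "wvar \<Rightarrow> xyser fls" where
  "Pfls v = fls_neg (fls_X_intpow (- int (\<iota> v) - 1) * Eplus)"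

definition PL :: "wvar \<Rightarrow> wlser" where "PL v = mps_const (Pfls v)"

definition BL :: wlser where "BL = PL W1 * mps_var W1 + PL W2 * mps_var W2"

text \<open>The inverse of \<open>1 - BL\<close>: the degree \<open>n\<close> part of the geometric series is \<open>BL ^ n\<close>.\<close>

definition GamL :: wlser where "GamL = Abs_mps (\<lambda>M. mps_coeff (BL ^ size M) M)"

lemma mps_coeff_GamL: "mps_coeff GamL M = mps_coeff (BL ^ size M) M"
  by (simp add: GamL_def Abs_mps_inverse)

lemma Pfls_nth: "fls_nth (Pfls v) n = (if - int (\<iota> v) - 1 \<le> n \<and> n < 0 then Splus (nat (n + int (\<iota> v) + 1)) else 0)"
  unfolding Pfls_def fls_neg_nth fls_X_intpow_times_conv_shift by (auto intro!: arg_cong[where f = Splus])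

lemma PL_negz: "PL v = negz (WL v)"
  by (rule nthz_eqI)
     (auto simp: PL_def WL_def EplusL_def Pfls_nth intro!: arg_cong[where f = "\<lambda>u. mps_const (Splus u)"])

lemma mps_coeff_PL_var: "mps_coeff (PL v * mps_var v) M = (if M = {#v#} then Pfls v else 0)"
  by (simp add: PL_def mps_coeff_const_times mps_var.rep_eq)

lemma mps_coeff_BL: "mps_coeff BL M = (if M = {#W1#} then Pfls W1 else if M = {#W2#} then Pfls W2 else 0)"
  by (simp add: BL_def plus_mps.rep_eq mps_coeff_PL_var)

lemma mps_coeff_BL_nonzero: "mps_coeff BL M \<noteq> 0 \<Longrightarrow> size M = 1"
  by (auto simp: mps_coeff_BL split: if_splits)

lemma zle_BL: "zle (- 1) BL"
  by (auto simp: zle_alt mps_coeff_BL Pfls_nth)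

lemma zge_BL: "zge (- int (\<iota> W1 + \<iota> W2) - 1) BL"
  by (auto simp: zge_alt mps_coeff_BL Pfls_nth)

lemma euler_BL [simp]: "euler BL = BL"
  by (rule mps_eqI) (simp add: mps_grade.rep_eq mps_coeff_BL)

lemma pderiv_BL [simp]: "mps_pderiv v BL = PL v"
  by (cases v) (simp_all add: BL_def PL_def derivation_add[OF derivation_pderiv]
      derivation_mult[OF derivation_pderiv] pderiv_var)

text \<open>\<open>BL\<close> has only monomials of size one, so a product with it splits off
  exactly one variable and leaves the next lower power in \<open>GamL\<close>.\<close>

lemma mps_coeff_BL_GamL:
  assumes "M \<noteq> {#}"
  shows "mps_coeff (BL * GamL) M = mps_coeff (BL ^ size M) M"
proof -
  have "mps_coeff (BL * GamL) M = mps_coeff (BL * BL ^ (size M - 1)) M"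
    unfolding mps_coeff_times
  proof (rule sum.cong)
    fix p assume p: "p \<in> {(A, C). A + C = M}"
    obtain A C where AC: "p = (A, C)" "A + C = M" using p by auto
    show "(case p of (A, C) \<Rightarrow> mps_coeff BL A * mps_coeff GamL C) =
      (case p of (A, C) \<Rightarrow> mps_coeff BL A * mps_coeff (BL ^ (size M - 1)) C)"
    proof (cases "mps_coeff BL A = 0")
      case False
      then have "size A = 1" by (rule mps_coeff_BL_nonzero)
      then have "size M - 1 = size C" using AC by auto
      then show ?thesis by (simp add: AC mps_coeff_GamL)
    qed (simp add: AC)
  qed simp
  moreover have "BL * BL ^ (size M - 1) = BL ^ size M"
    using assms by (cases "size M") auto
  ultimately show ?thesis by simp
qed

lemma BL_empty [simp]: "mps_coeff BL {#} = 0"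
  by (simp add: mps_coeff_BL)

lemma BL_GamL: "BL * GamL = GamL - 1"
proof (rule mps_eqI)
  fix M
  show "mps_coeff (BL * GamL) M = mps_coeff (GamL - 1) M"
    by (cases "M = {#}")
       (auto simp: mps_coeff_times_empty mps_coeff_BL_GamL minus_mps.rep_eq one_mps.rep_eq mps_coeff_GamL)
qed

lemma GamL_inverse: "(1 - BL) * GamL = 1"
  by (simp add: algebra_simps BL_GamL)

lemma GamL_empty [simp]: "mps_coeff GamL {#} = 1"
  by (simp add: mps_coeff_GamL one_mps.rep_eq)

lemma zle_GamL: "zle 0 GamL"
  using zle_power[of BL] zle_BL by (auto simp: zle_alt mps_coeff_GamL)

lemma derivation_GamL: "derivation d \<Longrightarrow> d GamL = GamL * GamL * d BL"
  by (rule derivation_inverse[OF _ GamL_inverse])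

lemma euler_GamL: "euler GamL = GamL * GamL * BL"
  by (simp add: derivation_GamL[OF derivation_euler])

lemma euler_GamL_times:
  assumes "euler X = X"
  shows "euler (GamL * X) = GamL * GamL * X"
proof -
  have "euler (GamL * X) = GamL * X * (1 + BL * GamL)"
    by (simp add: derivation_mult[OF derivation_euler] euler_GamL assms algebra_simps)
  also have "1 + BL * GamL = GamL" by (simp add: BL_GamL)
  finally show ?thesis by (simp only: mult_ac)
qed

text \<open>On the full exponential \<open>dX k\<close> is multiplication by z^k. This only moves
  powers of z up, so it is compatible with negative parts once the result is projected
  again.\<close>

lemma lder_dX_BL:
  assumes k: "k \<ge> 1"
  shows "lder (dX k) BL = negz (zpow (int k) * BL)"
proof (rule nthz_eqI, rule mps_eqI)
  fix n M
  have *: "dX k (fls_nth (Pfls v) n) = (if n < 0 then fls_nth (Pfls v) (n - int k) else 0)" for v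
    using k by (auto simp: Pfls_nth dX_Splus nat_diff_distrib derivation_0[OF derivation_pderiv]
        intro!: arg_cong[where f = Splus])
  show "mps_coeff (nthz n (lder (dX k) BL)) M = mps_coeff (nthz n (negz (zpow (int k) * BL))) M"
    by (auto simp: nthz_lder derivation_pderiv mps_map.rep_eq mps_coeff_nthz mps_coeff_BL * zero_mps.rep_eq
        derivation_0[OF derivation_pderiv])
qed

lemma lder_dXY_BL:
  assumes k: "k \<ge> 1"
  shows "lder (dXY k) BL = 0"
  by (rule nthz_eqI, rule mps_eqI)
     (auto simp: nthz_lder derivation_dXY mps_map.rep_eq mps_coeff_nthz mps_coeff_BL Pfls_nth
        dXY_Splus[OF k] zero_mps.rep_eq derivation_0[OF derivation_dXY])

lemma lder_dXY_GamL: "k \<ge> 1 \<Longrightarrow> lder (dXY k) GamL = 0"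
  by (simp add: derivation_GamL derivation_lder derivation_dXY lder_dXY_BL)

text \<open>The name hides a sign: this is minus the logarithm of \<open>ftau\<close>. The value 1/0
  = 0 makes the constant coefficient vanish.\<close>

definition logf :: wser where
  "logf = Abs_mps (\<lambda>M. (1 / real (size M)) *\<^sub>R mps_coeff (nthz 0 (YL * BL ^ size M)) M)"

lemma logf_empty [simp]: "mps_coeff logf {#} = 0"
  by (simp add: logf_def Abs_mps_inverse)

lemma euler_logf: "euler logf = nthz 0 (YL * (GamL - 1))"
proof (rule mps_eqI)
  fix M
  show "mps_coeff (euler logf) M = mps_coeff (nthz 0 (YL * (GamL - 1))) M"
  proof (cases "M = {#}")
    case False
    then have "mps_coeff (YL * (GamL - 1)) M = mps_coeff (YL * BL ^ size M) M"
      by (simp add: YL_def mps_coeff_const_times mps_coeff_BL_GamL flip: BL_GamL)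
    moreover have "mps_coeff (euler logf) M = (real (size M) * (1 / real (size M))) *\<^sub>R
         mps_coeff (nthz 0 (YL * BL ^ size M)) M"
      by (simp only: mps_grade.rep_eq logf_def Abs_mps_inverse UNIV_I of_nat_times_scaleR)
    ultimately show ?thesis using False by (simp add: mps_coeff_nthz)
  qed (simp add: mps_grade.rep_eq mps_coeff_nthz mps_coeff_times_empty minus_mps.rep_eq one_mps.rep_eq)
qed

lemma derivation_logf_aux:
  assumes d: "derivation d" "\<And>j. j \<ge> 1 \<Longrightarrow> d (xx j) = (if j = k then 1 else 0)" and k: "k \<ge> 1"
  shows "mps_map d (nthz 0 (YL * (GamL - 1))) =
    of_nat k * nthz (- int k) GamL + nthz 0 (YL * (GamL * GamL * lder d BL))"
proof -
  note D = derivation_lder[OF d(1)]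
  have *: "of_nat m = emb (of_nat m :: wser)" for m
    by (induction m) auto
  have "lder d (YL * (GamL - 1)) = YL * (GamL * GamL * lder d BL) + of_nat k * (zpow (int k) * (GamL - 1))"
    by (simp add: derivation_mult[OF D] derivation_diff[OF D] derivation_1[OF D] derivation_GamL[OF D]
        lder_YL[OF d k] mult_ac)
  then have "mps_map d (nthz 0 (YL * (GamL - 1))) = nthz 0 (YL * (GamL * GamL * lder d BL)) +
     of_nat k * nthz (- int k) (GamL - 1)"
    by (simp add: * flip: nthz_lder[OF d(1)])
  then show ?thesis using k by (simp add: nthz_one)
qed

text \<open>After \<open>euler\<close>, the explicit x_k contributes k times the z^-k coefficient of
  \<open>GamL\<close>, which is minus that of \<open>zder GamL\<close>. Since
  \<open>zder GamL = GamL * GamL * zder BL\<close> is the Euler derivative of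
  \<open>GamL * zder BL\<close>, \<open>euler\<close> can be undone.\<close>

lemma dX_logf:
  assumes k: "k \<ge> 1"
  shows "mps_map (dX k) logf = nthz 0 (YL * (GamL * lder (dX k) BL)) - nthz (- int k) (GamL * zder BL)"
proof (rule euler_inject)
  have *: "of_nat m = (of_int (int m) :: wser)" for m by simp
  have "euler (mps_map (dX k) logf) = mps_map (dX k) (nthz 0 (YL * (GamL - 1)))"
    by (simp only: euler_map[OF derivation_add[OF derivation_pderiv]] euler_logf)
  also have "\<dots> = nthz 0 (YL * (GamL * GamL * lder (dX k) BL)) - nthz (- int k) (zder GamL)"
    by (subst derivation_logf_aux[of _ k]) (use k in \<open>auto simp: derivation_pderiv pderiv_var\<close>)
  also have "\<dots> = euler (nthz 0 (YL * (GamL * lder (dX k) BL)) - nthz (- int k) (GamL * zder BL))"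
    by (simp add: derivation_diff[OF derivation_euler] nthz_euler derivation_mult[OF derivation_euler, of YL]
        euler_YL euler_GamL_times euler_lder euler_zder derivation_pderiv derivation_GamL[OF derivation_zder])
  finally show "euler (mps_map (dX k) logf) = \<dots>" .
  have "mps_coeff (lder (dX k) BL) {#} = 0" "mps_coeff (zder BL) {#} = 0"
    by (auto simp: lder_def zder_def mps_map.rep_eq derivation_0 derivation_fls_map derivation_fls_zder derivation_pderiv)
  then show "mps_coeff (mps_map (dX k) logf) {#} =
      mps_coeff (nthz 0 (YL * (GamL * lder (dX k) BL)) - nthz (- int k) (GamL * zder BL)) {#}"
    by (simp add: mps_map.rep_eq minus_mps.rep_eq mps_coeff_nthz mps_coeff_times_empty derivation_0[OF derivation_pderiv])
qed

lemma pderiv_logf: "mps_pderiv v logf = nthz 0 (YL * (GamL * PL v))"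
proof (rule euler_plus_inject)
  have "euler (mps_pderiv v logf) + mps_pderiv v logf = nthz 0 (YL * (GamL * GamL * PL v))"
    by (simp add: euler_pderiv euler_logf nthz_pderiv derivation_mult[OF derivation_pderiv]
        derivation_diff[OF derivation_pderiv] derivation_1[OF derivation_pderiv] pderiv_YL
        derivation_GamL[OF derivation_pderiv])
  \<comment> \<open>The factor \<open>(1 - BL) * GamL\<close> is a disguised 1; it turns this into
    an identity of polynomials in \<open>BL\<close>, \<open>GamL\<close> and
    \<open>PL v\<close>.\<close>
  also have "GamL * GamL * PL v = euler (GamL * PL v) + GamL * PL v * ((1 - BL) * GamL)"
    unfolding derivation_mult[OF derivation_euler] euler_GamL by (simp add: PL_def algebra_simps)
  also have "nthz 0 (YL * (euler (GamL * PL v) + GamL * PL v * ((1 - BL) * GamL)))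
     = euler (nthz 0 (YL * (GamL * PL v))) + nthz 0 (YL * (GamL * PL v))"
    unfolding GamL_inverse by (simp add: nthz_euler derivation_mult[OF derivation_euler, of YL] euler_YL algebra_simps)
  finally show "euler (mps_pderiv v logf) + mps_pderiv v logf = \<dots>" .
qed

lemma euler_dXY_logf:
  assumes k: "k \<ge> 1"
  shows "euler (mps_map (dXY k) logf) = of_nat k * nthz (- int k) GamL"
proof -
  have "euler (mps_map (dXY k) logf) = mps_map (dXY k) (nthz 0 (YL * (GamL - 1)))"
    by (simp only: euler_map[OF derivation_add[OF derivation_dXY]] euler_logf)
  also have "\<dots> = of_nat k * nthz (- int k) GamL"
    by (subst derivation_logf_aux[of _ k])
       (use k in \<open>auto simp: derivation_dXY dXY_def pderiv_var lder_dXY_BL\<close>)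
  finally show ?thesis .
qed

text \<open>Up to \<open>euler\<close>, the first derivatives are coefficients of
  \<open>GamL\<close>, which \<open>dXY\<close> annihilates. So \<open>logf\<close> is affine in
  these directions, and the exponential of the derivations acts on \<open>ftau\<close> by
  multiplication.\<close>

lemma dXY_dXY_logf:
  assumes "j \<ge> 1" "k \<ge> 1"
  shows "mps_map (dXY j) (mps_map (dXY k) logf) = 0"
proof (rule euler_inject)
  note D = mps_map_derivation[OF derivation_dXY]
  have "euler (mps_map (dXY j) (mps_map (dXY k) logf)) = mps_map (dXY j) (of_nat k * nthz (- int k) GamL)"
    by (subst euler_map[OF derivation_add[OF derivation_dXY]]) (simp only: euler_dXY_logf[OF assms(2)])
  also have "\<dots> = of_nat k * nthz (- int k) (lder (dXY j) GamL)"
    by (simp add: derivation_of_nat_times[OF D] nthz_lder derivation_dXY)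
  finally show "euler (mps_map (dXY j) (mps_map (dXY k) logf)) = euler 0"
    by (simp add: lder_dXY_GamL[OF assms(1)] derivation_0[OF derivation_euler])
qed (simp add: mps_map.rep_eq derivation_0[OF derivation_dXY] zero_mps.rep_eq)

definition ftau :: wser where "ftau = mps_exp (- logf)"

lemma ftau_empty: "mps_coeff ftau {#} = 1"
  unfolding ftau_def by (rule mps_exp_empty) (simp add: uminus_mps.rep_eq)

lemma map_ftau:
  assumes "derivation d" "\<And>r a. d (r *\<^sub>R a) = r *\<^sub>R d a"
  shows "mps_map d ftau = - (ftau * mps_map d logf)"
proof -
  have "mps_map d ftau = ftau * mps_map d (- logf)"
    unfolding ftau_def
    by (rule derivation_mps_exp[OF mps_map_derivation[OF assms(1)]])
       (auto intro!: mps_eqI[of "mps_map _ _"] simp: mps_map.rep_eq scaleR_mps.rep_eq assms(2) uminus_mps.rep_eq)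
  then show ?thesis by (simp add: derivation_uminus[OF mps_map_derivation[OF assms(1)]])
qed

lemma euler_ftau: "euler ftau = - (ftau * euler logf)"
proof -
  have "euler ftau = ftau * euler (- logf)"
    unfolding ftau_def
    by (rule derivation_mps_exp[OF derivation_euler])
       (auto simp: grade_scaleR mps_grade.rep_eq uminus_mps.rep_eq)
  then show ?thesis by (simp add: derivation_uminus[OF derivation_euler])
qed

lemma pderiv_ftau: "mps_pderiv v ftau = - (ftau * mps_pderiv v logf)"
proof -
  have "mps_pderiv v ftau = ftau * mps_pderiv v (- logf)"
    unfolding ftau_def
    by (rule derivation_mps_exp[OF derivation_pderiv])
       (auto simp: pderiv_scaleR mps_pderiv.rep_eq uminus_mps.rep_eq)
  then show ?thesis by (simp add: derivation_uminus[OF derivation_pderiv])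
qed

end

lemma mps_lim_cong:
  assumes "mps_lim F f" "eventually (\<lambda>K. G K = F K) sequentially"
  shows "mps_lim G f"
  unfolding mps_lim_def
proof
  fix M
  have "eventually (\<lambda>K. mps_coeff (F K) M = mps_coeff f M) sequentially"
    using assms(1) by (simp add: mps_lim_def)
  with assms(2) show "eventually (\<lambda>K. mps_coeff (G K) M = mps_coeff f M) sequentially"
    by eventually_elim simp
qed

lemma negz_emb_times: "negz (emb a * A) = emb a * negz A"
  by (rule nthz_eqI) simp

lemma negz_sum: "negz (\<Sum>i\<in>I. A i) = (\<Sum>i\<in>I. negz (A i))"
  by (rule nthz_eqI) (auto simp: nthz_sum)

lemma of_nat_emb: "of_nat n = emb (of_nat n)"
  by (induction n) auto

context
  fixes \<iota> :: "wvar \<Rightarrow> nat"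
begin

private abbreviation B where "B \<equiv> BL \<iota>"
private abbreviation \<Gamma> where "\<Gamma> \<equiv> GamL \<iota>"
private abbreviation N0 where "N0 \<equiv> \<iota> W1 + \<iota> W2 + 1"

lemma zge_B: "zge (- int N0) B"
  using zge_BL[of \<iota>] by (rule zge_mono) simp

lemma nthz_0_GamL: "nthz 0 \<Gamma> = 1"
proof -
  have "zle (- 1 + 0) (B * \<Gamma>)" by (rule zle_times[OF zle_BL zle_GamL])
  then have "nthz 0 (\<Gamma> - 1) = 0" unfolding BL_GamL[symmetric] by (simp add: zle_def)
  then show ?thesis by (simp add: nthz_one)
qed

subsection \<open>The shift of the arguments\<close>

text \<open>The factor by which \<open>deriv_z\<close> multiplies \<open>ftau\<close>. It turns out
  to be log(1 - B).\<close>

definition Lg :: "wser fps" where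
  "Lg = Abs_fps (\<lambda>i. if i = 0 then 0 else - ((1 / real i) *\<^sub>R mps_map (dXY i) (logf \<iota>)))"

lemma Lg_0 [simp]: "fps_nth Lg 0 = 0"
  by (simp add: Lg_def)

lemma Lg_empty: "mps_coeff (fps_nth Lg n) {#} = 0"
  by (simp add: Lg_def mps_coeff_simps derivation_0[OF derivation_dXY])

lemma euler_Lg: "fps_map euler Lg = 1 - zinv_fps \<Gamma>"
proof (rule fps_ext)
  fix n
  have "euler (fps_nth Lg n) = - ((1 / real n) *\<^sub>R (of_nat n * nthz (- int n) \<Gamma>))" if "n \<noteq> 0"
    using that by (simp add: Lg_def derivation_uminus[OF derivation_euler] grade_scaleR euler_dXY_logf)
  moreover have "(1 / real n) *\<^sub>R (of_nat n * nthz (- int n) \<Gamma>) = nthz (- int n) \<Gamma>" if "n \<noteq> 0"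
    using that by (metis nonzero_divide_eq_eq of_nat_eq_0_iff of_real_of_nat_eq scaleR_conv_of_real scaleR_one scaleR_scaleR)
  ultimately show "fps_nth (fps_map euler Lg) n = fps_nth (1 - zinv_fps \<Gamma>) n"
    by (cases "n = 0") (auto simp: nthz_0_GamL derivation_0[OF derivation_euler])
qed

lemma zle_1_B: "zle 0 (1 - B)"
  using zle_mono[OF zle_BL, of 0] by (intro zle_diff) (auto simp: zle_0_1)

text \<open>No logarithm is formed: \<open>euler\<close> sends \<open>Lg\<close> to 1 - \<Gamma>, so
  \<open>fexp Lg\<close> and \<Gamma>, and likewise \<open>fexp (- Lg)\<close> and 1 - B, have
  opposite logarithmic Euler derivatives.\<close>

lemma fexp_Lg: "fexp Lg = zinv_fps (1 - B)" and fexp_minus_Lg: "fexp (- Lg) = zinv_fps \<Gamma>"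
proof -
  define Gh where "Gh = zinv_fps \<Gamma>"
  define Bh where "Bh = zinv_fps (1 - B)"
  note D = derivation_fps_map[OF derivation_euler]
  have BG: "Bh * Gh = 1"
    unfolding Bh_def Gh_def by (simp add: zle_1_B zle_GamL GamL_inverse zinv_fps_1 flip: zinv_fps_times)
  have DG: "fps_map euler Gh = Gh * (Gh - 1)"
  proof -
    have "fps_map euler Gh = zinv_fps (euler \<Gamma>)"
      by (rule fps_ext) (simp add: Gh_def nthz_euler)
    also have "euler \<Gamma> = \<Gamma> * (\<Gamma> - 1)"
      by (simp add: euler_GamL mult_ac flip: BL_GamL)
    also have "zinv_fps \<dots> = Gh * zinv_fps (\<Gamma> - 1)"
      unfolding Gh_def by (rule zinv_fps_times) (auto intro: zle_GamL zle_diff zle_0_1)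
    also have "zinv_fps (\<Gamma> - 1) = Gh - 1"
      by (rule fps_ext) (simp add: Gh_def nthz_one)
    finally show ?thesis .
  qed
  have DB: "fps_map euler Bh = Bh - 1"
    by (rule fps_ext) (simp add: Bh_def nthz_euler derivation_diff[OF derivation_euler] derivation_1[OF derivation_euler] nthz_one
        derivation_0[OF derivation_euler])
  have DL: "fps_map euler (fexp Lg) = fexp Lg * (1 - Gh)"
    using derivation_fexp[OF derivation_euler grade_scaleR Lg_0] by (simp add: euler_Lg Gh_def)
  have DL': "fps_map euler (fexp (- Lg)) = fexp (- Lg) * (Gh - 1)"
    using derivation_fexp[OF derivation_euler grade_scaleR, of "- Lg"]
    by (simp add: derivation_uminus[OF D] euler_Lg Gh_def)
  have c: "mps_coeff (fps_nth (fexp Lg) n) {#} = (if n = 0 then 1 else 0)"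
     "mps_coeff (fps_nth (fexp (- Lg)) n) {#} = (if n = 0 then 1 else 0)" for n
    using fexp_empty[of Lg n] fexp_empty[of "- Lg" n] by (simp_all add: Lg_empty uminus_mps.rep_eq)
  have *: "fexp Lg * Gh = 1"
  proof (rule fps_eq_1_if_euler_0)
    show "fps_map euler (fexp Lg * Gh) = 0"
      unfolding derivation_mult[OF D] DL DG by (simp add: algebra_simps)
  qed (simp add: mps_coeff_empty_fps_times[OF c(1)] Gh_def mps_coeff_nthz)
  have **: "fexp (- Lg) * Bh = 1"
  proof (rule fps_eq_1_if_euler_0)
    have "fps_map euler (fexp (- Lg) * Bh) = fexp (- Lg) * (Bh - 1) + fexp (- Lg) * (Bh * Gh) - fexp (- Lg) * Bh"
      unfolding derivation_mult[OF D] DL' DB by (simp add: algebra_simps)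
    then show "fps_map euler (fexp (- Lg) * Bh) = 0" by (simp add: BG algebra_simps)
  qed (simp add: mps_coeff_empty_fps_times[OF c(2)] Bh_def mps_coeff_nthz minus_mps.rep_eq one_mps.rep_eq)
  have "fexp Lg = fexp Lg * (Bh * Gh)" by (simp add: BG)
  also have "\<dots> = Bh" using * by (simp add: mult_ac)
  finally show "fexp Lg = zinv_fps (1 - B)" by (simp add: Bh_def)
  have "fexp (- Lg) = fexp (- Lg) * (Bh * Gh)" by (simp add: BG)
  also have "\<dots> = Gh" using ** by (simp add: mult.assoc[symmetric])
  finally show "fexp (- Lg) = zinv_fps \<Gamma>" by (simp add: Gh_def)
qed

lemma map_dXY_Lg: "i \<ge> 1 \<Longrightarrow> mps_map (dXY i) (fps_nth Lg j) = 0"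
proof -
  assume i: "i \<ge> 1"
  have "mps_map (dXY i) (- (r *\<^sub>R F)) = - (r *\<^sub>R mps_map (dXY i) F)" for r and F :: wser
    by (rule mps_eqI) (simp add: mps_coeff_simps dXY_scaleR derivation_uminus[OF derivation_dXY])
  then show ?thesis
    using i by (simp add: Lg_def dXY_dXY_logf derivation_0[OF mps_map_derivation[OF derivation_dXY]])
qed

lemma map_dXY_Lg_power: "i \<ge> 1 \<Longrightarrow> mps_map (dXY i) (fps_nth (Lg ^ n) j) = 0"
proof (induction n arbitrary: j)
  case (Suc n)
  note D = mps_map_derivation[OF derivation_dXY[of i]]
  show ?case using Suc
    by (simp add: fps_mult_nth derivation_sum[OF D] derivation_mult[OF D] map_dXY_Lg)
qed (auto simp: derivation_0[OF mps_map_derivation[OF derivation_dXY]] derivation_1[OF mps_map_derivation[OF derivation_dXY]])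

text \<open>Every \<open>dXY i\<close> annihilates \<open>Lg\<close>, so each application of
  \<open>deriv_z\<close> just multiplies by one more \<open>Lg\<close>. The claim is made at one
  monomial \<open>M\<close> because \<open>exp_deriv_z\<close> acts on series in x and y.\<close>

lemma exp_deriv_z_eq:
  assumes F: "\<And>i. i \<ge> 1 \<Longrightarrow> mps_map (dXY i) F = - (F * mps_map (dXY i) (logf \<iota>))"
  shows "fps_nth (exp_deriv_z \<sigma> (mps_coeff F M)) n =
    mps_coeff (F * (\<Sum>j\<le>n. (\<sigma> ^ j / fact j) *\<^sub>R fps_nth (Lg ^ j) n)) M"
proof -
  have *: "fps_nth ((deriv_z ^^ j) (fps_const (mps_coeff F M))) m = mps_coeff (F * fps_nth (Lg ^ j) m) M" for j m
  proof (induction j arbitrary: m)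
    case (Suc j)
    have "fps_nth ((deriv_z ^^ Suc j) (fps_const (mps_coeff F M))) m =
      (\<Sum>i=1..m. (1 / real i) *\<^sub>R dXY i (mps_coeff (F * fps_nth (Lg ^ j) (m - i)) M))"
      by (simp add: deriv_z_def Suc dXY_def)
    also have "\<dots> = (\<Sum>i=1..m. mps_coeff (F * (fps_nth Lg i * fps_nth (Lg ^ j) (m - i))) M)"
    proof (rule sum.cong)
      fix i assume i: "i \<in> {1..m}"
      note D = mps_map_derivation[OF derivation_dXY[of i]]
      have "mps_map (dXY i) (F * fps_nth (Lg ^ j) (m - i)) = - (F * mps_map (dXY i) (logf \<iota>)) * fps_nth (Lg ^ j) (m - i)"
        using i by (simp add: derivation_mult[OF D] F map_dXY_Lg_power)
      then have "(1 / real i) *\<^sub>R mps_map (dXY i) (F * fps_nth (Lg ^ j) (m - i)) = F * (fps_nth Lg i * fps_nth (Lg ^ j) (m - i))"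
        using i by (simp add: Lg_def algebra_simps)
      then show "(1 / real i) *\<^sub>R dXY i (mps_coeff (F * fps_nth (Lg ^ j) (m - i)) M) =
         mps_coeff (F * (fps_nth Lg i * fps_nth (Lg ^ j) (m - i))) M"
        by (metis mps_map.rep_eq scaleR_mps.rep_eq)
    qed simp
    also have "\<dots> = mps_coeff (F * fps_nth (Lg ^ Suc j) m) M"
      by (simp add: fps_mult_nth sum_distrib_left mps_coeff_sum sum.atLeast_Suc_atMost[of 0])
    finally show ?case .
  qed (cases "m = 0"; simp add: zero_mps.rep_eq)
  show ?thesis
    by (simp add: exp_deriv_z_def * sum_distrib_left mps_coeff_sum scaleR_mps.rep_eq)
qed

lemma exp_deriv_z_1:
  assumes "\<And>i. i \<ge> 1 \<Longrightarrow> mps_map (dXY i) F = - (F * mps_map (dXY i) (logf \<iota>))"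
  shows "fps_nth (exp_deriv_z 1 (mps_coeff F M)) n = mps_coeff (nthz (- int n) (emb F * (1 - B))) M"
proof -
  have "(\<Sum>j\<le>n. (1 ^ j / fact j) *\<^sub>R fps_nth (Lg ^ j) n) = fps_nth (zinv_fps (1 - B)) n"
    unfolding fexp_Lg[symmetric] by (simp add: fexp_def)
  then show ?thesis by (simp add: exp_deriv_z_eq[OF assms] del: nthz_simps)
qed

lemma exp_deriv_z_minus_1:
  assumes "\<And>i. i \<ge> 1 \<Longrightarrow> mps_map (dXY i) F = - (F * mps_map (dXY i) (logf \<iota>))"
  shows "fps_nth (exp_deriv_z (- 1) (mps_coeff F M)) n = mps_coeff (nthz (- int n) (emb F * \<Gamma>)) M"
proof -
  have "(- 1 :: wser fps) ^ j = fps_const ((- 1) ^ j)" for j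
    by (cases "even j") auto
  then have "(- Lg) ^ j = fps_const ((- 1) ^ j) * Lg ^ j" for j
    by (metis power_minus)
  moreover have "r *\<^sub>R ((- 1) ^ j * a) = (r * (- 1) ^ j) *\<^sub>R a" for r j and a :: wser
    by (cases "even j") auto
  ultimately have "(\<Sum>j\<le>n. ((- 1) ^ j / fact j) *\<^sub>R fps_nth (Lg ^ j) n) = fps_nth (zinv_fps \<Gamma>) n"
    unfolding fexp_minus_Lg[symmetric] by (simp add: fexp_def)
  then show ?thesis by (simp add: exp_deriv_z_eq[OF assms])
qed

subsection \<open>The derivation attached to a mode of the current\<close>

definition UL :: "wvar \<Rightarrow> wlser" where "UL v = WL \<iota> v * \<Gamma>"

definition Upos :: "wvar \<Rightarrow> wlser" where "Upos v = UL v - negz (UL v)"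

definition Utrunc :: "wvar \<Rightarrow> nat \<Rightarrow> wlser" where
  "Utrunc v K = (\<Sum>k\<le>K. emb (nthz (int k) (UL v)) * zpow (int k))"

text \<open>
  \<open>\<partial>/\<partial>x\<^sub>k\<close> is weighted with the coefficient of \<open>z\<^sup>k\<close> in \<open>UL v\<close>, and \<open>p \<partial>/\<partial>p\<close>, acting as \<open>euler\<close>,
  takes the place of \<open>k = 0\<close>. The sum over all \<open>k\<close> only exists coefficientwise on suitable
  arguments; cut off at \<open>K\<close> it is a derivation.
\<close>

definition theta :: "wvar \<Rightarrow> nat \<Rightarrow> wser \<Rightarrow> wser" where
  "theta v K F = nthz 0 (UL v) * euler F + (\<Sum>k=1..K. nthz (int k) (UL v) * mps_map (dX k) F)"

definition thetaL :: "wvar \<Rightarrow> nat \<Rightarrow> wlser \<Rightarrow> wlser" where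
  "thetaL v K A = emb (nthz 0 (UL v)) * euler A + (\<Sum>k=1..K. emb (nthz (int k) (UL v)) * lder (dX k) A)"

text \<open>The multiplicative part of the action of the current: the first term comes from
  multiplication by the x_k, the second from the derivatives, \<open>euler\<close> included, that
  hit \<Gamma>.\<close>

definition rho :: "wvar \<Rightarrow> wser" where
  "rho v = nthz 0 (YL * UL v) - nthz 0 (UL v * (\<Gamma> * zder B))"

lemma derivation_theta: "derivation (theta v K)"
proof -
  have "derivation (\<lambda>F. \<Sum>k\<in>{0..K}. nthz (int k) (UL v) * (if k = 0 then euler else mps_map (dX k)) F)"
    by (rule derivation_scale_sum) (auto intro: derivation_euler mps_map_derivation derivation_pderiv)
  also have "(\<lambda>F. \<Sum>k\<in>{0..K}. nthz (int k) (UL v) * (if k = 0 then euler else mps_map (dX k)) F) = theta v K"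
    by (rule ext) (simp add: theta_def sum.atLeast_Suc_atMost[of 0])
  finally show ?thesis .
qed

lemma derivation_thetaL: "derivation (thetaL v K)"
proof -
  have "derivation (\<lambda>F. \<Sum>k\<in>{0..K}. emb (nthz (int k) (UL v)) * (if k = 0 then euler else lder (dX k)) F)"
    by (rule derivation_scale_sum) (auto intro: derivation_euler derivation_lder derivation_pderiv)
  also have "(\<lambda>F. \<Sum>k\<in>{0..K}. emb (nthz (int k) (UL v)) * (if k = 0 then euler else lder (dX k)) F) = thetaL v K"
    by (rule ext) (simp add: thetaL_def sum.atLeast_Suc_atMost[of 0])
  finally show ?thesis .
qed

lemma nthz_thetaL: "nthz n (thetaL v K A) = theta v K (nthz n A)"
  by (simp add: thetaL_def theta_def nthz_sum nthz_lder derivation_pderiv nthz_euler)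

lemma nthz_Upos [simp]: "nthz n (Upos v) = (if n \<ge> 0 then nthz n (UL v) else 0)"
  by (simp add: Upos_def)

lemma nthz_Utrunc: "nthz n (Utrunc v K) = (if 0 \<le> n \<and> n \<le> int K then nthz n (UL v) else 0)"
proof -
  have "nthz n (Utrunc v K) = (\<Sum>k\<le>K. if n = int k then nthz n (UL v) else 0)"
    unfolding Utrunc_def nthz_sum by (rule sum.cong) (auto simp: nthz_zpow)
  also have "\<dots> = (if 0 \<le> n \<and> n \<le> int K then nthz n (UL v) else 0)"
    by (cases n) auto
  finally show ?thesis .
qed

lemma zge_Upos: "zge 0 (Upos v)"
  by (simp add: zge_def)

lemma zge_rest: "zge (int K) (Upos v - Utrunc v K)"
  by (simp add: zge_def nthz_Utrunc)

lemma lder_dX_B_0: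
  assumes "k \<ge> N0"
  shows "lder (dX k) B = 0"
proof -
  have "zge (int k + - int N0) (zpow (int k) * B)" by (rule zge_times[OF zge_zpow zge_B])
  then have "zge 0 (zpow (int k) * B)" by (rule zge_mono) (use assms in simp)
  then show ?thesis using assms by (simp add: lder_dX_BL negz_zge)
qed

text \<open>Each mode sends B to the negative part of z^k B, \<open>euler\<close> being the mode k =
  0. From \<open>N0\<close> on the cut-off is exact, as the omitted modes leave no negative power of
  z.\<close>

lemma thetaL_B:
  assumes "K \<ge> N0"
  shows "thetaL v K B = negz (Upos v * B)"
proof -
  have "thetaL v K B = (\<Sum>k\<le>K. emb (nthz (int k) (UL v)) * negz (zpow (int k) * B))"
    unfolding thetaL_def atMost_atLeast0
    by (subst sum.atLeast_Suc_atMost[of 0]) (auto simp: lder_dX_BL negz_zle[OF zle_BL])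
  also have "\<dots> = negz (Utrunc v K * B)"
    by (simp add: Utrunc_def sum_distrib_right negz_sum mult.assoc negz_emb_times)
  also have "\<dots> = negz (Upos v * B) - negz ((Upos v - Utrunc v K) * B)"
    by (simp add: algebra_simps flip: negz_simps)
  also have "negz ((Upos v - Utrunc v K) * B) = 0"
  proof (rule negz_zge, rule zge_mono)
    show "zge (int K + - int N0) ((Upos v - Utrunc v K) * B)"
      by (rule zge_times[OF zge_rest zge_B])
  qed (use assms in simp)
  finally show ?thesis by simp
qed

lemma UL_inverse: "UL v * (1 - B) = WL \<iota> v"
  by (simp add: UL_def mult.assoc mult.commute[of \<Gamma>] GamL_inverse)

text \<open>Insert U = Upos + negz U into W = U (1 - B) and take negative parts: the product of negz
  U with 1 - B has only negative powers, and Upos has none.\<close>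

lemma PL_eq: "PL \<iota> v = negz (UL v) * (1 - B) - negz (Upos v * B)"
proof -
  have "zle (- 1 + - 1) (negz (UL v) * B)" by (rule zle_times[OF zle_negz zle_BL])
  then have "negz (negz (UL v) * B) = negz (UL v) * B" by (intro negz_zle) (erule zle_mono, simp)
  moreover have "negz (negz (UL v)) = negz (UL v)" by (rule nthz_eqI) simp
  moreover have "WL \<iota> v = UL v - Upos v * B - negz (UL v) * B"
    unfolding UL_inverse[symmetric] Upos_def by (simp add: algebra_simps)
  ultimately have "PL \<iota> v = negz (UL v) - negz (Upos v * B) - negz (UL v) * B"
    by (simp only: PL_negz negz_simps)
  then show ?thesis by (simp add: algebra_simps)
qed

text \<open>The z^(i-1) coefficient is the one that \<open>phi (- i)\<close> extracts; 1 - B is the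
  contribution of \<open>shift_op 1\<close>.\<close>

definition Gser :: "nat \<Rightarrow> wser" where
  "Gser i = nthz (int i - 1) (EminusL * (1 - B))"

lemma thetaL_EminusL: "thetaL v K EminusL = - ((Utrunc v K - emb (nthz 0 (UL v))) * EminusL)"
proof -
  have "Utrunc v K = emb (nthz 0 (UL v)) + (\<Sum>k=1..K. emb (nthz (int k) (UL v)) * zpow (int k))"
    unfolding Utrunc_def atMost_atLeast0 by (subst sum.atLeast_Suc_atMost[of 0]) auto
  moreover have "euler EminusL = 0" by (simp add: EminusL_def)
  ultimately show ?thesis
    by (simp add: thetaL_def lder_dX_EminusL sum_distrib_right mult.assoc sum_negf)
qed

lemma theta_Gser:
  assumes "K \<ge> N0" "i \<ge> 1"
  shows "theta v K (Gser i) = nthz 0 (UL v) * Gser i - mps_pderiv v (Gser i)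
     + nthz (int i - 1) ((Upos v - Utrunc v K) * (EminusL * (1 - B)))"
proof -
  note D = derivation_thetaL[of v K]
  define e0 where "e0 = nthz 0 (UL v)"
  have "thetaL v K (EminusL * (1 - B)) =
     EminusL * - negz (Upos v * B) - (Utrunc v K - emb e0) * (EminusL * (1 - B))"
    by (simp add: derivation_mult[OF D] derivation_diff[OF D] derivation_1[OF D] thetaL_B[OF assms(1)]
        thetaL_EminusL e0_def algebra_simps)
  also have "\<dots> = emb e0 * (EminusL * (1 - B)) + EminusL * PL \<iota> v
     + (Upos v - Utrunc v K) * (EminusL * (1 - B)) - EminusL * (UL v * (1 - B))"
    unfolding PL_eq Upos_def by (simp add: algebra_simps)
  \<comment> \<open>The exponentials cancel and leave a single negative power of z, invisible at
    z^(i-1) because i \<ge> 1.\<close>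
  also have "EminusL * (UL v * (1 - B)) = zpow (- int (\<iota> v) - 1)"
    unfolding UL_inverse WL_def by (metis EplusL_EminusL mult.commute mult.left_commute mult_1)
  finally have 1: "theta v K (Gser i) = e0 * Gser i + nthz (int i - 1) (EminusL * PL \<iota> v)
     + nthz (int i - 1) ((Upos v - Utrunc v K) * (EminusL * (1 - B)))"
    using assms(2) by (simp only: Gser_def nthz_thetaL[symmetric]) (simp add: nthz_zpow)
  have "mps_pderiv v (Gser i) = - nthz (int i - 1) (EminusL * PL \<iota> v)"
    by (simp add: Gser_def nthz_pderiv derivation_mult[OF derivation_pderiv] derivation_diff[OF derivation_pderiv]
        derivation_1[OF derivation_pderiv]) (simp add: EminusL_def)
  then show ?thesis by (simp add: 1 e0_def)
qed

lemma zle_zder_B: "zle (- 1) (\<Gamma> * zder B)"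
proof -
  have "zle (- 1) (zder B)" using zle_BL[of \<iota>] by (simp add: zle_def)
  then show ?thesis using zle_times[OF zle_GamL] by fastforce
qed

text \<open>The first term of \<open>dX_logf\<close> sums to the action of theta on B, and \<Gamma>
  times that is U - Upos - \<Gamma> P, where Upos pairs to 0 with \<open>YL\<close>. The second
  pairs U with \<Gamma> zder B, which has only negative powers and therefore sees only Upos.\<close>

lemma theta_logf:
  assumes "K \<ge> N0"
  shows "theta v K (logf \<iota>) = rho v - mps_pderiv v (logf \<iota>)
    + nthz 0 ((Upos v - Utrunc v K) * (\<Gamma> * zder B))"
proof -
  define Q where "Q = \<Gamma> * zder B"
  have e: "euler (logf \<iota>) = nthz 0 (YL * (\<Gamma> * euler B))"
    by (simp add: euler_logf mult.commute flip: BL_GamL)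
  have Q0: "nthz 0 Q = 0" using zle_zder_B by (simp add: zle_def Q_def)
  have "theta v K (logf \<iota>) = nthz 0 (UL v) * nthz 0 (YL * (\<Gamma> * euler B)) +
      (\<Sum>k=1..K. nthz (int k) (UL v) * nthz 0 (YL * (\<Gamma> * lder (dX k) B)))
      - (\<Sum>k=1..K. nthz (int k) (UL v) * nthz (- int k) Q)"
    by (simp add: theta_def e dX_logf Q_def right_diff_distrib sum_subtractf)
  also have "nthz 0 (UL v) * nthz 0 (YL * (\<Gamma> * euler B)) +
      (\<Sum>k=1..K. nthz (int k) (UL v) * nthz 0 (YL * (\<Gamma> * lder (dX k) B)))
      = nthz 0 (YL * (\<Gamma> * thetaL v K B))"
  proof -
    have "YL * (\<Gamma> * thetaL v K B) = emb (nthz 0 (UL v)) * (YL * (\<Gamma> * euler B)) +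
        (\<Sum>k=1..K. emb (nthz (int k) (UL v)) * (YL * (\<Gamma> * lder (dX k) B)))"
      by (simp add: thetaL_def algebra_simps sum_distrib_left)
    then show ?thesis by (simp add: nthz_sum)
  qed
  \<comment> \<open>The missing term k = 0 may be added, since \<open>Q\<close> has no constant term
    in z.\<close>
  also have "(\<Sum>k=1..K. nthz (int k) (UL v) * nthz (- int k) Q) = nthz 0 (Utrunc v K * Q)"
    unfolding Utrunc_def sum_distrib_right nthz_sum atMost_atLeast0
    by (subst sum.atLeast_Suc_atMost[of 0]) (auto simp: Q0 mult.assoc)
  also have "nthz 0 (YL * (\<Gamma> * thetaL v K B)) = nthz 0 (YL * UL v) - nthz 0 (YL * (\<Gamma> * PL \<iota> v))"
  proof -
    have "\<Gamma> * thetaL v K B = negz (UL v) * ((1 - B) * \<Gamma>) - \<Gamma> * PL \<iota> v"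
      unfolding thetaL_B[OF assms] PL_eq by (simp add: algebra_simps)
    then have "YL * (\<Gamma> * thetaL v K B) = YL * (UL v - Upos v - \<Gamma> * PL \<iota> v)"
      unfolding GamL_inverse Upos_def by simp
    also have "\<dots> = YL * UL v - YL * Upos v - YL * (\<Gamma> * PL \<iota> v)"
      by (simp add: algebra_simps)
    finally have "YL * (\<Gamma> * thetaL v K B) = \<dots>" .
    moreover have "nthz 0 (YL * Upos v) = 0"
      using zge_times[OF zge_1_YL zge_Upos] by (simp add: zge_def)
    ultimately show ?thesis by simp
  qed
  also have "nthz 0 (Utrunc v K * Q) = nthz 0 (UL v * Q) - nthz 0 ((Upos v - Utrunc v K) * Q)"
  proof -
    have "Utrunc v K * Q = UL v * Q - negz (UL v) * Q - (Upos v - Utrunc v K) * Q"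
      unfolding Upos_def by (simp add: algebra_simps)
    moreover have "nthz 0 (negz (UL v) * Q) = 0"
      using zle_times[OF zle_negz zle_zder_B] by (simp add: zle_def Q_def)
    ultimately show ?thesis by simp
  qed
  finally show ?thesis by (simp add: rho_def pderiv_logf Q_def)
qed

subsection \<open>Admissible series\<close>

text \<open>
  The properties shared by the tau function (\<open>r = 0\<close>, \<open>c = 1\<close>) and the series \<open>Gser i\<close>
  (\<open>r = 1\<close>, \<open>c = 0\<close>) that determine the action of the vertex operators; all three say how a
  derivation acts, so they are inherited by products.
\<close>

definition adm :: "nat \<Rightarrow> nat \<Rightarrow> wser \<Rightarrow> bool" where
  "adm r c F \<longleftrightarrow>
    (\<forall>i\<ge>1. mps_map (dXY i) F = - (of_nat c * (F * mps_map (dXY i) (logf \<iota>)))) \<and>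
    mps_lim (\<lambda>k. mps_map (dX k) F) 0 \<and>
    (\<forall>v. mps_lim (\<lambda>K. theta v K F)
       (of_nat r * (nthz 0 (UL v) * F) - mps_pderiv v F - of_nat c * (F * rho v)))"

lemma adm_times:
  assumes "adm r c F" "adm s d G"
  shows "adm (r + s) (c + d) (F * G)"
  unfolding adm_def
proof (intro conjI allI impI)
  fix i :: nat assume i: "i \<ge> 1"
  note D = mps_map_derivation[OF derivation_dXY[of i]]
  show "mps_map (dXY i) (F * G) = - (of_nat (c + d) * (F * G * mps_map (dXY i) (logf \<iota>)))"
    using assms i by (simp add: adm_def derivation_mult[OF D] algebra_simps)
next
  have "mps_lim (\<lambda>k. F * mps_map (dX k) G + mps_map (dX k) F * G) (F * 0 + 0 * G)"
    using assms by (intro mps_lim_add mps_lim_times mps_lim_const) (auto simp: adm_def)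
  then show "mps_lim (\<lambda>k. mps_map (dX k) (F * G)) 0"
    by (simp add: derivation_mult[OF mps_map_derivation[OF derivation_pderiv]])
next
  fix v
  have "mps_lim (\<lambda>K. F * theta v K G + theta v K F * G)
     (F * (of_nat s * (nthz 0 (UL v) * G) - mps_pderiv v G - of_nat d * (G * rho v)) +
      (of_nat r * (nthz 0 (UL v) * F) - mps_pderiv v F - of_nat c * (F * rho v)) * G)"
    using assms by (intro mps_lim_add mps_lim_times mps_lim_const) (auto simp: adm_def)
  then show "mps_lim (\<lambda>K. theta v K (F * G))
       (of_nat (r + s) * (nthz 0 (UL v) * (F * G)) - mps_pderiv v (F * G) - of_nat (c + d) * (F * G * rho v))"
    by (simp add: derivation_mult[OF derivation_theta] derivation_mult[OF derivation_pderiv] algebra_simps)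
qed

lemma adm_1: "adm 0 0 1"
  unfolding adm_def
  by (simp add: derivation_1[OF mps_map_derivation[OF derivation_dXY]]
      derivation_1[OF mps_map_derivation[OF derivation_pderiv]] derivation_1[OF derivation_theta]
      derivation_1[OF derivation_pderiv] mps_lim_const)

lemma adm_power: "adm r 0 F \<Longrightarrow> adm (n * r) 0 (F ^ n)"
  by (induction n) (auto simp: adm_1 dest: adm_times)

lemma adm_ftau: "adm 0 1 (ftau \<iota>)"
  unfolding adm_def
proof (intro conjI allI impI)
  fix i :: nat assume "i \<ge> 1"
  show "mps_map (dXY i) (ftau \<iota>) = - (of_nat 1 * (ftau \<iota> * mps_map (dXY i) (logf \<iota>)))"
    by (simp add: map_ftau derivation_dXY dXY_scaleR)
next
  have dX: "mps_map (dX k) (ftau \<iota>) = - (ftau \<iota> * mps_map (dX k) (logf \<iota>))" for k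
    by (simp add: map_ftau derivation_pderiv pderiv_scaleR)
  \<comment> \<open>From \<open>N0\<close> on this is the only part of \<open>dX_logf\<close> that
    is left.\<close>
  have *: "mps_lim (\<lambda>k. nthz 0 (zpow (int k) * (\<Gamma> * zder B))) 0"
    by (rule mps_lim_nthz_zge) (rule zge_zpow)
  have "mps_lim (\<lambda>k. - (ftau \<iota> * - nthz 0 (zpow (int k) * (\<Gamma> * zder B)))) (- (ftau \<iota> * - 0))"
    by (intro mps_lim_uminus mps_lim_times mps_lim_const *)
  then have "mps_lim (\<lambda>k. - (ftau \<iota> * - nthz 0 (zpow (int k) * (\<Gamma> * zder B)))) 0" by simp
  then show "mps_lim (\<lambda>k. mps_map (dX k) (ftau \<iota>)) 0"
    by (rule mps_lim_cong)
       (auto simp: eventually_sequentially dX dX_logf lder_dX_B_0 intro!: exI[of _ N0])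
next
  fix v
  have *: "theta v K (ftau \<iota>) = - (ftau \<iota> * theta v K (logf \<iota>))" for K
    by (simp add: theta_def euler_ftau map_ftau derivation_pderiv pderiv_scaleR algebra_simps sum_negf sum_distrib_left)
  have "mps_lim (\<lambda>K. - (ftau \<iota> * (rho v - mps_pderiv v (logf \<iota>)
       + nthz 0 ((Upos v - Utrunc v K) * (\<Gamma> * zder B))))) (- (ftau \<iota> * (rho v - mps_pderiv v (logf \<iota>) + 0)))"
    by (intro mps_lim_uminus mps_lim_times mps_lim_add mps_lim_const mps_lim_nthz_zge zge_rest)
  then have "mps_lim (\<lambda>K. theta v K (ftau \<iota>)) (- (ftau \<iota> * (rho v - mps_pderiv v (logf \<iota>) + 0)))"
    by (rule mps_lim_cong)
       (auto simp: eventually_sequentially * theta_logf simp del: nthz_simps intro!: exI[of _ N0])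
  then show "mps_lim (\<lambda>K. theta v K (ftau \<iota>))
       (of_nat 0 * (nthz 0 (UL v) * ftau \<iota>) - mps_pderiv v (ftau \<iota>) - of_nat 1 * (ftau \<iota> * rho v))"
    by (simp add: pderiv_ftau algebra_simps)
qed

lemma adm_Gser:
  assumes "i \<ge> 1"
  shows "adm 1 0 (Gser i)"
  unfolding adm_def
proof (intro conjI allI impI)
  fix j :: nat assume j: "j \<ge> 1"
  note D = derivation_lder[OF derivation_dXY[of j]]
  show "mps_map (dXY j) (Gser i) = - (of_nat 0 * (Gser i * mps_map (dXY j) (logf \<iota>)))"
    using j by (simp add: Gser_def derivation_mult[OF D] derivation_diff[OF D] derivation_1[OF D] lder_dXY_BL
        lder_dXY_EminusL flip: nthz_lder[OF derivation_dXY])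
next
  have *: "mps_map (dX k) (Gser i) = nthz (int i - 1) (- zpow (int k) * (EminusL * (1 - B)))" if "k \<ge> N0" for k
  proof -
    note D = derivation_lder[OF derivation_pderiv[of "Vx k"]]
    have "lder (dX k) (EminusL * (1 - B)) = - zpow (int k) * (EminusL * (1 - B))"
      using that lder_dX_B_0[OF that] by (simp add: derivation_mult[OF D] derivation_diff[OF D] derivation_1[OF D] lder_dX_EminusL mult.assoc)
    then show ?thesis by (simp only: Gser_def nthz_lder[OF derivation_pderiv, symmetric])
  qed
  have "mps_lim (\<lambda>k. nthz (int i - 1) (- zpow (int k) * (EminusL * (1 - B)))) 0"
    by (rule mps_lim_nthz_zge) (use zge_zpow[of "int _"] in \<open>simp add: zge_def\<close>)
  then show "mps_lim (\<lambda>k. mps_map (dX k) (Gser i)) 0"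
    by (rule mps_lim_cong) (use * in \<open>auto simp: eventually_sequentially intro!: exI[of _ N0]\<close>)
next
  fix v
  have "mps_lim (\<lambda>K. nthz 0 (UL v) * Gser i - mps_pderiv v (Gser i)
     + nthz (int i - 1) ((Upos v - Utrunc v K) * (EminusL * (1 - B)))) (nthz 0 (UL v) * Gser i - mps_pderiv v (Gser i) + 0)"
    by (intro mps_lim_add mps_lim_const mps_lim_nthz_zge zge_rest)
  then have "mps_lim (\<lambda>K. theta v K (Gser i)) (nthz 0 (UL v) * Gser i - mps_pderiv v (Gser i) + 0)"
    by (rule mps_lim_cong) (use theta_Gser[OF _ assms] in \<open>auto simp: eventually_sequentially intro!: exI[of _ N0]\<close>)
  then show "mps_lim (\<lambda>K. theta v K (Gser i))
       (of_nat 1 * (nthz 0 (UL v) * Gser i) - mps_pderiv v (Gser i) - of_nat 0 * (Gser i * rho v))"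
    by simp
qed

text \<open>For n < 0 the z^n coefficient of B survives in the k-th summand exactly when k < -n,
  that is -n - 1 times; B itself adds one, and the total -n is that of - z d/dz.\<close>

lemma B_plus_sum:
  assumes "K \<ge> N0"
  shows "B + (\<Sum>k=1..K. zpow (- int k) * lder (dX k) B) = - zder B"
proof (rule nthz_eqI)
  fix n
  define b where "b = nthz n B"
  have "nthz n (B + (\<Sum>k=1..K. zpow (- int k) * lder (dX k) B)) = b + (\<Sum>k=1..K. if int k < - n then b else 0)"
    unfolding nthz_simps nthz_sum b_def[symmetric]
    by (intro arg_cong2[where f = "(+)"] sum.cong) (auto simp: lder_dX_BL b_def)
  also have "\<dots> = - of_int n * b"
  proof (cases "- int N0 \<le> n \<and> n < 0")
    case True
    have "(\<Sum>k=1..K. if int k < - n then b else 0) = (\<Sum>k\<in>{1..<nat (- n)}. b)"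
      by (rule sum.mono_neutral_cong_right) (use True assms in auto)
    also have "\<dots> = of_nat (nat (- n) - 1) * b" by simp
    also have "\<dots> = (of_int (- n) - 1) * b"
    proof -
      obtain m where "nat (- n) = Suc m" using True by (metis gr0_implies_Suc nat_0_less_mult_iff neg_0_less_iff_less zero_less_nat_eq)
      then have "- n = int m + 1" by simp
      then show ?thesis using \<open>nat (- n) = Suc m\<close> by (simp only: ) simp
    qed
    finally show ?thesis by (simp add: algebra_simps)
  next
    case False
    then have "b = 0" using zge_B zle_BL[of \<iota>] unfolding b_def zge_def zle_def by force
    then show ?thesis unfolding \<open>b = 0\<close> by simp
  qed
  finally show "nthz n (B + (\<Sum>k=1..K. zpow (- int k) * lder (dX k) B)) = nthz n (- zder B)"
    by (simp add: b_def)
qed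

text \<open>
  The left-hand side is the coefficient extracted by \<open>phistar (- \<iota> v)\<close> from \<open>p\<^sup>-\<^sup>r F\<close>, with the
  infinitely many terms \<open>z\<^sup>-\<^sup>k \<partial>x\<^sub>k\<close> of the current cut off at \<open>K\<close>.
\<close>

lemma current_eq:
  fixes F :: wser
  defines "A \<equiv> emb F * \<Gamma>"
  assumes "K \<ge> N0"
  shows "nthz (int (\<iota> v) + 1) (EplusL * (YL * A + (\<Sum>k=1..K. zpow (- int k) * lder (dX k) A) + euler A - of_nat r * A))
    = F * rho v + theta v K F - of_nat r * (nthz 0 (UL v) * F)"
proof -
  let ?S = "YL * A + (\<Sum>k=1..K. zpow (- int k) * lder (dX k) A) + euler A - of_nat r * A"
  have dA: "lder (dX k) A = emb F * (\<Gamma> * \<Gamma> * lder (dX k) B) + emb (mps_map (dX k) F) * \<Gamma>" for k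
    unfolding A_def
    by (simp add: derivation_mult[OF derivation_lder[OF derivation_pderiv]] lder_emb derivation_pderiv
        derivation_GamL[OF derivation_lder[OF derivation_pderiv]])
  have eA: "euler A = emb F * (\<Gamma> * \<Gamma> * B) + emb (euler F) * \<Gamma>"
    unfolding A_def by (simp add: derivation_mult[OF derivation_euler] emb_euler euler_GamL)
  have "nthz (int (\<iota> v) + 1) (EplusL * ?S) = nthz 0 (WL \<iota> v * ?S)"
    unfolding WL_def mult.assoc nthz_zpow_times by (simp add: add.commute)
  \<comment> \<open>Sorted by what is hit: derivatives of \<Gamma> collect into the sum evaluated by
    \<open>B_plus_sum\<close>, derivatives of F into \<open>theta\<close>.\<close>
  also have "WL \<iota> v * ?S = emb F * (YL * UL v) + emb F * (UL v * (\<Gamma> * (B + (\<Sum>k=1..K. zpow (- int k) * lder (dX k) B))))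
     + (\<Sum>k=1..K. zpow (- int k) * (emb (mps_map (dX k) F) * UL v)) + emb (euler F) * UL v - emb (of_nat r * F) * UL v"
    unfolding dA eA by (simp add: A_def UL_def algebra_simps sum.distrib sum_distrib_left emb_times of_nat_emb[symmetric])
  also have "nthz 0 \<dots> = F * rho v + theta v K F - of_nat r * (nthz 0 (UL v) * F)"
  proof -
    have "nthz 0 (\<Sum>k=1..K. zpow (- int k) * (emb (mps_map (dX k) F) * UL v)) =
        (\<Sum>k=1..K. nthz (int k) (UL v) * mps_map (dX k) F)"
      unfolding nthz_sum by (rule sum.cong) (simp_all add: mult.commute)
    moreover have "nthz 0 (UL v * (\<Gamma> * - zder B)) = - nthz 0 (UL v * (\<Gamma> * zder B))"
      by simp
    ultimately show ?thesis
      unfolding B_plus_sum[OF assms(2)] nthz_simps nthz_emb_times rho_def theta_def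
      by (simp only:) (simp add: algebra_simps)
  qed
  finally show ?thesis .
qed

text \<open>Two cancellations: c = 1 in \<open>adm\<close> removes \<open>rho\<close>, and r times
  the constant term of U is removed by p dp acting on p^-r.\<close>

lemma current_lim:
  fixes F :: wser
  defines "A \<equiv> emb F * \<Gamma>"
  assumes "adm r 1 F"
  shows "mps_lim (\<lambda>K. nthz (int (\<iota> v) + 1)
      (EplusL * (YL * A + (\<Sum>k=1..K. zpow (- int k) * lder (dX k) A) + euler A - of_nat r * A)))
    (- mps_pderiv v F)"
proof (rule mps_lim_cong)
  show "mps_lim (\<lambda>K. F * rho v + theta v K F - of_nat r * (nthz 0 (UL v) * F)) (- mps_pderiv v F)"
  proof -
    have "mps_lim (\<lambda>K. F * rho v + theta v K F - of_nat r * (nthz 0 (UL v) * F))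
      (F * rho v + (of_nat r * (nthz 0 (UL v) * F) - mps_pderiv v F - of_nat 1 * (F * rho v)) - of_nat r * (nthz 0 (UL v) * F))"
      using assms(2) unfolding adm_def by (intro mps_lim_diff mps_lim_add mps_lim_const) auto
    then show ?thesis by simp
  qed
  show "eventually (\<lambda>K. nthz (int (\<iota> v) + 1)
      (EplusL * (YL * A + (\<Sum>k=1..K. zpow (- int k) * lder (dX k) A) + euler A - of_nat r * A)) =
      F * rho v + theta v K F - of_nat r * (nthz 0 (UL v) * F)) sequentially"
    unfolding A_def eventually_sequentially using current_eq by blast
qed

text \<open>At each monomial in w almost all x_k-derivatives vanish, for all powers of z at once, so
  one cut-off serves the whole Laurent coefficient.\<close>

lemma lder_dX_GamL_tame:
  assumes "adm r c F"
  shows "mps_lim (\<lambda>k. lder (dX k) (emb F * \<Gamma>)) 0"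
proof -
  have "mps_lim (\<lambda>k. emb (mps_map (dX k) F) * \<Gamma>) (emb 0 * \<Gamma>)"
    using assms unfolding emb_def adm_def by (intro mps_lim_times mps_lim_const mps_lim_map) auto
  then have "mps_lim (\<lambda>k. emb (mps_map (dX k) F) * \<Gamma>) 0" by simp
  then show ?thesis
    by (rule mps_lim_cong)
       (auto simp: eventually_sequentially derivation_mult[OF derivation_lder[OF derivation_pderiv]] lder_emb derivation_pderiv
        derivation_GamL[OF derivation_lder[OF derivation_pderiv]] lder_dX_B_0 intro!: exI[of _ N0])
qed

end

section \<open>The action on the Fock space\<close>

text \<open>\<open>C\<close> is bounded below in z, so the formal sum is finite and a multiplication
  operator becomes a product of Laurent series.\<close>

lemma formal_sum_fls:
  "formal_sum (\<lambda>m. a m * fls_nth C (s - int m)) = fls_nth (fps_to_fls (Abs_fps a) * C) s"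
proof -
  obtain N where N: "\<forall>n<N. fls_nth C n = 0" using fls_lower_bound by blast
  have "fls_nth (fps_to_fls (Abs_fps a) * C) s =
    (\<Sum>i=0..s - N. fls_nth (fps_to_fls (Abs_fps a)) i * fls_nth C (s - i))"
    by (rule fls_times_nth_bounds[OF _ N]) auto
  also have "\<dots> = (\<Sum>m\<in>{m. int m \<le> s - N}. a m * fls_nth C (s - int m))"
    by (rule sum.reindex_bij_witness[of _ int nat]) auto
  also have "\<dots> = formal_sum (\<lambda>m. a m * fls_nth C (s - int m))"
  proof (rule formal_sum_finite[symmetric])
    show "finite {m. int m \<le> s - N}"
      by (rule finite_subset[of _ "{..nat (s - N)}"]) auto
  qed (use N in auto)
  finally show ?thesis by simp
qed

lemma deriv_z_0: "deriv_z 0 = 0"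
  by (rule fps_ext) (simp add: deriv_z_def derivation_0[OF derivation_pderiv])

lemma exp_deriv_z_0: "exp_deriv_z \<sigma> 0 = 0"
proof -
  have "(deriv_z ^^ n) 0 = 0" for n by (induction n) (auto simp: deriv_z_0)
  then show ?thesis by (intro fps_ext) (simp add: exp_deriv_z_def)
qed

text \<open>The term of \<open>p\<^sup>-\<^sup>r F(w1 p, w2 p)\<close> that belongs to the monomial \<open>M\<close> in \<open>w\<close>.\<close>

definition vec :: "nat \<Rightarrow> wser \<Rightarrow> wvar multiset \<Rightarrow> fock" where
  "vec r F M = (\<lambda>q. if q = int (size M) - int r then mps_coeff F M else 0)"

definition smul :: "complex \<Rightarrow> fock \<Rightarrow> fock" where
  "smul c v = (\<lambda>q. mps_const c * v q)"

context
  fixes \<iota> :: "wvar \<Rightarrow> nat"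
begin

lemma shift_op_1:
  assumes "adm \<iota> r 1 F"
  shows "shift_op 1 (vec r F M) s q =
    (if q = int (size M) - int r then fls_nth (mps_coeff (emb F * (1 - BL \<iota>)) M) s else 0)"
proof -
  have "zle (0 + 0) (emb F * (1 - BL \<iota>))" by (rule zle_times[OF zle_emb zle_1_B])
  then show ?thesis
    using assms exp_deriv_z_1[of F \<iota> M "nat (- s)"]
    by (auto simp: shift_op_def vec_def adm_def exp_deriv_z_0 mps_coeff_nthz zle_alt
        simp del: nthz_emb_times nthz_simps)
qed

lemma shift_op_minus_1:
  assumes "adm \<iota> r 1 F"
  shows "shift_op (- 1) (vec r F M) s q =
    (if q = int (size M) - int r then fls_nth (mps_coeff (emb F * GamL \<iota>) M) s else 0)"
proof -
  have "zle (0 + 0) (emb F * GamL \<iota>)" by (rule zle_times[OF zle_emb zle_GamL])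
  then show ?thesis
    using assms exp_deriv_z_minus_1[of F \<iota> M "nat (- s)"]
    by (auto simp: shift_op_def vec_def adm_def exp_deriv_z_0 mps_coeff_nthz zle_alt
        simp del: nthz_emb_times nthz_simps)
qed

lemma phi_vec:
  assumes "adm \<iota> r 1 F"
  shows "phi (- int i) (vec r F M) = vec (r + 1) (Gser \<iota> i * F) M"
proof
  fix q
  define C where "C = mps_coeff (emb F * (1 - BL \<iota>)) M"
  have "phi (- int i) (vec r F M) q =
      (if q + 1 = int (size M) - int r then formal_sum (\<lambda>m. Sminus m * fls_nth C (int i - 1 - int m)) else 0)"
    by (auto simp: phi_def phi_z_def exp_mult_op_def shift_op_1[OF assms] C_def formal_sum_zero)
  also have "formal_sum (\<lambda>m. Sminus m * fls_nth C (int i - 1 - int m)) = fls_nth (Eminus * C) (int i - 1)"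
    by (rule formal_sum_fls)
  also have "\<dots> = mps_coeff (nthz (int i - 1) (emb F * (EminusL * (1 - BL \<iota>)))) M"
    unfolding mps_coeff_nthz C_def by (simp only: EminusL_def mult.left_commute[of "emb F"] mps_coeff_const_times)
  also have "\<dots> = mps_coeff (Gser \<iota> i * F) M"
    unfolding nthz_emb_times Gser_def by (simp only: mult.commute)
  finally show "phi (- int i) (vec r F M) q = vec (r + 1) (Gser \<iota> i * F) M q"
    by (auto simp: vec_def)
qed

lemma of_int_diff_times: "of_int (int a - int b) * (x :: 'a :: comm_ring_1) = of_nat a * x - of_nat b * x"
  by (simp add: algebra_simps)

lemma mps_coeff_of_nat_times: "mps_coeff (of_nat n * A) M = of_nat n * mps_coeff A M"
  by (induction n) (simp_all add: zero_mps.rep_eq plus_mps.rep_eq distrib_right)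

lemma fls_nth_of_nat_times: "fls_nth (of_nat n * A) m = of_nat n * fls_nth A m"
  by (induction n) (simp_all add: distrib_right)

text \<open>The factor is that of the coefficient of -dF/dw_v at \<open>M\<close>; the larger
  monomial on the right accounts for the factor p in \<open>phistar\<close>.\<close>

lemma phistar_vec:
  assumes adm: "adm \<iota> r 1 F"
  shows "phistar (- int (\<iota> v)) (vec r F M) = smul (- of_nat (Suc (count M v))) (vec r F (add_mset v M))"
proof
  fix q
  define A where "A = emb F * GamL \<iota>"
  define C where "C = mps_coeff A M"
  let ?D = "\<lambda>K. YL * A + (\<Sum>k=1..K. zpow (- int k) * lder (dX k) A) + euler A - of_nat r * A"
  have "eventually (\<lambda>K. mps_coeff (nthz (int (\<iota> v) + 1) (EplusL * ?D K)) M =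
      mps_coeff (- mps_pderiv v F) M) sequentially"
    using current_lim[OF adm, of v] by (simp only: mps_lim_def A_def)
  then obtain K1 where K1: "\<And>K. K \<ge> K1 \<Longrightarrow> mps_coeff (nthz (int (\<iota> v) + 1) (EplusL * ?D K)) M =
      mps_coeff (- mps_pderiv v F) M" unfolding eventually_sequentially by blast
  have "eventually (\<lambda>k. mps_coeff (lder (dX k) A) M = mps_coeff 0 M) sequentially"
    using lder_dX_GamL_tame[OF adm] by (simp add: mps_lim_def A_def)
  then obtain K2 where "\<And>k. k \<ge> K2 \<Longrightarrow> mps_coeff (lder (dX k) A) M = mps_coeff 0 M"
    unfolding eventually_sequentially by blast
  then have K2: "dX k (fls_nth C n) = 0" if "k \<ge> K2" for k n
    using fls_map_nth[of "dX k" C n] that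
    by (simp add: C_def lder_def mps_map.rep_eq zero_mps.rep_eq derivation_0[OF derivation_pderiv])
  \<comment> \<open>Beyond \<open>K1\<close> the truncated current has reached its limit at
    \<open>M\<close>; beyond \<open>K2\<close> the omitted terms vanish there.\<close>
  define K where "K = max K1 K2"
  define D where "D = mps_coeff (?D K) M"
  \<comment> \<open>The last term is p dp on \<open>vec r F M\<close>, which sits at the power
    \<open>size M - r\<close> of p.\<close>
  have D: "fls_nth D n = fls_nth (fps_to_fls (Abs_fps (\<lambda>k. of_nat k * xx k)) * C) n
    + (\<Sum>k=1..K. dX k (fls_nth C (n + int k))) + of_int (int (size M) - int r) * fls_nth C n" for n
  proof -
    have "mps_coeff (zpow (- int k) * lder (dX k) A) M = fls_X_intpow (- int k) * fls_map (dX k) C" for k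
      by (simp only: zpow_def mps_coeff_const_times lder_def mps_map.rep_eq C_def)
    moreover have "fls_nth (fls_X_intpow (- int k) * fls_map (dX k) C) n = dX k (fls_nth C (n + int k))" for k
      unfolding fls_X_intpow_times_conv_shift by (simp add: fls_map_nth derivation_0[OF derivation_pderiv])
    ultimately have "fls_nth (mps_coeff (\<Sum>k=1..K. zpow (- int k) * lder (dX k) A) M) n =
       (\<Sum>k=1..K. dX k (fls_nth C (n + int k)))"
      by (simp only: mps_coeff_sum fls_nth_sum)
    moreover have "mps_coeff (YL * A) M = fps_to_fls (Abs_fps (\<lambda>k. of_nat k * xx k)) * C"
      by (simp only: YL_def mps_coeff_const_times C_def)
    ultimately show ?thesis
      unfolding of_int_diff_times
      by (simp only: D_def plus_mps.rep_eq minus_mps.rep_eq fls_plus_nth fls_minus_nth mps_grade.rep_eq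
          mps_coeff_of_nat_times fls_nth_of_nat_times C_def) simp
  qed
  have cur: "current_op (shift_op (- 1) (vec r F M)) s t =
     (if t = int (size M) - int r then fls_nth D (s + 1) else 0)" for s t
  proof (cases "t = int (size M) - int r")
    case True
    have sh: "shift_op (- 1) (vec r F M) s t = fls_nth C s" for s
      by (simp add: shift_op_minus_1[OF adm] True C_def A_def)
    have "formal_sum (\<lambda>k. if k > 0 then of_nat k * xx k * fls_nth C (s - (int k - 1)) else 0) =
      formal_sum (\<lambda>k. (of_nat k * xx k) * fls_nth C (s + 1 - int k))"
      by (rule arg_cong[where f = formal_sum]) (auto simp: algebra_simps)
    moreover have "formal_sum (\<lambda>k. if k > 0 then dX k (fls_nth C (s + int k + 1)) else 0) =
      (\<Sum>k=1..K. dX k (fls_nth C (s + 1 + int k)))"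
      by (subst formal_sum_finite[of "{1..K}"]) (auto simp: K2 K_def algebra_simps not_le intro!: sum.cong)
    ultimately show ?thesis
      unfolding current_op_def sh by (simp only: formal_sum_fls D True if_True simp_thms)
  next
    case False
    then have "shift_op (- 1) (vec r F M) s t = 0" for s
      by (simp add: shift_op_minus_1[OF adm])
    then show ?thesis
      using False by (simp add: current_op_def derivation_0[OF derivation_pderiv] formal_sum_zero cong: if_cong)
  qed
  have "phistar (- int (\<iota> v)) (vec r F M) q =
     (if q - 1 = int (size M) - int r then formal_sum (\<lambda>m. Splus m * fls_nth D (int (\<iota> v) + 1 - int m)) else 0)"
    by (auto simp: phistar_def phistar_z_def exp_mult_op_def cur formal_sum_zero algebra_simps)
  also have "formal_sum (\<lambda>m. Splus m * fls_nth D (int (\<iota> v) + 1 - int m)) = fls_nth (Eplus * D) (int (\<iota> v) + 1)"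
    by (rule formal_sum_fls)
  also have "\<dots> = mps_coeff (nthz (int (\<iota> v) + 1) (EplusL * ?D K)) M"
    unfolding mps_coeff_nthz D_def by (simp only: EplusL_def mps_coeff_const_times)
  also have "\<dots> = - (of_nat (Suc (count M v)) * mps_coeff F (add_mset v M))"
    using K1[of K] by (simp add: K_def uminus_mps.rep_eq mps_pderiv.rep_eq del: nthz_simps)
  also have "\<dots> = mps_const (- of_nat (Suc (count M v))) * mps_coeff F (add_mset v M)"
  proof -
    have "of_nat n = (mps_const (of_nat n) :: xyser)" for n
      by (induction n) (auto simp flip: mps_const_simps(3))
    then show ?thesis by (simp del: of_nat_Suc flip: mps_const_simps(5))
  qed
  finally show "phistar (- int (\<iota> v)) (vec r F M) q = smul (- of_nat (Suc (count M v))) (vec r F (add_mset v M)) q"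
    by (auto simp: smul_def vec_def algebra_simps)
qed

lemma vacuum_vec: "vacuum = vec 0 (ftau \<iota>) {#}"
  by (rule ext) (simp add: vacuum_def vec_def ftau_empty)

end

subsection \<open>Linearity\<close>

definition fock_linear :: "(fock \<Rightarrow> fock) \<Rightarrow> bool" where
  "fock_linear T \<longleftrightarrow> (\<forall>v w. T (\<lambda>q. v q + w q) = (\<lambda>q. T v q + T w q)) \<and> (\<forall>c v. T (smul c v) = smul c (T v))"

lemma linear_add: "fock_linear T \<Longrightarrow> T (\<lambda>q. v q + w q) = (\<lambda>q. T v q + T w q)"
  and linear_smul: "fock_linear T \<Longrightarrow> T (smul c v) = smul c (T v)"
  by (simp_all add: fock_linear_def)

lemma formal_sum_add:
  assumes "formally_summable F" "formally_summable G"
  shows "formal_sum (\<lambda>i. F i + G i) = formal_sum F + formal_sum G"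
  by (rule mps_eqI)
     (use assms in \<open>simp add: mps_coeff_formal_sum plus_mps.rep_eq formally_summable_def Sum_any.distrib\<close>)

lemma formal_sum_const_times:
  assumes "formally_summable (F :: _ \<Rightarrow> ('v, complex) mps)"
  shows "formal_sum (\<lambda>i. mps_const c * F i) = mps_const c * formal_sum F"
  by (rule mps_eqI)
     (use assms in \<open>simp add: mps_coeff_formal_sum mps_coeff_const_times formally_summable_def Sum_any_right_distrib\<close>)

lemma deriv_z_add: "deriv_z (G + H) = deriv_z G + deriv_z H"
  by (rule fps_ext)
     (simp add: deriv_z_def derivation_add[OF derivation_pderiv] algebra_simps sum.distrib scaleR_add_right sum_subtractf)

lemma deriv_z_const: "deriv_z (fps_const (mps_const c) * G) = fps_const (mps_const c) * deriv_z G"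
  by (rule fps_ext)
     (simp add: deriv_z_def derivation_mult[OF derivation_pderiv] sum_distrib_left right_diff_distrib[symmetric])

lemma exp_deriv_z_add: "exp_deriv_z \<sigma> (g + h) = exp_deriv_z \<sigma> g + exp_deriv_z \<sigma> h"
proof -
  have "(deriv_z ^^ n) (fps_const (g + h)) = (deriv_z ^^ n) (fps_const g) + (deriv_z ^^ n) (fps_const h)" for n
    by (induction n) (auto simp: deriv_z_add)
  then show ?thesis
    by (intro fps_ext) (simp add: exp_deriv_z_def scaleR_add_right sum.distrib)
qed

lemma exp_deriv_z_const: "exp_deriv_z \<sigma> (mps_const c * g) = fps_const (mps_const c) * exp_deriv_z \<sigma> g"
proof -
  have "(deriv_z ^^ n) (fps_const (mps_const c * g)) = fps_const (mps_const c) * (deriv_z ^^ n) (fps_const g)" for n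
    by (induction n) (auto simp: deriv_z_const)
  then show ?thesis
    by (intro fps_ext) (simp add: exp_deriv_z_def sum_distrib_left)
qed

lemma shift_op_add: "shift_op \<sigma> (\<lambda>q. v q + w q) r q = shift_op \<sigma> v r q + shift_op \<sigma> w r q"
  by (simp add: shift_op_def exp_deriv_z_add)

lemma shift_op_smul: "shift_op \<sigma> (smul c v) r q = mps_const c * shift_op \<sigma> v r q"
  by (simp add: shift_op_def exp_deriv_z_const smul_def)

lemma exp_mult_op_add:
  assumes "\<And>n. homogeneous n (t n)"
  shows "exp_mult_op t (\<lambda>r q. V r q + W r q) r q = exp_mult_op t V r q + exp_mult_op t W r q"
  by (simp add: exp_mult_op_def distrib_left formal_sum_add formally_summable_exp_mult_op[OF assms])

lemma exp_mult_op_const: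
  assumes "\<And>n. homogeneous n (t n)"
  shows "exp_mult_op t (\<lambda>r q. mps_const c * V r q) r q = mps_const c * exp_mult_op t V r q"
  by (simp add: exp_mult_op_def mult.left_commute[of _ "mps_const c"]
      formal_sum_const_times formally_summable_exp_mult_op[OF assms])

text \<open>Restricted to images of \<open>shift_op\<close>: they have no positive powers of z,
  which makes the sum over the x_k-derivatives finite.\<close>

lemma current_op_add:
  "current_op (shift_op \<sigma> (\<lambda>q. v q + w q)) r q =
   current_op (shift_op \<sigma> v) r q + current_op (shift_op \<sigma> w) r q"
proof -
  have 1: "(\<lambda>k. if k > 0 then of_nat k * xx k * shift_op \<sigma> (\<lambda>q. v q + w q) (r - (int k - 1)) q else 0) =
    (\<lambda>k. (if k > 0 then of_nat k * xx k * shift_op \<sigma> v (r - (int k - 1)) q else 0) +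
         (if k > 0 then of_nat k * xx k * shift_op \<sigma> w (r - (int k - 1)) q else 0))"
    by (rule ext) (simp add: shift_op_add algebra_simps)
  have 2: "(\<lambda>k. if k > 0 then dX k (shift_op \<sigma> (\<lambda>q. v q + w q) (r + int k + 1) q) else 0) =
    (\<lambda>k. (if k > 0 then dX k (shift_op \<sigma> v (r + int k + 1) q) else 0) +
         (if k > 0 then dX k (shift_op \<sigma> w (r + int k + 1) q) else 0))"
    by (rule ext) (simp add: shift_op_add derivation_add[OF derivation_pderiv])
  show ?thesis
    unfolding current_op_def 1 2
    by (simp add: formal_sum_add formally_summable_current_op_x formally_summable_current_op_pderiv
        shift_op_add algebra_simps del: of_nat_mult)
qed

lemma current_op_const:
  "current_op (shift_op \<sigma> (smul c v)) r q = mps_const c * current_op (shift_op \<sigma> v) r q"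
proof -
  have 1: "(\<lambda>k. if k > 0 then of_nat k * xx k * shift_op \<sigma> (smul c v) (r - (int k - 1)) q else 0) =
    (\<lambda>k. mps_const c * (if k > 0 then of_nat k * xx k * shift_op \<sigma> v (r - (int k - 1)) q else 0))"
    by (rule ext) (simp add: shift_op_smul mult_ac)
  have 2: "(\<lambda>k. if k > 0 then dX k (shift_op \<sigma> (smul c v) (r + int k + 1) q) else 0) =
    (\<lambda>k. mps_const c * (if k > 0 then dX k (shift_op \<sigma> v (r + int k + 1) q) else 0))"
    by (rule ext) (simp add: shift_op_smul derivation_mult[OF derivation_pderiv])
  show ?thesis
    unfolding current_op_def 1 2
    by (subst (1 2) formal_sum_const_times)
       (simp_all only: formally_summable_current_op_x formally_summable_current_op_pderiv
        shift_op_smul distrib_left mult.left_commute[of _ "mps_const c"])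
qed

lemma linear_phi: "fock_linear (phi i)"
  unfolding fock_linear_def phi_def phi_z_def
  using exp_mult_op_add[OF homogeneous_arguments(2)] exp_mult_op_const[OF homogeneous_arguments(2)]
  by (auto simp: shift_op_add[abs_def] shift_op_smul[abs_def]) (simp add: smul_def)

lemma linear_phistar: "fock_linear (phistar i)"
  unfolding fock_linear_def phistar_def phistar_z_def
  using exp_mult_op_add[OF homogeneous_arguments(1)] exp_mult_op_const[OF homogeneous_arguments(1)]
  by (auto simp: current_op_add[abs_def] current_op_const[abs_def]) (simp add: smul_def)

lemma linear_compose: "fock_linear S \<Longrightarrow> fock_linear T \<Longrightarrow> fock_linear (S \<circ> T)"
  by (simp add: fock_linear_def)

lemma linear_scale_op: "fock_linear T \<Longrightarrow> fock_linear (scale_op c T)"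
  by (simp add: fock_linear_def scale_op_def smul_def distrib_left mult.left_commute[of "mps_const c"])

lemma linear_power: "fock_linear T \<Longrightarrow> fock_linear (T ^^ n)"
  by (induction n) (auto simp: fock_linear_def)

lemma linear_zero:
  assumes "fock_linear T"
  shows "T (\<lambda>q. 0) = (\<lambda>q. 0)"
proof -
  have "T (smul 0 (\<lambda>q. 0)) = smul 0 (T (\<lambda>q. 0))" by (rule linear_smul[OF assms])
  then show ?thesis by (simp add: smul_def)
qed

lemma linear_sum:
  assumes "fock_linear T"
  shows "T (\<lambda>q. \<Sum>i\<in>I. v i q) = (\<lambda>q. \<Sum>i\<in>I. T (v i) q)"
proof (induction I rule: infinite_finite_induct)
  case (insert i I)
  have "T (\<lambda>q. v i q + (\<Sum>i\<in>I. v i q)) = (\<lambda>q. T (v i) q + T (\<lambda>q. \<Sum>i\<in>I. v i q) q)"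
    by (rule linear_add[OF assms])
  then show ?case using insert by simp
qed (simp_all add: linear_zero[OF assms])

subsection \<open>The weight filtration\<close>

definition order_ge :: "int \<Rightarrow> xyser \<Rightarrow> bool" where
  "order_ge N g \<longleftrightarrow> (\<forall>M. mps_coeff g M \<noteq> 0 \<longrightarrow> N \<le> int (weight M))"

text \<open>Plays the part of continuity: exponentials of operators of positive gain converge, and
  linear operators of gain 0 commute with convergent sums.\<close>

definition raises :: "int \<Rightarrow> (fock \<Rightarrow> fock) \<Rightarrow> bool" where
  "raises d T \<longleftrightarrow> (\<forall>N v. (\<forall>q. order_ge N (v q)) \<longrightarrow> (\<forall>q. order_ge (N + d) (T v q)))"

lemma order_ge_0 [simp]: "order_ge N 0"
  by (simp add: order_ge_def zero_mps.rep_eq)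

lemma order_ge_mono: "order_ge N g \<Longrightarrow> N' \<le> N \<Longrightarrow> order_ge N' g"
  by (fastforce simp: order_ge_def)

lemma order_ge_add: "order_ge N f \<Longrightarrow> order_ge N g \<Longrightarrow> order_ge N (f + g)"
  unfolding order_ge_def plus_mps.rep_eq by (metis add.right_neutral)

lemma order_ge_uminus: "order_ge N f \<Longrightarrow> order_ge N (- f)"
  by (simp add: order_ge_def uminus_mps.rep_eq)

lemma order_ge_diff: "order_ge N f \<Longrightarrow> order_ge N g \<Longrightarrow> order_ge N (f - g)"
  using order_ge_add[of N f "- g"] by (simp add: order_ge_uminus)

lemma order_ge_scaleR: "order_ge N f \<Longrightarrow> order_ge N (r *\<^sub>R f)"
  by (simp add: order_ge_def scaleR_mps.rep_eq)

lemma order_ge_sum: "(\<And>i. i \<in> I \<Longrightarrow> order_ge N (f i)) \<Longrightarrow> order_ge N (\<Sum>i\<in>I. f i)"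
  by (induction I rule: infinite_finite_induct) (auto intro: order_ge_add)

lemma order_ge_times: "order_ge a f \<Longrightarrow> order_ge b g \<Longrightarrow> order_ge (a + b) (f * g)"
  unfolding order_ge_def by (fastforce elim!: mps_coeff_times_nonzeroE simp: weight_def)

lemma order_ge_nonneg: "order_ge 0 f"
  by (simp add: order_ge_def)

lemma order_ge_times_any: "order_ge b g \<Longrightarrow> order_ge b (f * g)"
  using order_ge_times[OF order_ge_nonneg, of b g f] by simp

lemma order_ge_homogeneous: "homogeneous n f \<Longrightarrow> order_ge (int n) f"
  by (auto simp: order_ge_def homogeneous_def)

lemma order_ge_formal_sum:
  assumes "\<And>i. order_ge N (f i)"
  shows "order_ge N (formal_sum f)"
  unfolding order_ge_def mps_coeff_formal_sum
  using assms by (auto simp: order_ge_def elim: Sum_any.not_neutral_obtains_not_neutral)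

lemma order_ge_pderiv:
  assumes "order_ge N g" "v = Vx k \<or> v = Vy k"
  shows "order_ge (N - int k) (mps_pderiv v g)"
  unfolding order_ge_def mps_pderiv.rep_eq
proof (intro allI impI)
  fix M assume "of_nat (count M v + 1) * mps_coeff g (add_mset v M) \<noteq> 0"
  then have "N \<le> int (weight (add_mset v M))" using assms(1) by (auto simp: order_ge_def)
  then show "N - int k \<le> int (weight M)" using assms(2) by (auto simp: weight_def)
qed

lemma order_ge_exp_deriv_z:
  assumes "order_ge N g"
  shows "order_ge (N - int m) (fps_nth (exp_deriv_z \<sigma> g) m)"
proof -
  have "order_ge (N - int m) (fps_nth ((deriv_z ^^ n) (fps_const g)) m)" for n m
  proof (induction n arbitrary: m)
    case (Suc n)
    have "order_ge (N - int m) (mps_pderiv v (fps_nth ((deriv_z ^^ n) (fps_const g)) (m - i)))"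
      if "i \<in> {1..m}" "v = Vx i \<or> v = Vy i" for i v
      using order_ge_pderiv[OF Suc[of "m - i"] that(2)] that(1) by (simp add: of_nat_diff)
    then show ?case
      unfolding funpow.simps comp_apply deriv_z_def[of "(deriv_z ^^ n) _"] fps_nth_Abs_fps
      by (intro order_ge_sum order_ge_scaleR order_ge_diff) auto
  qed (use assms in simp)
  then show ?thesis
    by (auto simp: exp_deriv_z_def intro!: order_ge_sum order_ge_scaleR)
qed

text \<open>Giving z the weight -1 makes each factor of a vertex operator homogeneous, so its z^r
  coefficient raises the order by r; the current adds one more.\<close>

lemma order_ge_shift_op:
  assumes "\<And>q. order_ge N (v q)"
  shows "order_ge (N + r) (shift_op \<sigma> v r q)"
  using order_ge_exp_deriv_z[OF assms[of q], of "nat (- r)" \<sigma>] by (auto simp: shift_op_def)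

lemma order_ge_exp_mult_op:
  assumes "\<And>n. homogeneous n (t n)" "\<And>r q. order_ge (N + r) (V r q)"
  shows "order_ge (N + r) (exp_mult_op t V r q)"
  unfolding exp_mult_op_def
proof (rule order_ge_formal_sum)
  fix m
  have "order_ge (int m + (N + (r - int m))) (schur t m * V (r - int m) q)"
    by (intro order_ge_times order_ge_homogeneous homogeneous_schur assms)
  then show "order_ge (N + r) (schur t m * V (r - int m) q)" by simp
qed

lemma order_ge_current_op:
  assumes "\<And>r q. order_ge (N + r) (V r q)"
  shows "order_ge (N + 1 + r) (current_op V r q)"
  unfolding current_op_def
proof (intro order_ge_add order_ge_formal_sum)
  fix k :: nat
  have "order_ge (int k + (N + (r - (int k - 1)))) (of_nat k * (xx k * V (r - (int k - 1)) q))"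
    by (intro order_ge_times order_ge_times_any[of _ _ "of_nat k"] order_ge_homogeneous[OF homogeneous_xx] assms)
  then show "order_ge (N + 1 + r) (if k > 0 then of_nat k * xx k * V (r - (int k - 1)) q else 0)"
    by (simp add: mult.assoc algebra_simps)
  have "order_ge (N + (r + int k + 1) - int k) (dX k (V (r + int k + 1) q))"
    by (intro order_ge_pderiv assms) simp
  then show "order_ge (N + 1 + r) (if k > 0 then dX k (V (r + int k + 1) q) else 0)"
    by (simp add: algebra_simps)
next
  have "order_ge (N + (r + 1)) (of_int q * V (r + 1) q)"
    by (intro order_ge_times_any assms)
  then show "order_ge (N + 1 + r) (of_int q * V (r + 1) q)" by (simp add: algebra_simps)
qed

text \<open>For i = 1 nothing is gained; only together with \<open>phistar (- l)\<close> does i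
  \<ge> 1 guarantee a positive gain, namely i + l.\<close>

lemma raises_phi: "raises (int i - 1) (phi (- int i))"
  unfolding raises_def phi_def phi_z_def
  using order_ge_exp_mult_op[OF homogeneous_arguments(2) order_ge_shift_op, of _ _ "int i - 1"] by simp

lemma raises_phistar: "raises (int l + 1) (phistar (- int l))"
  unfolding raises_def phistar_def phistar_z_def
  using order_ge_exp_mult_op[OF homogeneous_arguments(1) order_ge_current_op[OF order_ge_shift_op], of _ _ "int l"]
  by (simp add: algebra_simps)

lemma raises_compose: "raises a S \<Longrightarrow> raises b T \<Longrightarrow> raises (a + b) (S \<circ> T)"
  unfolding raises_def comp_apply by (simp only: add.commute[of a b] add.assoc[symmetric]) blast

lemma raises_mono: "raises a S \<Longrightarrow> b \<le> a \<Longrightarrow> raises b S"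
  unfolding raises_def by (meson add_left_mono order_ge_mono)

lemma raises_scale_op: "raises a S \<Longrightarrow> raises a (scale_op c S)"
  unfolding raises_def scale_op_def by (auto intro: order_ge_times_any)

lemma raises_power: "raises a S \<Longrightarrow> raises (int n * a) (S ^^ n)"
proof (induction n)
  case (Suc n)
  then have "raises (a + int n * a) (S \<circ> S ^^ n)" by (intro raises_compose) auto
  moreover have "int (Suc n) * a = a + int n * a" by (simp add: algebra_simps)
  ultimately show ?case by (simp only: funpow.simps)
qed (simp add: raises_def)

text \<open>Cut at the weight of the coefficient in question: on the head, a finite sum, linearity
  suffices, and the tail keeps its higher order under \<open>T\<close> and is not seen.\<close>

lemma linear_formal_sum:
  fixes v :: "nat \<Rightarrow> fock"
  assumes T: "fock_linear T" "raises 0 T" and v: "\<And>m q. order_ge (int m) (v m q)"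
  shows "T (\<lambda>q. formal_sum (\<lambda>m. v m q)) = (\<lambda>q. formal_sum (\<lambda>m. T (v m) q))"
proof (intro ext mps_eqI)
  fix q M
  define K where "K = Suc (weight M)"
  define R where "R q = formal_sum (\<lambda>m. if m < K then 0 else v m q)" for q
  have Tv: "order_ge (int m) (T (v m) q)" for m q
    using T(2) v unfolding raises_def by fastforce
  have split: "formal_sum (\<lambda>m. v m q) = (\<Sum>m<K. v m q) + R q" for q
  proof -
    have "formally_summable (\<lambda>m. if m < K then v m q else 0)"
      unfolding formally_summable_def
    proof
      fix M
      show "finite {m. mps_coeff (if m < K then v m q else 0) M \<noteq> 0}"
        by (rule finite_subset[of _ "{..<K}"]) (auto simp: zero_mps.rep_eq split: if_splits)
    qed
    moreover have "formally_summable (\<lambda>m. if m < K then 0 else v m q)"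
      unfolding formally_summable_def
    proof
      fix M
      show "finite {m. mps_coeff (if m < K then 0 else v m q) M \<noteq> 0}"
        by (rule finite_subset[of _ "{..weight M}"])
           (use v in \<open>force simp: zero_mps.rep_eq order_ge_def split: if_splits\<close>)+
    qed
    moreover have "(\<lambda>m. v m q) = (\<lambda>m. (if m < K then v m q else 0) + (if m < K then 0 else v m q))"
      by auto
    ultimately have "formal_sum (\<lambda>m. v m q) = formal_sum (\<lambda>m. if m < K then v m q else 0) + R q"
      unfolding R_def by (subst formal_sum_add[symmetric]) simp_all
    also have "formal_sum (\<lambda>m. if m < K then v m q else 0) = (\<Sum>m<K. v m q)"
      by (subst formal_sum_finite[of "{..<K}"]) auto
    finally show ?thesis .
  qed
  have "order_ge (int K) (R q)" for q
    unfolding R_def by (rule order_ge_formal_sum) (auto intro: order_ge_mono[OF v])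
  then have R: "order_ge (int K) (T R q)"
    using T(2) unfolding raises_def by fastforce
  have "T (\<lambda>q. formal_sum (\<lambda>m. v m q)) = T (\<lambda>q. (\<Sum>m<K. v m q) + R q)"
    by (simp only: split)
  also have "\<dots> = (\<lambda>q. (\<Sum>m<K. T (v m) q) + T R q)"
  proof -
    have "T (\<lambda>q. (\<Sum>m<K. v m q) + R q) = (\<lambda>q. T (\<lambda>q. \<Sum>m<K. v m q) q + T R q)"
      by (rule linear_add[OF T(1)])
    then show ?thesis by (simp only: linear_sum[OF T(1)])
  qed
  finally have "mps_coeff (T (\<lambda>q. formal_sum (\<lambda>m. v m q)) q) M = (\<Sum>m<K. mps_coeff (T (v m) q) M)"
    using R by (auto simp: plus_mps.rep_eq mps_coeff_sum order_ge_def K_def)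
  also have "\<dots> = mps_coeff (formal_sum (\<lambda>m. T (v m) q)) M"
    unfolding mps_coeff_formal_sum
    by (rule Sum_any.expand_superset[symmetric]) (use Tv in \<open>force simp: order_ge_def K_def\<close>)+
  finally show "mps_coeff (T (\<lambda>q. formal_sum (\<lambda>m. v m q)) q) M = mps_coeff (formal_sum (\<lambda>m. T (v m) q)) M" .
qed

lemma exp_op_defined_raises:
  assumes "raises 1 T" "\<And>q. order_ge 0 (v q)"
  shows "exp_op_defined T v" "order_ge (int n) ((T ^^ n) v q)"
proof -
  have *: "order_ge (int n) ((T ^^ n) v q)" for n q
    using raises_power[OF assms(1), of n] assms(2) unfolding raises_def by fastforce
  then show "order_ge (int n) ((T ^^ n) v q)" .
  show "exp_op_defined T v"
    unfolding exp_op_defined_def formally_summable_def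
  proof (intro allI)
    fix q M
    show "finite {n. mps_coeff (exp_op_term T v q n) M \<noteq> 0}"
      by (rule finite_subset[of _ "{..weight M}"])
         (use * in \<open>force simp: exp_op_term_def order_ge_def scaleR_mps.rep_eq\<close>)+
  qed
qed

section \<open>Lagrange inversion for affine functions of two variables\<close>

definition coef :: "nat \<Rightarrow> nat \<Rightarrow> wser \<Rightarrow> xyser" where
  "coef m n F = mps_coeff F (replicate_mset m W1 + replicate_mset n W2)"

text \<open>
  Without defect (\<open>s = 0\<close>) the infinite sums of Lagrange inversion converge; each factor
  \<open>w1\<close> or \<open>w2\<close> costs one.
\<close>

definition adapted :: "nat \<Rightarrow> wser \<Rightarrow> bool" where
  "adapted s F \<longleftrightarrow> (\<forall>M. order_ge (int (size M) - int s) (mps_coeff F M))"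

definition w_degree_le :: "nat \<Rightarrow> wser \<Rightarrow> bool" where
  "w_degree_le d F \<longleftrightarrow> (\<forall>M. size M > d \<longrightarrow> mps_coeff F M = 0)"

lemma wvar_multiset: "(M :: wvar multiset) = replicate_mset (count M W1) W1 + replicate_mset (count M W2) W2"
proof (rule multiset_eqI)
  fix v show "count M v = count (replicate_mset (count M W1) W1 + replicate_mset (count M W2) W2) v"
    by (cases v) auto
qed

lemma finite_wvar_multisets: "finite {M :: wvar multiset. size M \<le> n}"
proof (rule finite_subset)
  show "{M :: wvar multiset. size M \<le> n} \<subseteq>
      (\<lambda>(a, b). replicate_mset a W1 + replicate_mset b W2) ` ({..n} \<times> {..n})"
  proof
    fix M :: "wvar multiset" assume "M \<in> {M. size M \<le> n}"
    then have "count M W1 \<le> n" "count M W2 \<le> n" using count_le_size[of M] by (auto intro: order.trans)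
    then show "M \<in> (\<lambda>(a, b). replicate_mset a W1 + replicate_mset b W2) ` ({..n} \<times> {..n})"
      by (intro image_eqI[of _ _ "(count M W1, count M W2)"]) (use wvar_multiset[of M] in auto)
  qed
qed auto

lemma mps_coeff_eq_if_order_ge:
  "order_ge (int (Suc (weight M))) (f - g) \<Longrightarrow> mps_coeff f M = mps_coeff g M"
  by (auto simp: order_ge_def minus_mps.rep_eq dest!: spec[of _ M])

lemma coef_simps:
  "coef m n (F + G) = coef m n F + coef m n G"
  "coef m n (F - G) = coef m n F - coef m n G"
  "coef m n (mps_const a * F) = a * coef m n F"
  by (simp_all add: coef_def plus_mps.rep_eq minus_mps.rep_eq mps_coeff_const_times)

lemma coef_var [simp]:
  "coef 0 n (w1 * F) = 0" "coef (Suc m) n (w1 * F) = coef m n F"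
  "coef m 0 (w2 * F) = 0" "coef m (Suc n) (w2 * F) = coef m n F"
  by (auto simp: coef_def mps_coeff_var_times)

lemma coef_degree: "w_degree_le d F \<Longrightarrow> d < m + n \<Longrightarrow> coef m n F = 0"
  by (simp add: w_degree_le_def coef_def)

lemma order_ge_coef: "adapted s F \<Longrightarrow> order_ge (int (m + n) - int s) (coef m n F)"
  unfolding adapted_def coef_def by (metis size_replicate_mset size_union)

lemma adapted_times:
  assumes "adapted s F" "adapted t G"
  shows "adapted (s + t) (F * G)"
  unfolding adapted_def mps_coeff_times
proof (intro allI order_ge_sum)
  fix M :: "wvar multiset" and p assume "p \<in> {(A, C). A + C = M}"
  then obtain A C where p: "p = (A, C)" "A + C = M" by auto
  have "order_ge ((int (size A) - int s) + (int (size C) - int t)) (mps_coeff F A * mps_coeff G C)"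
    using assms by (intro order_ge_times) (auto simp: adapted_def)
  then show "order_ge (int (size M) - int (s + t)) (case p of (A, C) \<Rightarrow> mps_coeff F A * mps_coeff G C)"
    unfolding p(1) using p(2)[symmetric] by (simp add: algebra_simps)
qed

lemma adapted_add: "adapted s F \<Longrightarrow> adapted s G \<Longrightarrow> adapted s (F + G)"
  by (simp add: adapted_def plus_mps.rep_eq order_ge_add)

lemma adapted_const: "adapted 0 (mps_const a)"
  by (simp add: adapted_def mps_const.rep_eq order_ge_nonneg)

lemma adapted_const_var: "order_ge 1 a \<Longrightarrow> adapted 0 (mps_const a * mps_var v)"
  by (simp add: adapted_def mps_coeff_const_times mps_var.rep_eq)

lemma adapted_power: "adapted 0 F \<Longrightarrow> adapted 0 (F ^ n)"
  by (induction n) (auto simp: adapted_const[of 1, simplified] dest: adapted_times)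

lemma w_degree_le_times:
  assumes "w_degree_le d F" "w_degree_le e G"
  shows "w_degree_le (d + e) (F * G)"
  unfolding w_degree_le_def mps_coeff_times
proof (intro allI impI sum.neutral ballI)
  fix M :: "wvar multiset" and p assume M: "size M > d + e" and "p \<in> {(A, C). A + C = M}"
  then obtain A C where p: "p = (A, C)" "A + C = M" by auto
  have "size A > d \<or> size C > e" using M p(2) by auto
  then show "(case p of (A, C) \<Rightarrow> mps_coeff F A * mps_coeff G C) = 0"
    using assms by (auto simp: p w_degree_le_def)
qed

lemma w_degree_le_add: "w_degree_le d F \<Longrightarrow> w_degree_le d G \<Longrightarrow> w_degree_le d (F + G)"
  by (simp add: w_degree_le_def plus_mps.rep_eq)

lemma w_degree_le_const: "w_degree_le d (mps_const a)"
  by (auto simp: w_degree_le_def mps_const.rep_eq)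

lemma w_degree_le_const_var: "w_degree_le 1 (mps_const a * mps_var v)"
  by (auto simp: w_degree_le_def mps_coeff_const_times mps_var.rep_eq)

lemma w_degree_le_power: "w_degree_le 1 F \<Longrightarrow> w_degree_le n (F ^ n)"
  by (induction n) (auto simp: w_degree_le_const[of 0 1, simplified] dest: w_degree_le_times)

text \<open>To be used with -c G_i and -d G_j, where \<open>invD\<close> inverts D. The positive
  order of the coefficients of w makes the powers of \<open>g1\<close> and \<open>g2\<close>
  adapted.\<close>

locale affine_pair =
  fixes \<alpha>1 \<alpha>2 a11 a12 a21 a22 invD :: xyser
  assumes a: "order_ge 1 a11" "order_ge 1 a12" "order_ge 1 a21" "order_ge 1 a22"
    and invD: "((1 - a11) * (1 - a22) - a12 * a21) * invD = 1"
begin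

definition g1 :: wser where "g1 = mps_const \<alpha>1 + mps_const a11 * w1 + mps_const a12 * w2"
definition g2 :: wser where "g2 = mps_const \<alpha>2 + mps_const a21 * w1 + mps_const a22 * w2"

text \<open>Cramer's rule for w1 = g1, w2 = g2.\<close>

definition sol :: "wvar \<Rightarrow> xyser" where
  "sol v = (case v of W1 \<Rightarrow> ((1 - a22) * \<alpha>1 + a12 * \<alpha>2) * invD
                    | W2 \<Rightarrow> ((1 - a11) * \<alpha>2 + a21 * \<alpha>1) * invD)"

lemma adapted_g: "adapted 0 g1" "adapted 0 g2"
  unfolding g1_def g2_def by (intro adapted_add adapted_const adapted_const_var a)+

lemma w_degree_g: "w_degree_le 1 g1" "w_degree_le 1 g2"
  unfolding g1_def g2_def
  by (intro w_degree_le_add w_degree_le_const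
      w_degree_le_const_var)+

text \<open>
  Up to weight \<open>K\<close>, the functional \<open>S K\<close> does not distinguish \<open>w1\<close> from \<open>g1\<close> and \<open>w2\<close> from \<open>g2\<close>;
  hence it is the evaluation at the solution of \<open>w1 = g1\<close>, \<open>w2 = g2\<close>, times \<open>S K 1\<close>.
\<close>

definition S :: "nat \<Rightarrow> wser \<Rightarrow> xyser" where
  "S K F = (\<Sum>n<Suc K. \<Sum>m<Suc K. coef m n (g1 ^ m * g2 ^ n * F))"

lemma S_add: "S K (F + G) = S K F + S K G"
  by (simp only: S_def distrib_left coef_simps sum.distrib)

lemma S_const: "S K (mps_const c * F) = c * S K F"
  by (simp only: S_def mult.left_commute[of _ "mps_const c"] coef_simps sum_distrib_left)

lemma order_ge_term: "adapted s F \<Longrightarrow> order_ge (int (m + n) - int s) (coef m n (g1 ^ m' * g2 ^ n' * F))"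
  using adapted_times[OF adapted_times[OF adapted_power[OF adapted_g(1), of m'] adapted_power[OF adapted_g(2), of n']], of s F]
  by (intro order_ge_coef) simp

text \<open>Telescoping: extracting one more w1 matches one more factor \<open>g1\<close>, so the
  two sums differ only in the row m = K, which has high order.\<close>

lemma S_w1:
  assumes F: "adapted s F"
  shows "order_ge (int K - int s) (S K (w1 * F) - S K (g1 * F))"
proof -
  have "S K (w1 * F) = (\<Sum>n<Suc K. \<Sum>m<K. coef m n (g1 ^ Suc m * g2 ^ n * F))"
    unfolding S_def mult.left_commute[of _ w1] by (subst sum.lessThan_Suc_shift) simp
  moreover have "S K (g1 * F) = (\<Sum>n<Suc K. (\<Sum>m<K. coef m n (g1 ^ Suc m * g2 ^ n * F)) + coef K n (g1 ^ Suc K * g2 ^ n * F))"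
    unfolding S_def by (simp only: sum.lessThan_Suc[of _ K] power_Suc mult_ac)
  ultimately have "S K (w1 * F) - S K (g1 * F) = - (\<Sum>n<Suc K. coef K n (g1 ^ Suc K * g2 ^ n * F))"
    by (simp only: sum.distrib) simp
  then show ?thesis
    by (auto simp del: power_Suc sum.lessThan_Suc intro!: order_ge_uminus order_ge_sum order_ge_mono[OF order_ge_term[OF F]])
qed

lemma S_w2:
  assumes F: "adapted s F"
  shows "order_ge (int K - int s) (S K (w2 * F) - S K (g2 * F))"
proof -
  have "S K (w2 * F) = (\<Sum>n<K. \<Sum>m<Suc K. coef m n (g1 ^ m * g2 ^ Suc n * F))"
    unfolding S_def mult.left_commute[of _ w2] by (subst sum.lessThan_Suc_shift) simp
  moreover have "S K (g2 * F) = (\<Sum>n<K. \<Sum>m<Suc K. coef m n (g1 ^ m * g2 ^ Suc n * F)) + (\<Sum>m<Suc K. coef m K (g1 ^ m * g2 ^ Suc K * F))"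
    unfolding S_def by (simp only: sum.lessThan_Suc[of _ K] power_Suc mult_ac)
  ultimately have "S K (w2 * F) - S K (g2 * F) = - (\<Sum>m<Suc K. coef m K (g1 ^ m * g2 ^ Suc K * F))"
    by (simp only: ) simp
  then show ?thesis
    by (auto simp del: power_Suc sum.lessThan_Suc intro!: order_ge_uminus order_ge_sum order_ge_mono[OF order_ge_term[OF F]])
qed

text \<open>\<open>S_w1\<close> and \<open>S_w2\<close> form a linear system for the values on w1 F
  and w2 F with errors of high order, solved by the adjugate matrix and \<open>invD\<close>.\<close>

lemma S_var:
  assumes F: "adapted s F"
  shows "order_ge (int K - int s) (S K (mps_var v * F) - sol v * S K F)"
proof -
  define x where "x = S K (w1 * F)"
  define y where "y = S K (w2 * F)"
  define z where "z = S K F"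
  define e1 where "e1 = x - (\<alpha>1 * z + a11 * x + a12 * y)"
  define e2 where "e2 = y - (\<alpha>2 * z + a21 * x + a22 * y)"
  have "S K (g1 * F) = \<alpha>1 * z + a11 * x + a12 * y" "S K (g2 * F) = \<alpha>2 * z + a21 * x + a22 * y"
    unfolding g1_def g2_def x_def y_def z_def by (simp_all only: distrib_right S_add mult.assoc S_const)
  then have e: "order_ge (int K - int s) e1" "order_ge (int K - int s) e2"
    using S_w1[OF F, of K] S_w2[OF F, of K] by (simp_all add: e1_def e2_def x_def y_def)
  let ?D = "(1 - a11) * (1 - a22) - a12 * a21"
  show ?thesis
  proof (cases v)
    case W1
    have "x - sol W1 * z = (?D * invD) * x - sol W1 * z" by (simp add: invD)
    also have "\<dots> = invD * ((1 - a22) * e1 + a12 * e2)"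
      by (simp add: e1_def e2_def sol_def algebra_simps)
    finally show ?thesis
      using e by (auto simp: W1 x_def z_def intro: order_ge_times_any order_ge_add)
  next
    case W2
    have "y - sol W2 * z = (?D * invD) * y - sol W2 * z" by (simp add: invD)
    also have "\<dots> = invD * ((1 - a11) * e2 + a21 * e1)"
      by (simp add: e1_def e2_def sol_def algebra_simps)
    finally show ?thesis
      using e by (auto simp: W2 y_def z_def intro: order_ge_times_any order_ge_add)
  qed
qed

section \<open>Evaluation on monomials\<close>

definition wmon :: "wvar multiset \<Rightarrow> wser" where "wmon M = (\<Prod>v\<in>#M. mps_var v)"

lemma wmon_simps: "wmon {#} = 1" "wmon (add_mset v M) = mps_var v * wmon M"
  by (simp_all add: wmon_def)

lemma mps_coeff_wmon: "mps_coeff (wmon M) A = (if A = M then 1 else 0)"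
proof (induction M arbitrary: A)
  case (add v M)
  show ?case by (auto simp: wmon_simps mps_coeff_var_times add)
qed (simp add: wmon_simps one_mps.rep_eq)

lemma adapted_wmon: "adapted (size M) (wmon M)"
  by (simp add: adapted_def mps_coeff_wmon order_ge_nonneg)

lemma S_wmon: "order_ge (int K - int (size M)) (S K (wmon M) - (\<Prod>v\<in>#M. sol v) * S K 1)"
proof (induction M)
  case (add v M)
  have "order_ge (int K - int (size M)) (sol v * (S K (wmon M) - (\<Prod>v\<in>#M. sol v) * S K 1))"
    by (rule order_ge_times_any[OF add])
  then have "order_ge (int K - int (size M))
     ((S K (mps_var v * wmon M) - sol v * S K (wmon M)) + sol v * (S K (wmon M) - (\<Prod>v\<in>#M. sol v) * S K 1))"
    by (intro order_ge_add S_var adapted_wmon)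
  then have "order_ge (int K - int (size M)) (S K (wmon (add_mset v M)) - (\<Prod>v\<in>#add_mset v M. sol v) * S K 1)"
    by (simp add: wmon_simps algebra_simps)
  then show ?case by (rule order_ge_mono) simp
qed (simp add: wmon_simps)

text \<open>
  The diagonal coefficients satisfy the recurrence of MacMahon's master theorem, because
  \<open>(g1 - a11 w1) (g2 - a22 w2)\<close> has the leading term \<open>a12 a21 w1 w2\<close>.
\<close>

lemma S_1: "order_ge (int K) (S K 1 - invD)"
proof -
  define h where "h m n = coef m n (g1 ^ m * g2 ^ n)" for m n
  let ?det = "a11 * a22 - a12 * a21"
  have h0: "h 0 0 = 1" by (simp add: h_def coef_def one_mps.rep_eq)
  have h1: "h (Suc m) 0 = a11 * h m 0" for m
  proof -
    have "g1 ^ Suc m = mps_const \<alpha>1 * g1 ^ m + mps_const a11 * (w1 * g1 ^ m) + mps_const a12 * (w2 * g1 ^ m)"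
      by (simp add: g1_def algebra_simps)
    moreover have "coef (Suc m) 0 (g1 ^ m) = 0"
      by (rule coef_degree[OF w_degree_le_power[OF w_degree_g(1)]]) simp
    ultimately show ?thesis by (simp add: h_def coef_simps)
  qed
  have h2: "h 0 (Suc n) = a22 * h 0 n" for n
  proof -
    have "g2 ^ Suc n = mps_const \<alpha>2 * g2 ^ n + mps_const a21 * (w1 * g2 ^ n) + mps_const a22 * (w2 * g2 ^ n)"
      by (simp add: g2_def algebra_simps)
    moreover have "coef 0 (Suc n) (g2 ^ n) = 0"
      by (rule coef_degree[OF w_degree_le_power[OF w_degree_g(2)]]) simp
    ultimately show ?thesis by (simp add: h_def coef_simps)
  qed
  have h3: "h (Suc m) (Suc n) = a11 * h m (Suc n) + a22 * h (Suc m) n - ?det * h m n" for m n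
  proof -
    define Q where "Q = g1 ^ m * g2 ^ n"
    \<comment> \<open>The part of degree at most one of (g1 - a11 w1) (g2 - a22 w2). Times
      \<open>Q\<close> it has degree at most m + n + 1 and misses the exponent (m + 1, n +
      1).\<close>
    define R where "R = mps_const (\<alpha>1 * \<alpha>2) + mps_const (\<alpha>1 * a21) * w1 + mps_const (\<alpha>2 * a12) * w2"
    have "w_degree_le (1 + (m + n)) (R * Q)"
      unfolding R_def Q_def
      by (intro w_degree_le_times w_degree_le_power w_degree_g w_degree_le_add w_degree_le_const
          w_degree_le_const_var)
    then have R: "coef (Suc m) (Suc n) (R * Q) = 0" by (rule coef_degree) simp
    have "g1 ^ Suc m * g2 ^ Suc n = mps_const a11 * (w1 * (g1 ^ m * g2 ^ Suc n))
        + mps_const a22 * (w2 * (g1 ^ Suc m * g2 ^ n)) - mps_const ?det * (w1 * (w2 * Q)) + R * Q"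
    proof -
      have det: "mps_const ?det = mps_const a11 * mps_const a22 - mps_const a12 * (mps_const a21 :: wser)"
        by (simp add: mps_const_times)
      have "g1 * g2 = mps_const a11 * (w1 * g2) + mps_const a22 * (w2 * g1) - mps_const ?det * (w1 * w2) + R"
        unfolding g1_def g2_def R_def det mps_const_times[symmetric] by (simp add: algebra_simps)
      then have "g1 * g2 * Q = (mps_const a11 * (w1 * g2) + mps_const a22 * (w2 * g1) - mps_const ?det * (w1 * w2) + R) * Q"
        by simp
      moreover have "g1 * g2 * Q = g1 ^ Suc m * g2 ^ Suc n"
        by (simp add: Q_def mult_ac)
      moreover have "(mps_const a11 * (w1 * g2) + mps_const a22 * (w2 * g1) - mps_const ?det * (w1 * w2) + R) * Q
        = mps_const a11 * (w1 * (g2 * Q)) + mps_const a22 * (w2 * (g1 * Q)) - mps_const ?det * (w1 * (w2 * Q)) + R * Q"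
        by (simp only: distrib_right left_diff_distrib mult.assoc)
      moreover have "g2 * Q = g1 ^ m * g2 ^ Suc n" "g1 * Q = g1 ^ Suc m * g2 ^ n"
        by (simp_all add: Q_def mult_ac)
      ultimately show ?thesis by (simp only:)
    qed
    then show ?thesis
      unfolding h_def by (simp only: coef_simps coef_var R) (simp add: Q_def)
  qed
  have ord: "order_ge (int (m + n)) (h m n)" for m n
    using order_ge_term[OF adapted_const[of 1], of m n m n] by (simp add: h_def)
  \<comment> \<open>\<open>X\<close>, \<open>Y\<close>, \<open>Z\<close> are \<open>T\<close>
    without the last m, the last n, or both, so all four agree up to weight \<open>K\<close>. The
    recurrence expresses \<open>T\<close> through the other three, which gives D T = 1 up to that
    weight.\<close>
  define T where "T = (\<Sum>n<Suc K. \<Sum>m<Suc K. h m n)"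
  define X where "X = (\<Sum>n<Suc K. \<Sum>m<K. h m n)"
  define Y where "Y = (\<Sum>n<K. \<Sum>m<Suc K. h m n)"
  define Z where "Z = (\<Sum>n<K. \<Sum>m<K. h m n)"
  have X: "X = (\<Sum>m<K. h m 0) + (\<Sum>n<K. \<Sum>m<K. h m (Suc n))"
    unfolding X_def by (rule sum.lessThan_Suc_shift)
  have Y: "Y = (\<Sum>n<K. h 0 n) + (\<Sum>n<K. \<Sum>m<K. h (Suc m) n)"
    unfolding Y_def by (simp only: sum.lessThan_Suc_shift[of _ K] sum.distrib)
  have "T = h 0 0 + (\<Sum>m<K. h (Suc m) 0) + ((\<Sum>n<K. h 0 (Suc n)) + (\<Sum>n<K. \<Sum>m<K. h (Suc m) (Suc n)))"
    unfolding T_def by (simp only: sum.lessThan_Suc_shift[of _ K] sum.distrib) (simp add: algebra_simps)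
  also have "\<dots> = 1 + a11 * X + a22 * Y - ?det * Z"
    unfolding X Y Z_def h0 h1 h2 h3
    by (simp add: sum.distrib sum_subtractf sum_distrib_left algebra_simps)
  finally have T: "T = 1 + a11 * X + a22 * Y - ?det * Z" .
  have 1: "order_ge (int K) (T - X)"
  proof -
    have "T - X = (\<Sum>n<Suc K. h K n)"
      unfolding T_def X_def by (simp only: sum.lessThan_Suc[of _ K] sum.distrib) simp
    then show ?thesis by (auto simp del: sum.lessThan_Suc intro!: order_ge_sum order_ge_mono[OF ord])
  qed
  have 2: "order_ge (int K) (T - Y)"
  proof -
    have "T - Y = (\<Sum>m<Suc K. h m K)"
      unfolding T_def Y_def by (simp add: sum.lessThan_Suc[of _ K] sum.distrib)
    then show ?thesis by (auto simp del: sum.lessThan_Suc intro!: order_ge_sum order_ge_mono[OF ord])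
  qed
  have 3: "order_ge (int K) (T - Z)"
  proof -
    have "Y - Z = (\<Sum>n<K. h K n)"
      unfolding Z_def Y_def by (simp add: sum.lessThan_Suc[of _ K] sum.distrib)
    then have "order_ge (int K) (Y - Z)" by (auto intro!: order_ge_sum order_ge_mono[OF ord])
    then have "order_ge (int K) ((T - Y) + (Y - Z))" by (intro order_ge_add 2)
    then show ?thesis by simp
  qed
  let ?D = "(1 - a11) * (1 - a22) - a12 * a21"
  have "T - invD = invD * (?D * T - 1)"
  proof -
    have "invD * (?D * T - 1) = (?D * invD) * T - invD" by (simp add: algebra_simps)
    then show ?thesis by (simp add: invD)
  qed
  also have "?D * T - 1 = T - 1 - a11 * T - a22 * T + ?det * T" by (simp add: algebra_simps)
  also have "\<dots> = ?det * (T - Z) - a11 * (T - X) - a22 * (T - Y)"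
    by (subst (1) T) (simp add: algebra_simps)
  finally have "order_ge (int K) (T - invD)"
    using 1 2 3 by (auto intro!: order_ge_times_any order_ge_diff)
  moreover have "S K 1 = T" by (simp only: S_def T_def h_def mult_1_right)
  ultimately show ?thesis by simp
qed

lemma S_adapted:
  assumes f: "adapted 0 f"
  shows "order_ge (int K) (S K f - invD * (\<Sum>M | size M \<le> 2 * K. subst_term sol f M))"
proof -
  \<comment> \<open>Coefficients at exponents m, n \<le> K see no monomial of f of size above 2
    K.\<close>
  define I where "I = {M :: wvar multiset. size M \<le> 2 * K}"
  have I: "finite I" unfolding I_def by (rule finite_wvar_multisets)
  define t where "t = (\<Sum>M\<in>I. mps_const (mps_coeff f M) * wmon M)"
  have t: "mps_coeff t A = (if A \<in> I then mps_coeff f A else 0)" for A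
  proof -
    have "mps_coeff t A = (\<Sum>M\<in>I. if A = M then mps_coeff f A else 0)"
      unfolding t_def mps_coeff_sum by (rule sum.cong) (auto simp: mps_coeff_const_times mps_coeff_wmon)
    then show ?thesis using I by simp
  qed
  have "S K f = S K t"
    unfolding S_def coef_def
  proof (intro sum.cong refl mps_coeff_times_cong)
    fix m n A assume *: "n \<in> {..<Suc K}" "m \<in> {..<Suc K}" "A \<subseteq># replicate_mset m W1 + replicate_mset n W2"
    have "size A \<le> m + n" using size_mset_mono[OF *(3)] by simp
    then show "mps_coeff f A = mps_coeff t A" using * by (simp add: t I_def)
  qed
  also have "S K t = (\<Sum>M\<in>I. mps_coeff f M * S K (wmon M))"
    unfolding t_def using I by induction (auto simp: S_add S_const S_const[of K 0 0, simplified])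
  finally have "S K f - invD * (\<Sum>M\<in>I. subst_term sol f M) =
      (\<Sum>M\<in>I. mps_coeff f M * (S K (wmon M) - (\<Prod>v\<in>#M. sol v) * S K 1))
      + (\<Sum>M\<in>I. subst_term sol f M) * (S K 1 - invD)"
    by (simp add: subst_term_def algebra_simps sum.distrib sum_subtractf sum_distrib_left sum_distrib_right)
  \<comment> \<open>The orders lost in \<open>S_wmon\<close> are regained from the coefficient of
    the adapted series f.\<close>
  moreover have "order_ge (int (size M) + (int K - int (size M)))
      (mps_coeff f M * (S K (wmon M) - (\<Prod>v\<in>#M. sol v) * S K 1))" for M
    using f by (intro order_ge_times S_wmon) (simp add: adapted_def)
  ultimately show ?thesis
    by (auto simp: I_def intro!: order_ge_add order_ge_sum order_ge_times_any[OF S_1])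
qed

lemma subst_term_order: 
  assumes "adapted 0 f"
  shows "order_ge (int (size M)) (subst_term s f M)"
  using assms unfolding subst_term_def adapted_def
  by (subst mult.commute) (auto intro: order_ge_times_any)

lemma summable_subst:
  assumes f: "adapted 0 f"
  shows "formally_summable (subst_term s f)"
  unfolding formally_summable_def
proof
  fix M
  show "finite {A. mps_coeff (subst_term s f A) M \<noteq> 0}"
    by (rule finite_subset[OF _ finite_wvar_multisets[of "weight M"]])
       (use subst_term_order[OF f] in \<open>force simp: order_ge_def\<close>)
qed

text \<open>Good's form of Lagrange inversion, \<open>invD\<close> being the reciprocal Jacobian
  determinant of w - g. A coefficient is read off from \<open>S K\<close> with \<open>K\<close> just
  above its weight.\<close>

theorem lagrange_good:
  assumes f: "adapted 0 f"
  shows "formal_sum (\<lambda>n. formal_sum (\<lambda>m. coef m n (g1 ^ m * g2 ^ n * f))) = invD * subst sol f"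
proof (rule mps_eqI)
  fix M
  define K where "K = Suc (weight M)"
  have ord: "order_ge (int (m + n)) (coef m n (g1 ^ m * g2 ^ n * f))" for m n
    using order_ge_term[OF f, of m n m n] by simp
  have inner: "mps_coeff (formal_sum (\<lambda>m. coef m n (g1 ^ m * g2 ^ n * f))) M =
     (\<Sum>m<Suc K. mps_coeff (coef m n (g1 ^ m * g2 ^ n * f)) M)" for n
    unfolding mps_coeff_formal_sum
    by (rule Sum_any.expand_superset) (use ord in \<open>force simp: order_ge_def K_def\<close>)+
  have "mps_coeff (formal_sum (\<lambda>n. formal_sum (\<lambda>m. coef m n (g1 ^ m * g2 ^ n * f)))) M =
     (\<Sum>n<Suc K. mps_coeff (formal_sum (\<lambda>m. coef m n (g1 ^ m * g2 ^ n * f))) M)"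
    unfolding mps_coeff_formal_sum[of "\<lambda>n. formal_sum (\<lambda>m. coef m n (g1 ^ m * g2 ^ n * f))"]
  proof (rule Sum_any.expand_superset)
    show "{n. mps_coeff (formal_sum (\<lambda>m. coef m n (g1 ^ m * g2 ^ n * f))) M \<noteq> 0} \<subseteq> {..<Suc K}"
    proof
      fix n assume "n \<in> {n. mps_coeff (formal_sum (\<lambda>m. coef m n (g1 ^ m * g2 ^ n * f))) M \<noteq> 0}"
      then have "(\<Sum>m<Suc K. mps_coeff (coef m n (g1 ^ m * g2 ^ n * f)) M) \<noteq> 0"
        by (simp only: inner mem_Collect_eq not_False_eq_True)
      then obtain m where "mps_coeff (coef m n (g1 ^ m * g2 ^ n * f)) M \<noteq> 0"
        by (rule sum.not_neutral_contains_not_neutral)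
      then show "n \<in> {..<Suc K}" using ord[of m n] by (force simp: order_ge_def K_def)
    qed
  qed simp
  also have "\<dots> = mps_coeff (S K f) M"
    unfolding S_def mps_coeff_sum inner ..
  also have "\<dots> = mps_coeff (invD * (\<Sum>A | size A \<le> 2 * K. subst_term sol f A)) M"
    by (rule mps_coeff_eq_if_order_ge) (use S_adapted[OF f, of K] in \<open>simp only: K_def\<close>)
  also have "\<dots> = mps_coeff (invD * subst sol f) M"
  proof -
    have "order_ge (int K) (subst sol f - (\<Sum>A | size A \<le> 2 * K. subst_term sol f A))"
      unfolding order_ge_def
    proof (intro allI impI, rule ccontr)
      fix C assume C: "mps_coeff (subst sol f - (\<Sum>A | size A \<le> 2 * K. subst_term sol f A)) C \<noteq> 0"
        "\<not> int K \<le> int (weight C)"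
      have "mps_coeff (subst sol f) C = (\<Sum>A | size A \<le> 2 * K. mps_coeff (subst_term sol f A) C)"
        unfolding subst_def mps_coeff_formal_sum
        by (rule Sum_any.expand_superset)
           (use subst_term_order[OF f, of _ sol] C(2) in \<open>force simp: order_ge_def finite_wvar_multisets\<close>)+
      then show False using C(1) by (simp add: minus_mps.rep_eq mps_coeff_sum)
    qed
    then have *: "order_ge (int K) (invD * (subst sol f - (\<Sum>A | size A \<le> 2 * K. subst_term sol f A)))"
      by (rule order_ge_times_any)
    show ?thesis
      by (rule mps_coeff_eq_if_order_ge[symmetric]) (use * in \<open>simp only: K_def right_diff_distrib\<close>)
  qed
  finally show "mps_coeff (formal_sum (\<lambda>n. formal_sum (\<lambda>m. coef m n (g1 ^ m * g2 ^ n * f)))) M =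
      mps_coeff (invD * subst sol f) M" .
qed

end

section \<open>Exponentials of vertex operators\<close>

lemma smul_smul: "smul a (smul b v) = smul (a * b) v"
  by (rule ext) (simp add: smul_def mult.assoc[symmetric] mps_const_times)

lemma scale_op_smul: "scale_op c T v = smul c (T v)"
  by (simp add: scale_op_def smul_def)

lemma scaleR_mps_const: "r *\<^sub>R (mps_const c * (x :: xyser)) = mps_const (of_real r * c) * x"
  by (rule mps_eqI, simp only: scaleR_mps.rep_eq mps_coeff_const_times) (simp add: scaleR_conv_of_real)

lemma formal_sum_scaleR:
  fixes F :: "'i \<Rightarrow> xyser"
  assumes "r \<noteq> 0"
  shows "formal_sum (\<lambda>i. r *\<^sub>R F i) = r *\<^sub>R formal_sum F"
  by (rule mps_eqI)
     (use assms in \<open>simp add: mps_coeff_formal_sum scaleR_mps.rep_eq Sum_any.expand_set scaleR_sum_right\<close>)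

text \<open>Common frame for (2), with H = 1 and \<rho> = 0, and (3), with \<open>Gser\<close> for H
  and \<rho> = 1; \<rho> counts the factors p^-1 contributed by one application.\<close>

locale tau_pair =
  fixes \<iota> :: "wvar \<Rightarrow> nat" and \<Phi> :: "wvar \<Rightarrow> fock \<Rightarrow> fock" and H :: "wvar \<Rightarrow> wser" and \<rho> :: nat
  assumes linear: "fock_linear (\<Phi> v)" and raises: "raises 1 (\<Phi> v)"
    and adm_H: "adm \<iota> \<rho> 0 (H v)"
    and vec: "adm \<iota> r 1 F \<Longrightarrow>
      \<Phi> v (vec r F M) = smul (- of_nat (Suc (count M v))) (vec (r + \<rho>) (H v * F) (add_mset v M))"
begin

definition tvec :: "nat \<Rightarrow> nat \<Rightarrow> fock" where
  "tvec m n = vec ((m + n) * \<rho>) (H W1 ^ m * H W2 ^ n * ftau \<iota>) (replicate_mset m W1 + replicate_mset n W2)"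

lemma adm_tvec: "adm \<iota> ((m + n) * \<rho>) 1 (H W1 ^ m * H W2 ^ n * ftau \<iota>)"
proof -
  have "adm \<iota> (m * \<rho> + n * \<rho> + 0) (0 + 0 + 1) (H W1 ^ m * H W2 ^ n * ftau \<iota>)"
    by (intro adm_times adm_power adm_H adm_ftau)
  then show ?thesis by (simp add: distrib_right)
qed

lemma step1: "\<Phi> W1 (tvec m n) = smul (- of_nat (Suc m)) (tvec (Suc m) n)"
  unfolding tvec_def vec[OF adm_tvec] by (simp add: mult_ac add_ac del: of_nat_Suc)

lemma step2: "\<Phi> W2 (tvec m n) = smul (- of_nat (Suc n)) (tvec m (Suc n))"
  unfolding tvec_def vec[OF adm_tvec] by (simp add: mult_ac add_ac del: of_nat_Suc)

text \<open>The factors count + 1 build up m!, which will cancel the 1/m! of the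
  exponential.\<close>

lemma power1: "(scale_op c (\<Phi> W1) ^^ m) vacuum = smul ((- c) ^ m * fact m) (tvec m 0)"
proof (induction m)
  case 0
  have "vacuum = tvec 0 0" by (simp add: tvec_def vacuum_vec[of \<iota>])
  then show ?case by (simp add: smul_def)
next
  case (Suc m)
  then show ?case
    by (simp add: scale_op_smul linear_smul[OF linear] step1 smul_smul fact_Suc algebra_simps)
qed

lemma power2: "(scale_op d (\<Phi> W2) ^^ n) (tvec m 0) = smul ((- d) ^ n * fact n) (tvec m n)"
proof (induction n)
  case (Suc n)
  then show ?case
    by (simp add: scale_op_smul linear_smul[OF linear] step2 smul_smul fact_Suc algebra_simps)
qed (simp add: smul_def)

lemma raises_scale: "raises 1 (scale_op c (\<Phi> v))"
  by (rule raises_scale_op[OF raises])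

lemma order_ge_vacuum: "order_ge 0 (v q)"
  by (rule order_ge_nonneg)

lemma defined: "exp_op_defined (scale_op c (\<Phi> W1)) vacuum"
  "exp_op_defined (scale_op d (\<Phi> W2)) (exp_op (scale_op c (\<Phi> W1)) vacuum)"
  by (rule exp_op_defined_raises[OF raises_scale order_ge_vacuum])+

text \<open>Each power of the outer operator passes through the infinite inner sum because it is
  linear and does not lower the order.\<close>

lemma exp_exp:
  "exp_op (scale_op d (\<Phi> W2)) (exp_op (scale_op c (\<Phi> W1)) vacuum) q =
   formal_sum (\<lambda>n. formal_sum (\<lambda>m. mps_const ((- c) ^ m * (- d) ^ n) * tvec m n q))"
proof -
  define T where "T = scale_op d (\<Phi> W2)"
  define v where "v m q = exp_op_term (scale_op c (\<Phi> W1)) vacuum q m" for m q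
  have v: "v m = smul ((- c) ^ m) (tvec m 0)" for m
    by (rule ext) (simp add: v_def exp_op_term_def power1 smul_def scaleR_mps_const)
  have "order_ge (int m) (v m q)" for m q
    unfolding v_def exp_op_term_def
    by (intro order_ge_scaleR exp_op_defined_raises(2)[OF raises_scale order_ge_vacuum])
  moreover have lin: "fock_linear (T ^^ n)" for n
    unfolding T_def by (intro linear_power linear_scale_op linear)
  moreover have "raises 0 (T ^^ n)" for n
    using raises_power[OF raises_scale, of n d W2] unfolding T_def by (rule raises_mono) simp
  ultimately have "(T ^^ n) (\<lambda>q. formal_sum (\<lambda>m. v m q)) = (\<lambda>q. formal_sum (\<lambda>m. (T ^^ n) (v m) q))" for n
    by (intro linear_formal_sum)
  then have *: "(T ^^ n) (exp_op (scale_op c (\<Phi> W1)) vacuum) q = formal_sum (\<lambda>m. (T ^^ n) (v m) q)" for n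
    by (simp add: exp_op_def v_def)
  have "(1 / fact n) *\<^sub>R formal_sum (\<lambda>m. (T ^^ n) (v m) q) =
     formal_sum (\<lambda>m. mps_const ((- c) ^ m * (- d) ^ n) * tvec m n q)" for n
  proof -
    have "(1 / fact n) *\<^sub>R (T ^^ n) (v m) q = mps_const ((- c) ^ m * (- d) ^ n) * tvec m n q" for m
      unfolding v linear_smul[OF lin] unfolding T_def power2 smul_smul
      by (simp add: smul_def scaleR_mps_const)
    then show ?thesis by (simp flip: formal_sum_scaleR)
  qed
  then have "exp_op_term T (exp_op (scale_op c (\<Phi> W1)) vacuum) q =
     (\<lambda>n. formal_sum (\<lambda>m. mps_const ((- c) ^ m * (- d) ^ n) * tvec m n q))"
    by (intro ext) (simp add: exp_op_term_def *)
  then show ?thesis by (simp add: exp_op_def[of T] flip: T_def)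
qed

end

lemma tau_pair_phistar: "tau_pair \<iota> (\<lambda>v. phistar (- int (\<iota> v))) (\<lambda>v. 1) 0"
  by unfold_locales (auto intro: linear_phistar raises_mono[OF raises_phistar] adm_1 simp: phistar_vec)

lemma tau_pair_phi_phistar:
  assumes "\<And>v. j v \<ge> 1"
  shows "tau_pair \<iota> (\<lambda>v. phi (- int (j v)) \<circ> phistar (- int (\<iota> v))) (\<lambda>v. Gser \<iota> (j v)) 1"
proof
  fix v r F M
  show "fock_linear (phi (- int (j v)) \<circ> phistar (- int (\<iota> v)))"
    by (intro linear_compose linear_phi linear_phistar)
  have "raises ((int (j v) - 1) + (int (\<iota> v) + 1)) (phi (- int (j v)) \<circ> phistar (- int (\<iota> v)))"
    by (intro raises_compose raises_phi raises_phistar)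
  then show "raises 1 (phi (- int (j v)) \<circ> phistar (- int (\<iota> v)))"
    by (rule raises_mono) (use assms[of v] in linarith)
  show "adm \<iota> 1 0 (Gser \<iota> (j v))" by (rule adm_Gser[OF assms])
  assume "adm \<iota> r 1 F"
  then show "(phi (- int (j v)) \<circ> phistar (- int (\<iota> v))) (vec r F M) =
      smul (- of_nat (Suc (count M v))) (vec (r + 1) (Gser \<iota> (j v) * F) (add_mset v M))"
    by (simp add: phistar_vec linear_smul[OF linear_phi] phi_vec del: of_nat_Suc)
qed

text \<open>The operator \<open>phistar\<close> carries the coefficient at \<open>M\<close> to a
  nonzero multiple of the one at \<open>add_mset v M\<close> and raises the order by at least one,
  so the claim follows by induction from the constant coefficient.\<close>

lemma adapted_ftau: "adapted 0 (ftau \<iota>)"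
proof -
  have "order_ge (int (size M)) (mps_coeff (ftau \<iota>) M)" for M
  proof (induction M)
    case (add v M)
    define g where "g = mps_coeff (ftau \<iota>) (add_mset v M)"
    have "order_ge (int (size M)) (vec 0 (ftau \<iota>) M q)" for q
      using add by (simp add: vec_def)
    then have "order_ge (int (size M) + 1) (phistar (- int (\<iota> v)) (vec 0 (ftau \<iota>) M) (int (size M) + 1))"
      using raises_mono[OF raises_phistar[of "\<iota> v"], of 1] unfolding raises_def by fastforce
    moreover have "phistar (- int (\<iota> v)) (vec 0 (ftau \<iota>) M) (int (size M) + 1) =
        mps_const (- of_nat (Suc (count M v))) * g"
      unfolding phistar_vec[OF adm_ftau] by (simp add: smul_def vec_def g_def del: of_nat_Suc)
    ultimately have "order_ge (int (size M) + 1) (mps_const (- of_nat (Suc (count M v))) * g)"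
      by simp
    moreover have "- of_nat (Suc (count M v)) \<noteq> (0 :: complex)"
      by (simp del: of_nat_Suc)
    ultimately have "order_ge (int (size M) + 1) g"
      by (simp add: order_ge_def mps_coeff_const_times del: of_nat_Suc)
    then show ?case by (simp add: g_def add.commute)
  qed (simp add: order_ge_nonneg)
  then show ?thesis by (simp add: adapted_def)
qed

section \<open>Comparison with the given series\<close>

abbreviation idx :: "nat \<Rightarrow> nat \<Rightarrow> wvar \<Rightarrow> nat" where
  "idx l k \<equiv> case_wvar l k"

lemma nthz_const_var: "nthz n (mps_const c * mps_var v) = mps_const (fls_nth c n) * mps_var v"
  by (rule mps_eqI) (simp add: mps_coeff_nthz mps_coeff_const_times mps_var.rep_eq)

lemma schur_poly_z_nth:
  "fps_nth (schur_poly_z l) j = (if 1 \<le> j \<and> j \<le> l + 1 then mps_const (Splus (l + 1 - j)) else 0)"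
proof -
  have "fps_nth (schur_poly_z l) j = (\<Sum>m\<le>l. if j = l + 1 - m then mps_const (Splus m) else 0)"
    unfolding schur_poly_z_def fps_sum_nth by (rule sum.cong) (auto simp: fps_X_power_nth)
  also have "\<dots> = (\<Sum>m\<in>(if 1 \<le> j \<and> j \<le> l + 1 then {l + 1 - j} else {}). mps_const (Splus m))"
    by (rule sum.mono_neutral_cong_right) (auto split: if_splits)
  finally show ?thesis by simp
qed

lemma zinv_fps_BL:
  "zinv_fps (BL (idx l k)) = schur_poly_z l * fps_const w1 + schur_poly_z k * fps_const w2"
proof (rule fps_ext)
  fix j
  have "mps_const (fls_nth (Pfls (idx l k) v) (- int j)) = fps_nth (schur_poly_z (idx l k v)) j" for v
    by (auto simp: Pfls_nth schur_poly_z_nth intro!: arg_cong[where f = "\<lambda>u. mps_const (Splus u)"])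
  from this[of W1] this[of W2]
  show "fps_nth (zinv_fps (BL (idx l k))) j =
    fps_nth (schur_poly_z l * fps_const w1 + schur_poly_z k * fps_const w2) j"
    by (simp add: BL_def PL_def nthz_const_var)
qed

lemma nthz_YL_times:
  assumes "zge (- int J) A"
  shows "nthz 0 (YL * A) = (\<Sum>j\<le>J. mps_const (of_nat j * xx j) * nthz (- int j) A)"
proof (rule mps_eqI)
  fix M
  let ?Y = "fps_to_fls (Abs_fps (\<lambda>k. of_nat k * xx k))"
  have "fls_nth (?Y * mps_coeff A M) 0 = (\<Sum>i=0..0 - - int J. fls_nth ?Y i * fls_nth (mps_coeff A M) (0 - i))"
    by (rule fls_times_nth_bounds) (use assms in \<open>auto simp: zge_alt\<close>)
  also have "\<dots> = (\<Sum>j\<le>J. (of_nat j * xx j) * fls_nth (mps_coeff A M) (- int j))"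
    by (rule sum.reindex_bij_witness[of _ int nat]) auto
  finally show "mps_coeff (nthz 0 (YL * A)) M = mps_coeff (\<Sum>j\<le>J. mps_const (of_nat j * xx j) * nthz (- int j) A) M"
    by (simp add: YL_def mps_coeff_nthz mps_coeff_const_times mps_coeff_sum)
qed

lemma zge_power: "zge (- int a) A \<Longrightarrow> zge (- int (n * a)) (A ^ n)"
proof (induction n)
  case (Suc n)
  then have "zge (- int a + - int (n * a)) (A * A ^ n)" by (intro zge_times) auto
  then show ?case by (simp add: algebra_simps)
qed (simp add: zge_0_1)

lemma zle_power': "zle (- 1) A \<Longrightarrow> zle (- int n) (A ^ n)"
proof (induction n)
  case (Suc n)
  then have "zle (- 1 + - int n) (A * A ^ n)" by (intro zle_times) auto
  then show ?case by (simp add: algebra_simps)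
qed (simp add: zle_0_1)

lemma p_ser_eq:
  assumes "n \<ge> 1"
  shows "p_ser k l n = nthz 0 (YL * BL (idx l k) ^ n)"
proof -
  define N where "N = n * (l + k + 2)"
  define A where "A = BL (idx l k) ^ n"
  have "zge (- int (n * (l + k + 1))) A"
    unfolding A_def by (rule zge_power, rule zge_mono[OF zge_BL]) simp
  then have "zge (- int N) A" by (rule zge_mono) (simp add: N_def algebra_simps)
  then have "nthz 0 (YL * A) = (\<Sum>j\<le>N. mps_const (of_nat j * xx j) * nthz (- int j) A)"
    by (rule nthz_YL_times)
  \<comment> \<open>Each factor B brings at least one power of 1/z, so j starts at n; with i = N - j
    this becomes the upper limit n (l + k + 1) in \<open>p_ser\<close>.\<close>
  also have "\<dots> = (\<Sum>j\<in>{n..N}. mps_const (of_nat j * xx j) * nthz (- int j) A)"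
    by (rule sum.mono_neutral_right) (use zle_power'[OF zle_BL[of "idx l k"], of n] in \<open>auto simp: A_def zle_def\<close>)
  also have "\<dots> = (\<Sum>i\<le>n * (l + k + 1). mps_const (of_nat (N - i) * xx (N - i)) * nthz (- int (N - i)) A)"
    by (rule sum.reindex_bij_witness[of _ "\<lambda>i. N - i" "\<lambda>j. N - j"]) (auto simp: N_def algebra_simps)
  also have "\<dots> = p_ser k l n"
    unfolding p_ser_def
  proof (rule sum.cong)
    fix i
    have "nthz (- int (N - i)) A = f_coeff k l n i"
      unfolding f_coeff_def A_def N_def zinv_fps_BL[symmetric]
      by (simp add: zinv_fps_power[OF zle_mono[OF zle_BL, of 0], symmetric])
    moreover have "mps_const (of_nat m :: xyser) = (of_nat m :: wser)" for m
      by (induction m) (auto simp flip: mps_const_simps(3))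
    ultimately show "mps_const (of_nat (N - i) * xx (N - i)) * nthz (- int (N - i)) A =
      f_coeff k l n i * of_nat (n * (l + k + 2) - i) * mps_const (xx (n * (l + k + 2) - i))"
      unfolding N_def by (simp only: mps_const_times[symmetric] mult_ac)
  qed simp
  finally show ?thesis by (simp add: A_def)
qed

lemma f_ser_eq: "f_ser k l = ftau (idx l k)"
proof -
  have "formal_sum (\<lambda>n. if n \<ge> 1 then (1 / of_nat n) *\<^sub>R p_ser k l n else 0) = logf (idx l k)"
  proof (rule mps_eqI)
    fix M
    let ?t = "\<lambda>n. mps_coeff (if n \<ge> 1 then (1 / of_nat n) *\<^sub>R p_ser k l n else 0) M"
    have "Sum_any ?t = sum ?t {size M}"
      using w_homogeneous_p_ser[of _ k l]
      by (intro Sum_any.expand_superset)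
         (auto simp: w_homogeneous_def zero_mps.rep_eq scaleR_mps.rep_eq split: if_splits)
    also have "\<dots> = (1 / real (size M)) *\<^sub>R mps_coeff (nthz 0 (YL * BL (idx l k) ^ size M)) M"
      by (cases "M = {#}") (auto simp: zero_mps.rep_eq scaleR_mps.rep_eq p_ser_eq Suc_le_eq nonempty_has_size)
    finally show "mps_coeff (formal_sum (\<lambda>n. if n \<ge> 1 then (1 / of_nat n) *\<^sub>R p_ser k l n else 0)) M =
       mps_coeff (logf (idx l k)) M"
      by (simp add: mps_coeff_formal_sum logf_def Abs_mps_inverse)
  qed
  then show ?thesis by (simp add: f_ser_def ftau_def)
qed

lemma exp_deriv_z_w_f_ser:
  "exp_deriv_z_w (f_ser k l) =
     (1 - schur_poly_z l * fps_const w1 - schur_poly_z k * fps_const w2) * fps_const (f_ser k l)"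
proof (rule fps_ext, rule mps_eqI)
  fix n M
  have *: "mps_map (dXY i) (ftau (idx l k)) = - (ftau (idx l k) * mps_map (dXY i) (logf (idx l k)))" if "i \<ge> 1" for i
    using adm_ftau[of "idx l k"] that by (simp add: adm_def)
  have "1 - schur_poly_z l * fps_const w1 - schur_poly_z k * fps_const w2 = zinv_fps (1 - BL (idx l k))"
  proof -
    have "zinv_fps (1 - BL (idx l k)) = 1 - zinv_fps (BL (idx l k))"
      by (rule fps_ext) (simp add: nthz_one)
    then show ?thesis by (simp add: zinv_fps_BL algebra_simps)
  qed
  moreover have "mps_coeff (fps_nth (exp_deriv_z_w (f_ser k l)) n) M
      = mps_coeff (nthz (- int n) (emb (ftau (idx l k)) * (1 - BL (idx l k)))) M"
    unfolding exp_deriv_z_w_def f_ser_eq using exp_deriv_z_1[OF *, of M n]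
    by (simp add: mps_map.rep_eq del: nthz_emb_times nthz_simps)
  ultimately show "mps_coeff (fps_nth (exp_deriv_z_w (f_ser k l)) n) M =
     mps_coeff (fps_nth ((1 - schur_poly_z l * fps_const w1 - schur_poly_z k * fps_const w2) * fps_const (f_ser k l)) n) M"
    by (simp add: f_ser_eq mult.commute)
qed

lemma exp_phistar_phistar:
  fixes k l :: nat and a b :: complex
  defines "A \<equiv> scale_op a (phistar (- int l))" and "B \<equiv> scale_op b (phistar (- int k))"
  shows "exp_op_defined A vacuum" "exp_op_defined B (exp_op A vacuum)"
    "exp_op B (exp_op A vacuum) = subst_p (- a) (- b) (f_ser k l)"
proof -
  interpret tau_pair "idx l k" "\<lambda>v. phistar (- int (idx l k v))" "\<lambda>v. 1" 0
    by (rule tau_pair_phistar)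
  show "exp_op_defined A vacuum" "exp_op_defined B (exp_op A vacuum)"
    using defined(1)[of a] defined(2)[of b a] by (simp_all add: A_def B_def)
  show "exp_op B (exp_op A vacuum) = subst_p (- a) (- b) (f_ser k l)"
  proof
    fix q
    let ?f = "\<lambda>m n. mps_coeff (f_ser k l) (replicate_mset m W1 + replicate_mset n W2)"
    let ?t = "\<lambda>m n. mps_const ((- a) ^ m * (- b) ^ n) * (if q = int (m + n) then ?f m n else 0)"
    have "exp_op B (exp_op A vacuum) q = formal_sum (\<lambda>n. formal_sum (\<lambda>m. ?t m n))"
      unfolding f_ser_eq using exp_exp[of b a q] by (simp add: A_def B_def tvec_def vec_def)
    also have "\<dots> = subst_p (- a) (- b) (f_ser k l) q"
    proof (cases "q < 0")
      case True
      then show ?thesis by (simp add: subst_p_def formal_sum_zero)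
    next
      case False
      then obtain Q where Q: "q = int Q" by (metis not_less nonneg_int_cases)
      \<comment> \<open>The power of p forces m + n = Q, so the double formal sum collapses to a
        finite one.\<close>
      have "formal_sum (\<lambda>m. ?t m n) = (if n \<le> Q then mps_const ((- a) ^ (Q - n) * (- b) ^ n) * ?f (Q - n) n else 0)" for n
        by (subst formal_sum_finite[of "if n \<le> Q then {Q - n} else {}"]) (auto simp: Q)
      then have "formal_sum (\<lambda>n. formal_sum (\<lambda>m. ?t m n)) = (\<Sum>n\<le>Q. mps_const ((- a) ^ (Q - n) * (- b) ^ n) * ?f (Q - n) n)"
        by (subst formal_sum_finite[of "{..Q}"]) auto
      also have "\<dots> = (\<Sum>(m, n) | m + n = Q. ?f m n * mps_const ((- a) ^ m * (- b) ^ n))"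
        by (rule sum.reindex_bij_witness[of _ snd "\<lambda>n. (Q - n, n)"]) (auto simp: mult.commute)
      finally show ?thesis by (simp add: subst_p_def Q)
    qed
    finally show "exp_op B (exp_op A vacuum) q = subst_p (- a) (- b) (f_ser k l) q" .
  qed
qed

text \<open>\<open>A_ser\<close> is a truncated convolution of the two exponentials: keeping only
  negative powers in \<open>Pfls\<close> is what stops its sum at m = t.\<close>

lemma fls_nth_Eminus_Pfls:
  assumes "i \<ge> 1"
  shows "fls_nth (Pfls \<iota> v * Eminus) (int i - 1) = A_ser i (\<iota> v)"
proof -
  have "fls_nth (Pfls \<iota> v * Eminus) (int i - 1) =
    (\<Sum>j=- int (\<iota> v) - 1..(int i - 1) - 0. fls_nth (Pfls \<iota> v) j * fls_nth Eminus (int i - 1 - j))"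
    by (rule fls_times_nth_bounds) (auto simp: Pfls_nth)
  also have "\<dots> = (\<Sum>j\<in>{- int (\<iota> v) - 1..< 0}. Splus (nat (j + int (\<iota> v) + 1)) * Sminus (nat (int i - 1 - j)))"
    by (rule sum.mono_neutral_cong_right) (use assms in \<open>auto simp: Pfls_nth\<close>)
  also have "\<dots> = A_ser i (\<iota> v)"
    unfolding A_ser_def
    by (rule sum.reindex_bij_witness[of _ "\<lambda>m. int m - int (\<iota> v) - 1" "\<lambda>j. nat (j + int (\<iota> v) + 1)"])
       (use assms in \<open>auto intro!: arg_cong2[where f = "(*)"] arg_cong[where f = Sminus]\<close>)
  finally show ?thesis .
qed

lemma Gser_eq:
  assumes "i \<ge> 1"
  shows "Gser (idx l k) i = mps_const (Sminus (i - 1)) - mps_const (A_ser i l) * w1 - mps_const (A_ser i k) * w2"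
proof -
  have "EminusL * (1 - BL (idx l k)) = EminusL - mps_const (Pfls (idx l k) W1 * Eminus) * mps_var W1 - mps_const (Pfls (idx l k) W2 * Eminus) * mps_var W2"
    by (simp add: BL_def PL_def EminusL_def mps_const_times[symmetric] algebra_simps)
  moreover have "nthz (int i - 1) EminusL = mps_const (Sminus (i - 1))"
    using assms by (simp add: EminusL_def nat_diff_distrib)
  ultimately show ?thesis
    using fls_nth_Eminus_Pfls[OF assms, of "idx l k"] by (simp add: Gser_def nthz_const_var)
qed

lemma order_ge_A_ser:
  assumes "i \<ge> 1"
  shows "order_ge 1 (A_ser i t)"
proof -
  have "homogeneous (i + t) (A_ser i t)"
    unfolding A_ser_def
  proof (rule homogeneous_sum)
    fix m assume "m \<in> {..t}"
    then have "m + (i + t - m) = i + t" by auto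
    moreover have "homogeneous (m + (i + t - m)) (Splus m * Sminus (i + t - m))"
      by (intro homogeneous_times homogeneous_schur homogeneous_arguments)
    ultimately show "homogeneous (i + t) (Splus m * Sminus (i + t - m))" by simp
  qed
  from order_ge_homogeneous[OF this] show ?thesis by (rule order_ge_mono) (use assms in simp)
qed

lemma exp_phi_phistar:
  fixes k l i j :: nat and c d :: complex
  assumes i: "i \<ge> 1" and j: "j \<ge> 1"
  defines "C \<equiv> scale_op c (phi (- int i) \<circ> phistar (- int l))"
    and "E \<equiv> scale_op d (phi (- int j) \<circ> phistar (- int k))"
  shows "exp_op_defined C vacuum" "exp_op_defined E (exp_op C vacuum)"
    "\<exists>invD. D_ser k l i j c d * invD = 1 \<and>
            (let s = subst_w (N1_ser k l i j c d * invD) (N2_ser k l i j c d * invD) in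
              formally_summable (subst_term s (f_ser k l)) \<and>
              exp_op E (exp_op C vacuum) = fock_const (invD * subst s (f_ser k l)))"
proof -
  define J where "J = case_wvar i j"
  have J: "J v \<ge> 1" for v using i j by (cases v) (auto simp: J_def)
  interpret t: tau_pair "idx l k" "\<lambda>v. phi (- int (J v)) \<circ> phistar (- int (idx l k v))" "\<lambda>v. Gser (idx l k) (J v)" 1
    by (rule tau_pair_phi_phistar[OF J])
  show "exp_op_defined C vacuum" "exp_op_defined E (exp_op C vacuum)"
    using t.defined(1)[of c] t.defined(2)[of d c] by (simp_all add: C_def E_def J_def)
  let ?c = "mps_const c :: xyser" and ?d = "mps_const d :: xyser"
  have D: "D_ser k l i j c d = (1 - ?c * A_ser i l) * (1 - ?d * A_ser j k) - ?c * A_ser i k * (?d * A_ser j l)"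
    by (simp add: D_ser_def algebra_simps)
  have ord: "order_ge 1 (e * A_ser m t)" if "m \<ge> 1" for e m t
    by (rule order_ge_times_any[OF order_ge_A_ser[OF that]])
  \<comment> \<open>D is 1 up to positive weight, hence invertible.\<close>
  have "order_ge 1 (D_ser k l i j c d - 1)"
    unfolding D_ser_def by (simp, intro order_ge_add order_ge_diff order_ge_uminus order_ge_times_any ord order_ge_A_ser i j)
  then have "mps_coeff (D_ser k l i j c d) {#} = 1"
    by (auto simp: order_ge_def minus_mps.rep_eq one_mps.rep_eq weight_def dest!: spec[of _ "{#}"])
  then obtain invD where invD: "D_ser k l i j c d * invD = 1" using mps_inverse_exists by blast
  \<comment> \<open>The data of -c G_i and -d G_j; the sign makes the parts linear in w positive,
    and the determinant is D.\<close>
  interpret a: affine_pair "- ?c * Sminus (i - 1)" "- ?d * Sminus (j - 1)"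
     "?c * A_ser i l" "?c * A_ser i k" "?d * A_ser j l" "?d * A_ser j k" invD
    by unfold_locales (use ord i j invD D in auto)
  define s where "s = subst_w (N1_ser k l i j c d * invD) (N2_ser k l i j c d * invD)"
  have s: "a.sol = s"
  proof
    fix v show "a.sol v = s v"
      unfolding a.sol_def s_def subst_w_def N1_ser_def N2_ser_def
      by (cases v) (simp_all add: algebra_simps del: mps_const_simps)
  qed
  have g1: "a.g1 = mps_const (mps_const (- c)) * Gser (idx l k) i"
    and g2: "a.g2 = mps_const (mps_const (- d)) * Gser (idx l k) j"
    unfolding a.g1_def a.g2_def Gser_eq[OF i] Gser_eq[OF j]
    by (simp_all add: right_diff_distrib mult.assoc[symmetric] mps_const_times flip: mps_const_simps(5))
  have "mps_const (e ^ m) = (mps_const e :: xyser) ^ m" "mps_const (x ^ m) = (mps_const x :: wser) ^ m" for e x m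
    by (induction m) (simp_all flip: mps_const_times)
  then have coef: "coef m n (a.g1 ^ m * a.g2 ^ n * f_ser k l) =
     mps_const ((- c) ^ m * (- d) ^ n) * coef m n (Gser (idx l k) i ^ m * Gser (idx l k) j ^ n * f_ser k l)" for m n
  proof -
    have "a.g1 ^ m * a.g2 ^ n * f_ser k l = mps_const (mps_const ((- c) ^ m * (- d) ^ n)) * (Gser (idx l k) i ^ m * Gser (idx l k) j ^ n * f_ser k l)"
      unfolding g1 g2 power_mult_distrib mps_const_times[symmetric]
      using \<open>\<And>m e. mps_const (e ^ m) = (mps_const e :: xyser) ^ m\<close> \<open>\<And>x m. mps_const (x ^ m) = (mps_const x :: wser) ^ m\<close>
      by (simp only: mult_ac)
    then show ?thesis by (simp only: coef_simps)
  qed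
  have ad: "adapted 0 (f_ser k l)" unfolding f_ser_eq by (rule adapted_ftau)
  have "exp_op E (exp_op C vacuum) = fock_const (invD * subst s (f_ser k l))"
  proof
    fix q
    have "exp_op E (exp_op C vacuum) q = formal_sum (\<lambda>n. formal_sum (\<lambda>m. mps_const ((- c) ^ m * (- d) ^ n) * t.tvec m n q))"
      using t.exp_exp[of d c q] by (simp add: C_def E_def J_def)
    also have "\<dots> = fock_const (invD * subst s (f_ser k l)) q"
    proof (cases "q = 0")
      case True
      then have "mps_const ((- c) ^ m * (- d) ^ n) * t.tvec m n q = coef m n (a.g1 ^ m * a.g2 ^ n * f_ser k l)" for m n
        unfolding coef unfolding t.tvec_def vec_def coef_def f_ser_eq by (simp add: J_def)
      then have "formal_sum (\<lambda>n. formal_sum (\<lambda>m. mps_const ((- c) ^ m * (- d) ^ n) * t.tvec m n q)) =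
          formal_sum (\<lambda>n. formal_sum (\<lambda>m. coef m n (a.g1 ^ m * a.g2 ^ n * f_ser k l)))"
        by (simp only:)
      also have "\<dots> = invD * subst a.sol (f_ser k l)"
        by (rule a.lagrange_good[OF ad])
      finally show ?thesis using True by (simp only: s fock_const_def simp_thms if_True)
    next
      case False
      \<comment> \<open>Each of the m + n pairs contributes p from \<open>phistar\<close> and p^-1
        from \<open>phi\<close>, so only q = 0 survives.\<close>
      then have "t.tvec m n q = 0" for m n unfolding t.tvec_def vec_def by simp
      then show ?thesis using False by (simp add: fock_const_def formal_sum_zero)
    qed
    finally show "exp_op E (exp_op C vacuum) q = fock_const (invD * subst s (f_ser k l)) q" .
  qed
  then show "\<exists>invD. D_ser k l i j c d * invD = 1 \<and>
            (let s = subst_w (N1_ser k l i j c d * invD) (N2_ser k l i j c d * invD) in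
              formally_summable (subst_term s (f_ser k l)) \<and>
              exp_op E (exp_op C vacuum) = fock_const (invD * subst s (f_ser k l)))"
    using invD a.summable_subst[OF ad] by (auto simp: Let_def s_def)
qed

theorem corollary3p2:
  fixes k l :: nat
  assumes "l \<le> k"
  shows
    "(exp_deriv_z_w (f_ser k l) =
       (1 - schur_poly_z l * fps_const w1 - schur_poly_z k * fps_const w2) * fps_const (f_ser k l))
     \<and>
     (\<forall>a b :: complex.
       let A = scale_op a (phistar (- int l)); B = scale_op b (phistar (- int k)) in
         exp_op_defined A vacuum \<and>
         exp_op_defined B (exp_op A vacuum) \<and>
         exp_op B (exp_op A vacuum) = subst_p (- a) (- b) (f_ser k l))
     \<and>
     (\<forall>i j :: nat. \<forall>c d :: complex. i \<ge> 1 \<longrightarrow> j \<ge> 1 \<longrightarrow>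
       (let C = scale_op c (phi (- int i) \<circ> phistar (- int l));
            E = scale_op d (phi (- int j) \<circ> phistar (- int k)) in
         exp_op_defined C vacuum \<and>
         exp_op_defined E (exp_op C vacuum) \<and>
         (\<exists>invD. D_ser k l i j c d * invD = 1 \<and>
            (let s = subst_w (N1_ser k l i j c d * invD) (N2_ser k l i j c d * invD) in
              formally_summable (subst_term s (f_ser k l)) \<and>
              exp_op E (exp_op C vacuum) = fock_const (invD * subst s (f_ser k l))))))"
  unfolding Let_def by (intro conjI allI impI exp_deriv_z_w_f_ser exp_phistar_phistar exp_phi_phistar[unfolded Let_def])

end
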